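(* Let the moment assumption and the boundedness assumption of the context hold, let $Y\neq0$ and $D_{\mathrm{KL}}(f_1\|f_0)<\infty$, and write $\Lambda_{\max}=\sup_x\Lambda^{(s)}(x)\in(0,\infty)$ and $\lambda_p=\log\{1/(1-p)\}$ for $p\in(0,1)$. (a) (Tilt.) The equation $\mathbb E_0\exp(\theta\Lambda^{(s)})=1$ has the root $\theta=0$ and exactly one root $\theta_0>0$. Consequently $\tilde f_0=e^{\theta_0\Lambda^{(s)}}f_0$ is a probability density, and $e^{Z_n}$ with $Z_n=\theta_0\Lambda^{(s)}(x_n)$ is the likelihood ratio of $\tilde f_0$ against $f_0$ at $x_n$. (b) (False alarms.) $\mathbb E_\infty T_h\ge e^{h}$ for every $h>0$; $\mathbb E_\infty T_A\ge A$ for every $A>0$; and, for the Shiryaev rule with geometric prior parameter $p\in(0,1)$, $\mathrm{PFA}(T_B)\le(1+B)^{-1}$ for every $B>0$. Moreover, for the increment $\Lambda^{(s)}$ (and $\theta_0$) held fixed, $\mathrm{PFA}(T_B)$ depends on the observation model only through $f_0$ and $p$ (it is unchanged if the post-change density of the observations is replaced by another one). (c) (Delay.) Let $(\beta,c)=(h,0)$ for $T=T_h$, $(\beta,c)=(\log A,0)$ for $T=T_A$, and $(\beta,c)=(\log(B/p),\lambda_p)$ for $T=T_B$, and let the threshold satisfy $\beta>0$, i.e. $h>0$, $A>1$, $B>p$ respectively. Then $$\mathrm{ADD}(T)\ \le\ \frac{\beta+\theta_0\Lambda_{\max}+c}{\theta_0\mathbb E_1\Lambda^{(s)}+c},\qquad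 \mathbb E_1\Lambda^{(s)}=\tfrac12J(s)>0,$$ and for the Shiryaev rule $\mathbb E[(T_B-\tau+1)^{+}\mid T_B\ge\tau]$, under the joint law of the geometric prior on $\tau$ and the observations, is bounded by the same quantity. (d) (Efficiency.) Put $$e(s)=\frac{\theta_0\,\mathbb E_1\Lambda^{(s)}}{D_{\mathrm{KL}}(f_1\|f_0)}.$$ Then $0<e(s)\le1$, with equality $e(s)=1$ if and only if $\theta_0\Lambda^{(s)}=\ell$ $f_0$-almost surely, where $\ell=\ln(f_1/f_0)$. Moreover, at the thresholds $h=\log\gamma$ and $A=\gamma$ (which ensure $\mathbb E_\infty T\ge\gamma$) and $B=\alpha^{-1}-1$ (which ensures $\mathrm{PFA}(T_B)\le\alpha$), the delay of each rule exceeds the corresponding asymptotic optimum — $\log\gamma/D_{\mathrm{KL}}(f_1\|f_0)$ for $T_h$ and $T_A$, and $\log(1/\alpha)/\{D_{\mathrm{KL}}(f_1\|f_0)+\lambda_p\}$ for $T_B$ with $p$ fixed — by a factor of at most $(1+o(1))/e(s)$ as $\gamma\to\infty$, respectively $\alpha\to0$; at finite $\gamma$ the overshoot term $\theta_0\Lambda_{\max}$ in (c) adds $O(1/\log\gamma)$ to the ratio. (e) (Local limit.) Let the local-family assumption of the context hold with $f_1=g_\theta$, and assume in addition that $Y=Y(\theta)\neq0$ for $\theta>0$ and that $D_{\mathrm{KL}}(g_\theta\|f_0)=\theta^2I/2+o(\theta^2)$. Then, as $\theta\downarrow0$ (with the dictionary and $f_0$ fixed), $\theta_0\to2$ and $$e(s)\longrightarrow\kappa(\Phi):=\frac{B^{\top}C_0^{-1}B}{I},\qquad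 B_i=\mathbb E_0[(\varphi-u_0)_i\,q],\quad i=1,\dots,s$$ (here $B$ denotes this vector, not the threshold), where $0\le\kappa(\Phi)\le1$, with $\kappa(\Phi)=1$ if and only if $q$ lies in the span of $(\varphi-u_0)_1,\dots,(\varphi-u_0)_s$ $f_0$-almost surely.
   Context: Observations $x_1,x_2,\dots$ are real and independent. Under $\mathbb P_\infty$ every $x_t$ has density $f_0$; under $\mathbb P_\tau$ ($\tau\ge1$) $x_t$ has density $f_0$ for $t<\tau$ and $f_1$ for $t\ge\tau$. Expectations: $\mathbb E_\infty$ and $\mathbb E_\tau$ for the sequence; in contrast $\mathbb E_0,\mathbb E_1$ (and $\mathrm{Cov}_0,\mathrm{Cov}_1$) always refer to a single observation $x$ with density $f_0$, $f_1$. Dictionary $\Phi$: a vector $\varphi=(\varphi_1,\dots,\varphi_s)^{\top}$ of real functions. $u_j=\mathbb E_j\varphi$, $C_j=\mathrm{Cov}_j\varphi$ ($j=0,1$), $F=C_0+C_1$, $Y=u_1-u_0$, $K=F^{-1}Y$, $J(s)=Y^{\top}F^{-1}Y$, $\Lambda^{(s)}(x)=K^{\top}(\varphi(x)-\tfrac12(u_0+u_1))$. Moment assumption: every $\varphi_i$ has a finite second moment under $f_0$ and $f_1$; $C_0$ is positive definite; $f_1$ vanishes wherever $f_0$ does. Boundedness assumption: there is $\varphi_{\max}<\infty$ with $|\varphi_i(x)|\le\varphi_{\max}$ for all $i$ and $x$. Stopping rules, driven by $Z_n=\theta_0\Lambda^{(s)}(x_n)$, where $\theta_0$ is the positive root of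 $\mathbb E_0e^{\theta\Lambda^{(s)}}=1$: CUSUM: $W_0=0$, $W_n=\max(0,W_{n-1}+Z_n)$, $T_h=\inf\{n\ge1:W_n\ge h\}$. Shiryaev–Roberts: $R_0=0$, $R_n=(1+R_{n-1})e^{Z_n}$, $T_A=\inf\{n\ge1:R_n\ge A\}$. Shiryaev with parameter $p\in(0,1)$: $S_0=0$, $S_n=(p+S_{n-1})e^{Z_n}/(1-p)$, $T_B=\inf\{n\ge1:S_n\ge B\}$, with geometric prior $\Pr(\tau=k)=p(1-p)^{k-1}$, $k\ge1$, on the change time. Metrics: $\mathrm{ADD}(T)=\sup_{\tau\ge1}\operatorname{ess\,sup}\mathbb E_\tau[(T-\tau+1)^{+}\mid x_1,\dots,x_{\tau-1}]$; $\mathrm{PFA}(T)=\Pr(T<\tau)$ under the joint law of the prior on $\tau$ and the observations (given $\tau=k$ the observations follow $\mathbb P_k$). $D_{\mathrm{KL}}(f\|g)=\int f\ln(f/g)$. The "asymptotic optimum" values in (d) are the known first-order minimal delays: Lorden's, over stopping times with $\mathbb E_\infty T\ge\gamma$, and the Bayesian one, over stopping times with $\mathrm{PFA}(T)\le\alpha$. Local-family assumption (used only in (e)): $\{g_\theta:\theta\ge0\}$ is a family of densities with $g_0=f_0$, differentiable in quadratic mean at $\theta=0$ with score $q\in L^2(f_0)$ (i.e. $\|\sqrt{g_\theta}-\sqrt{f_0}-\tfrac12\theta q\sqrt{f_0}\|_{L^2}=o(\theta)$), $\mathbb E_0q=0$, Fisher information $I=\mathbb E_0q^2\in(0,\infty)$;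 the post-change law is $f_1=g_\theta$, $\theta>0$. *)

theory Defs
  imports "HOL-Probability.Probability" "HOL-Library.Landau_Symbols"
begin

section \<open>One observation\<close>

text \<open>Densities are taken with respect to Lebesgue measure on the real line.\<close>

definition law :: "(real \<Rightarrow> real) \<Rightarrow> real measure" where
  "law f = density lborel (\<lambda>x. ennreal (f x))"

definition prob_density :: "(real \<Rightarrow> real) \<Rightarrow> bool" where
  "prob_density f \<longleftrightarrow> f \<in> borel_measurable borel \<and> (\<forall>x. 0 \<le> f x) \<and> prob_space (law f)"

definition D_KL :: "(real \<Rightarrow> real) \<Rightarrow> (real \<Rightarrow> real) \<Rightarrow> real" where
  "D_KL f g = (\<integral>x. f x * ln (f x / g x) \<partial>lborel)"

text \<open>The negative part of the integrand of \<^const>\<open>D_KL\<close> is always integrable when \<open>f\<close> vanishes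
  wherever \<open>g\<close> does, so in that case integrability says exactly that the divergence is finite.
  For non-integrable integrands \<^const>\<open>D_KL\<close> has the junk value 0.\<close>

definition D_KL_finite :: "(real \<Rightarrow> real) \<Rightarrow> (real \<Rightarrow> real) \<Rightarrow> bool" where
  "D_KL_finite f g \<longleftrightarrow> integrable lborel (\<lambda>x. f x * ln (f x / g x))"

lemma D_KL_eq_KL_divergence:
  assumes "prob_density f" "prob_density g" "\<And>x. g x = 0 \<Longrightarrow> f x = 0"
  shows "D_KL f g = KL_divergence (exp 1) (law g) (law f)"
proof -
  have "KL_divergence (exp 1) (law g) (law f) = (\<integral>x. f x * log (exp 1) (f x / g x) \<partial>lborel)"
    unfolding law_def using assms
    by (intro lborel.KL_density_density) (auto simp: prob_density_def)
  then show ?thesis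
    by (simp add: D_KL_def log_def)
qed

text \<open>The log-likelihood ratio has the value \<open>-\<infinity>\<close> where \<open>f\<^sub>1\<close> vanishes
  (in HOL, \<open>ln 0\<close> would be 0). Its value where \<open>f\<^sub>0\<close> vanishes is immaterial.\<close>

definition log_lr :: "(real \<Rightarrow> real) \<Rightarrow> (real \<Rightarrow> real) \<Rightarrow> real \<Rightarrow> ereal" where
  "log_lr f1 f0 x = (if f1 x = 0 then -\<infinity> else ereal (ln (f1 x / f0 x)))"

section \<open>The dictionary\<close>

definition mean :: "(real \<Rightarrow> real ^ 's) \<Rightarrow> (real \<Rightarrow> real) \<Rightarrow> real ^ 's" where
  "mean \<phi> f = (\<chi> i. \<integral>x. \<phi> x $ i \<partial>law f)"

definition Cov :: "(real \<Rightarrow> real ^ 's) \<Rightarrow> (real \<Rightarrow> real) \<Rightarrow> real ^ 's ^ 's" where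
  "Cov \<phi> f = (\<chi> i j. \<integral>x. (\<phi> x $ i - mean \<phi> f $ i) * (\<phi> x $ j - mean \<phi> f $ j) \<partial>law f)"

text \<open>Applied only to covariance matrices, which are symmetric.\<close>

definition positive_definite :: "real ^ 's ^ 's \<Rightarrow> bool" where
  "positive_definite A \<longleftrightarrow> (\<forall>v. v \<noteq> 0 \<longrightarrow> 0 < v \<bullet> (A *v v))"

definition moment_assumption ::
    "(real \<Rightarrow> real ^ 's) \<Rightarrow> (real \<Rightarrow> real) \<Rightarrow> (real \<Rightarrow> real) \<Rightarrow> bool" where
  "moment_assumption \<phi> f0 f1 \<longleftrightarrow>
     (\<forall>i. integrable (law f0) (\<lambda>x. (\<phi> x $ i)\<^sup>2) \<and> integrable (law f1) (\<lambda>x. (\<phi> x $ i)\<^sup>2)) \<and>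
     positive_definite (Cov \<phi> f0) \<and>
     (\<forall>x. f0 x = 0 \<longrightarrow> f1 x = 0)"

definition boundedness_assumption :: "(real \<Rightarrow> real ^ 's) \<Rightarrow> bool" where
  "boundedness_assumption \<phi> \<longleftrightarrow> (\<exists>\<phi>max. \<forall>i x. \<bar>\<phi> x $ i\<bar> \<le> \<phi>max)"

definition F_mat :: "(real \<Rightarrow> real ^ 's) \<Rightarrow> (real \<Rightarrow> real) \<Rightarrow> (real \<Rightarrow> real) \<Rightarrow> real ^ 's ^ 's" where
  "F_mat \<phi> f0 f1 = Cov \<phi> f0 + Cov \<phi> f1"

definition Y_vec :: "(real \<Rightarrow> real ^ 's) \<Rightarrow> (real \<Rightarrow> real) \<Rightarrow> (real \<Rightarrow> real) \<Rightarrow> real ^ 's" where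
  "Y_vec \<phi> f0 f1 = mean \<phi> f1 - mean \<phi> f0"

definition K_vec :: "(real \<Rightarrow> real ^ 's) \<Rightarrow> (real \<Rightarrow> real) \<Rightarrow> (real \<Rightarrow> real) \<Rightarrow> real ^ 's" where
  "K_vec \<phi> f0 f1 = matrix_inv (F_mat \<phi> f0 f1) *v Y_vec \<phi> f0 f1"

definition J_val :: "(real \<Rightarrow> real ^ 's) \<Rightarrow> (real \<Rightarrow> real) \<Rightarrow> (real \<Rightarrow> real) \<Rightarrow> real" where
  "J_val \<phi> f0 f1 = Y_vec \<phi> f0 f1 \<bullet> (matrix_inv (F_mat \<phi> f0 f1) *v Y_vec \<phi> f0 f1)"

definition Lam :: "(real \<Rightarrow> real ^ 's) \<Rightarrow> (real \<Rightarrow> real) \<Rightarrow> (real \<Rightarrow> real) \<Rightarrow> real \<Rightarrow> real" where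
  "Lam \<phi> f0 f1 x = K_vec \<phi> f0 f1 \<bullet> (\<phi> x - (1/2) *\<^sub>R (mean \<phi> f0 + mean \<phi> f1))"

definition theta0 :: "(real \<Rightarrow> real ^ 's) \<Rightarrow> (real \<Rightarrow> real) \<Rightarrow> (real \<Rightarrow> real) \<Rightarrow> real" where
  "theta0 \<phi> f0 f1 = (THE \<theta>. 0 < \<theta> \<and> (\<integral>x. exp (\<theta> * Lam \<phi> f0 f1 x) \<partial>law f0) = 1)"

definition efficiency :: "(real \<Rightarrow> real ^ 's) \<Rightarrow> (real \<Rightarrow> real) \<Rightarrow> (real \<Rightarrow> real) \<Rightarrow> real" where
  "efficiency \<phi> f0 f1 = theta0 \<phi> f0 f1 * (\<integral>x. Lam \<phi> f0 f1 x \<partial>law f1) / D_KL f1 f0"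

section \<open>The observation sequence\<close>

text \<open>Sample points are sequences indexed by \<open>1, 2, \<dots>\<close>; the observation \<open>x\<^sub>t\<close> is the coordinate at
  \<open>t\<close>. The change time \<open>\<tau> = \<infinity>\<close> is the law without a change.\<close>

definition obs_space :: "(nat \<Rightarrow> real) measure" where
  "obs_space = (\<Pi>\<^sub>M t\<in>{1..}. borel)"

definition obs_law ::
    "(real \<Rightarrow> real) \<Rightarrow> (real \<Rightarrow> real) \<Rightarrow> enat \<Rightarrow> (nat \<Rightarrow> real) measure" where
  "obs_law f0 f1 \<tau> = (\<Pi>\<^sub>M t\<in>{1..}. law (if enat t < \<tau> then f0 else f1))"

text \<open>The \<open>\<sigma>\<close>-algebra generated by \<open>x\<^sub>1, \<dots>, x\<^bsub>\<tau>-1\<^esub>\<close>; it is trivial for \<open>\<tau> = 1\<close>.\<close>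

definition history :: "nat \<Rightarrow> (nat \<Rightarrow> real) measure" where
  "history \<tau> =
     vimage_algebra (space obs_space) (\<lambda>\<omega>. restrict \<omega> {1..<\<tau>}) (\<Pi>\<^sub>M t\<in>{1..<\<tau>}. borel)"

section \<open>Stopping rules\<close>

text \<open>The increment at time \<open>n\<close> is \<open>z (x\<^sub>n)\<close>.\<close>

primrec cusum_stat :: "(real \<Rightarrow> real) \<Rightarrow> (nat \<Rightarrow> real) \<Rightarrow> nat \<Rightarrow> real" where
  "cusum_stat z \<omega> 0 = 0"
| "cusum_stat z \<omega> (Suc n) = max 0 (cusum_stat z \<omega> n + z (\<omega> (Suc n)))"

primrec sr_stat :: "(real \<Rightarrow> real) \<Rightarrow> (nat \<Rightarrow> real) \<Rightarrow> nat \<Rightarrow> real" where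
  "sr_stat z \<omega> 0 = 0"
| "sr_stat z \<omega> (Suc n) = (1 + sr_stat z \<omega> n) * exp (z (\<omega> (Suc n)))"

primrec shiryaev_stat :: "real \<Rightarrow> (real \<Rightarrow> real) \<Rightarrow> (nat \<Rightarrow> real) \<Rightarrow> nat \<Rightarrow> real" where
  "shiryaev_stat p z \<omega> 0 = 0"
| "shiryaev_stat p z \<omega> (Suc n) = (p + shiryaev_stat p z \<omega> n) * exp (z (\<omega> (Suc n))) / (1 - p)"

definition first_passage :: "(nat \<Rightarrow> real) \<Rightarrow> real \<Rightarrow> enat" where
  "first_passage s b = Inf {enat n | n. 1 \<le> n \<and> b \<le> s n}"

definition T_cusum :: "(real \<Rightarrow> real) \<Rightarrow> real \<Rightarrow> (nat \<Rightarrow> real) \<Rightarrow> enat" where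
  "T_cusum z h \<omega> = first_passage (cusum_stat z \<omega>) h"

definition T_sr :: "(real \<Rightarrow> real) \<Rightarrow> real \<Rightarrow> (nat \<Rightarrow> real) \<Rightarrow> enat" where
  "T_sr z A \<omega> = first_passage (sr_stat z \<omega>) A"

definition T_shiryaev :: "real \<Rightarrow> (real \<Rightarrow> real) \<Rightarrow> real \<Rightarrow> (nat \<Rightarrow> real) \<Rightarrow> enat" where
  "T_shiryaev p z B \<omega> = first_passage (shiryaev_stat p z \<omega>) B"

section \<open>Metrics\<close>

definition mean_time_no_change ::
    "(real \<Rightarrow> real) \<Rightarrow> (real \<Rightarrow> real) \<Rightarrow> ((nat \<Rightarrow> real) \<Rightarrow> enat) \<Rightarrow> ennreal" where
  "mean_time_no_change f0 f1 T = (\<integral>\<^sup>+\<omega>. ennreal_of_enat (T \<omega>) \<partial>obs_law f0 f1 \<infinity>)"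

text \<open>Subtraction on \<^typ>\<open>enat\<close> is truncated at 0, so this is \<open>(T - \<tau> + 1)\<^sup>+\<close>.\<close>

definition delay :: "enat \<Rightarrow> nat \<Rightarrow> ennreal" where
  "delay T \<tau> = ennreal_of_enat (T + 1 - enat \<tau>)"

definition ADD ::
    "(real \<Rightarrow> real) \<Rightarrow> (real \<Rightarrow> real) \<Rightarrow> ((nat \<Rightarrow> real) \<Rightarrow> enat) \<Rightarrow> ennreal" where
  "ADD f0 f1 T = (SUP \<tau>\<in>{1..}.
     esssup (obs_law f0 f1 (enat \<tau>))
       (nn_cond_exp (obs_law f0 f1 (enat \<tau>)) (history \<tau>) (\<lambda>\<omega>. delay (T \<omega>) \<tau>)))"

text \<open>\<^const>\<open>geometric_pmf\<close> lives on \<open>0, 1, 2, \<dots>\<close>, hence the shift by \<^const>\<open>Suc\<close>.\<close>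

definition change_prior :: "real \<Rightarrow> nat pmf" where
  "change_prior p = map_pmf Suc (geometric_pmf p)"

definition joint_law ::
    "(real \<Rightarrow> real) \<Rightarrow> (real \<Rightarrow> real) \<Rightarrow> real \<Rightarrow> (nat \<times> (nat \<Rightarrow> real)) measure" where
  "joint_law f0 f1 p = measure_pmf (change_prior p) \<bind>
     (\<lambda>k. distr (obs_law f0 f1 (enat k)) (count_space UNIV \<Otimes>\<^sub>M obs_space) (Pair k))"

definition PFA ::
    "(real \<Rightarrow> real) \<Rightarrow> (real \<Rightarrow> real) \<Rightarrow> real \<Rightarrow> ((nat \<Rightarrow> real) \<Rightarrow> enat) \<Rightarrow> real" where
  "PFA f0 f1 p T =
     measure (joint_law f0 f1 p) {(k, \<omega>) \<in> space (joint_law f0 f1 p). T \<omega> < enat k}"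

definition bayes_delay ::
    "(real \<Rightarrow> real) \<Rightarrow> (real \<Rightarrow> real) \<Rightarrow> real \<Rightarrow> ((nat \<Rightarrow> real) \<Rightarrow> enat) \<Rightarrow> ennreal" where
  "bayes_delay f0 f1 p T =
     (\<integral>\<^sup>+y. delay (T (snd y)) (fst y) * indicator {(k, \<omega>). enat k \<le> T \<omega>} y \<partial>joint_law f0 f1 p) /
     emeasure (joint_law f0 f1 p) {(k, \<omega>) \<in> space (joint_law f0 f1 p). enat k \<le> T \<omega>}"

definition lambda_p :: "real \<Rightarrow> real" where
  "lambda_p p = ln (1 / (1 - p))"

section \<open>Local families\<close>

definition fisher_info :: "(real \<Rightarrow> real) \<Rightarrow> (real \<Rightarrow> real) \<Rightarrow> real" where
  "fisher_info f0 q = (\<integral>x. (q x)\<^sup>2 \<partial>law f0)"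

text \<open>Differentiability in quadratic mean at 0; the integrand under the square root is integrable
  because \<open>q \<in> L\<^sup>2(f\<^sub>0)\<close>.\<close>

definition local_family ::
    "(real \<Rightarrow> real) \<Rightarrow> (real \<Rightarrow> real \<Rightarrow> real) \<Rightarrow> (real \<Rightarrow> real) \<Rightarrow> bool" where
  "local_family f0 g q \<longleftrightarrow>
     (\<forall>\<theta>\<ge>0. prob_density (g \<theta>)) \<and> g 0 = f0 \<and>
     q \<in> borel_measurable borel \<and> integrable (law f0) (\<lambda>x. (q x)\<^sup>2) \<and>
     (\<lambda>\<theta>. sqrt (\<integral>x. (sqrt (g \<theta> x) - sqrt (f0 x) - 1/2 * \<theta> * q x * sqrt (f0 x))\<^sup>2 \<partial>lborel))
       \<in> o[at_right 0](\<lambda>\<theta>. \<theta>) \<and>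
     (\<integral>x. q x \<partial>law f0) = 0 \<and> 0 < fisher_info f0 q"

definition score_vec ::
    "(real \<Rightarrow> real ^ 's) \<Rightarrow> (real \<Rightarrow> real) \<Rightarrow> (real \<Rightarrow> real) \<Rightarrow> real ^ 's" where
  "score_vec \<phi> f0 q = (\<chi> i. \<integral>x. (\<phi> x - mean \<phi> f0) $ i * q x \<partial>law f0)"

definition kappa :: "(real \<Rightarrow> real ^ 's) \<Rightarrow> (real \<Rightarrow> real) \<Rightarrow> (real \<Rightarrow> real) \<Rightarrow> real" where
  "kappa \<phi> f0 q =
     (score_vec \<phi> f0 q \<bullet> (matrix_inv (Cov \<phi> f0) *v score_vec \<phi> f0 q)) / fisher_info f0 q"

end

theory Submission
  imports Defs
begin

text \<open>Since \<open>e\<^bsup>Z\<^esup>\<close> has mean 1 under \<open>f\<^sub>0\<close>, the processes \<open>R\<^sub>n - n\<close> and \<open>(1 - p)\<^sup>n (1 + S\<^sub>n)\<close> are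
  martingales without a change, and stopping them at the alarm gives the false alarm bounds;
  CUSUM is reduced to Shiryaev--Roberts by \<open>e\<^bsup>W\<^esup> \<le> 1 + R\<close>. Whatever the past, each statistic
  dominates from the change time on the random walk restarted there, so Wald's identity with an overshoot
  of at most one increment bounds the delay. The efficiency bound is Gibbs' inequality for \<open>f\<^sub>1\<close>
  and the tilted density. For the local limit, \<open>E\<^sub>0 exp (t \<Lambda>) - 1\<close> is expanded to second order:
  divided by the variance of \<open>\<Lambda>\<close> it tends to \<open>t (t - 2) / 2\<close>, whose positive root is 2.\<close>

text \<open>Apart from comparisons between rules, an alarm time is used only through its survival
  events: that no alarm has occurred by n depends on the first n observations, and means are sums of
  survival probabilities. Optional stopping becomes a one-step inequality on the survivors, where
  the statistic is below its threshold and every expectation exists; discarding the overshoot at the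
  alarm turns the martingale identity into an inequality. For the worst-case delay the obstacle is
  that the alarm time depends on the past. It is dominated by a count that uses only observations
  from the change on, and conditioning on the past leaves the mean of that count unchanged. In the
  local limit \<Lambda> varies with \<theta> and shrinks faster than \<theta> when the score is
  orthogonal to the dictionary. Hence the normalisation by the variance and not by \<theta>^2. The
  value 2 comes from F being close to twice C_0, so that J is close to twice the variance. The root
  is located by the sign of the expansion at fixed arguments, with no implicit function
  argument.\<close>

declare One_nat_def [simp del] \<comment> \<open>keeps \<open>{1..n}\<close> from becoming \<open>{Suc 0..n}\<close>\<close>

section \<open>Functions of finitely many observations\<close>

text \<open>Survival past n is a condition on finitely many values of the statistic; measurability
  and independence of alarm times are read off from this form. Alarms start at time 1, so time 0 is
  always survived.\<close>

lemma enat_less_first_passage_iff: "enat n < first_passage s b \<longleftrightarrow> (\<forall>i\<in>{1..n}. s i < b)"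
proof
  assume *: "enat n < first_passage s b"
  show "\<forall>i\<in>{1..n}. s i < b"
  proof (rule ballI, rule ccontr)
    fix i assume "i \<in> {1..n}" "\<not> s i < b"
    then have "first_passage s b \<le> enat i"
      unfolding first_passage_def by (intro Inf_lower) auto
    with * \<open>i \<in> {1..n}\<close> show False
      by (cases "first_passage s b") auto
  qed
next
  assume *: "\<forall>i\<in>{1..n}. s i < b"
  have "eSuc (enat n) \<le> first_passage s b"
    unfolding first_passage_def
  proof (rule Inf_greatest)
    fix a assume "a \<in> {enat n |n. 1 \<le> n \<and> b \<le> s n}"
    then obtain m where "a = enat m" "1 \<le> m" "b \<le> s m"
      by auto
    with * show "eSuc (enat n) \<le> a"
      by (simp add: eSuc_enat Suc_le_eq) (meson atLeastAtMost_iff not_le)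
  qed
  then show "enat n < first_passage s b"
    by (simp add: ileI1 eSuc_enat Suc_ile_eq)
qed

text \<open>A possibly infinite time counts the instants that it survives. Integrating termwise
  gives its mean as a sum of survival probabilities, with no separate case for an alarm that never
  comes.\<close>

lemma ennreal_of_enat_eq_suminf:
  "ennreal_of_enat t = (\<Sum>n. of_bool (enat n < t))"
proof -
  have "(\<lambda>i::nat. if i < t then 1 else 0) sums ennreal_of_enat t"
    using sums_If_finite[of "\<lambda>r. r < t" "\<lambda>_. 1 :: ennreal"]
    by (cases t) (simp_all add: sums_def of_nat_tendsto_top_ennreal)
  then show ?thesis
    by (simp add: sums_iff of_bool_def)
qed

text \<open>The unit of delay with index m is incurred when there is no alarm by time \<tau> + m -
  1; for m = 0 this says that the alarm is not before the change. The subtraction is exact because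
  \<tau> is at least 1.\<close>

lemma delay_eq_suminf:
  assumes "1 \<le> \<tau>"
  shows "delay T \<tau> = (\<Sum>m. of_bool (enat (\<tau> + m - 1) < T))"
proof -
  have "enat m < T + 1 - enat \<tau> \<longleftrightarrow> enat (\<tau> + m - 1) < T" for m
    using assms by (cases T) (auto simp: one_enat_def)
  then show ?thesis
    unfolding delay_def ennreal_of_enat_eq_suminf by simp
qed

lemma less_enat_iff_not_enat_less: "1 \<le> k \<Longrightarrow> T < enat k \<longleftrightarrow> \<not> enat (k - 1) < T"
  by (cases T) auto

text \<open>Statistics stay functions on whole sequences instead of finite products. Invariance
  under \<open>restrict\<close> says that \<open>U\<close> factors through the coordinates in
  \<open>J\<close>, so the same \<open>U\<close> can be read on any larger product, and independence
  of disjoint blocks applies to it directly.\<close>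

definition depends_on :: "nat set \<Rightarrow> 'b measure \<Rightarrow> ((nat \<Rightarrow> real) \<Rightarrow> 'b) \<Rightarrow> bool" where
  "depends_on J N U \<longleftrightarrow> U \<in> measurable (\<Pi>\<^sub>M i\<in>J. borel) N \<and> (\<forall>\<omega>. U (restrict \<omega> J) = U \<omega>)"

lemma depends_on_mono:
  assumes "depends_on J N U" "J \<subseteq> K"
  shows "depends_on K N U"
proof -
  have eq: "U = (\<lambda>\<omega>. U (restrict \<omega> J))"
    using assms by (auto simp: depends_on_def)
  have U [measurable]: "U \<in> measurable (\<Pi>\<^sub>M i\<in>J. borel) N"
    using assms by (auto simp: depends_on_def)
  have [measurable]: "(\<lambda>\<omega>. restrict \<omega> J) \<in> measurable (\<Pi>\<^sub>M i\<in>K. borel) (\<Pi>\<^sub>M i\<in>J. borel)"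
    using assms(2) by (rule measurable_restrict_subset)
  have "U \<in> measurable (\<Pi>\<^sub>M i\<in>K. borel) N"
    by (subst eq) measurable
  moreover have "U (restrict \<omega> K) = U \<omega>" for \<omega>
  proof -
    have "restrict (restrict \<omega> K) J = restrict \<omega> J"
      using assms(2) by (auto simp: restrict_def fun_eq_iff)
    then show ?thesis
      by (subst (1 2) eq) simp
  qed
  ultimately show ?thesis
    by (simp add: depends_on_def)
qed

lemma depends_on_const: "c \<in> space N \<Longrightarrow> depends_on J N (\<lambda>_. c)"
  by (simp add: depends_on_def)

lemma depends_on_component: "i \<in> J \<Longrightarrow> depends_on J borel (\<lambda>\<omega>. \<omega> i)"
  by (simp add: depends_on_def)

lemma depends_on_compose:
  "depends_on J N U \<Longrightarrow> h \<in> measurable N N' \<Longrightarrow> depends_on J N' (\<lambda>\<omega>. h (U \<omega>))"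
  by (auto simp: depends_on_def)

lemma depends_on_compose2:
  assumes "depends_on J N U" "depends_on J N' V" "case_prod h \<in> measurable (N \<Otimes>\<^sub>M N') L"
  shows "depends_on J L (\<lambda>\<omega>. h (U \<omega>) (V \<omega>))"
proof -
  have [measurable]: "U \<in> measurable (\<Pi>\<^sub>M i\<in>J. borel) N" "V \<in> measurable (\<Pi>\<^sub>M i\<in>J. borel) N'"
    using assms by (auto simp: depends_on_def)
  have "(\<lambda>\<omega>. case_prod h (U \<omega>, V \<omega>)) \<in> measurable (\<Pi>\<^sub>M i\<in>J. borel) L"
    using assms(3) by measurable
  then show ?thesis
    using assms by (auto simp: depends_on_def)
qed

lemma depends_on_sum:
  fixes U :: "'i \<Rightarrow> (nat \<Rightarrow> real) \<Rightarrow> real"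
  assumes "\<And>i. i \<in> I \<Longrightarrow> depends_on J borel (U i)"
  shows "depends_on J borel (\<lambda>\<omega>. \<Sum>i\<in>I. U i \<omega>)"
  using assms by (auto simp: depends_on_def intro!: borel_measurable_sum sum.cong)

lemma depends_on_Ball:
  assumes "finite I" "\<And>i. i \<in> I \<Longrightarrow> depends_on J (count_space UNIV) (\<lambda>\<omega>. P i \<omega> :: bool)"
  shows "depends_on J (count_space UNIV) (\<lambda>\<omega>. \<forall>i\<in>I. P i \<omega>)"
  using assms by (auto simp: depends_on_def intro: pred_intros_finite)

definition adapted :: "((nat \<Rightarrow> real) \<Rightarrow> nat \<Rightarrow> real) \<Rightarrow> bool" where
  "adapted s \<longleftrightarrow> (\<forall>n. depends_on {1..n} borel (\<lambda>\<omega>. s \<omega> n))"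

lemma adapted_recursion:
  assumes "\<And>\<omega>. s \<omega> 0 = c" "\<And>\<omega> n. s \<omega> (Suc n) = h (s \<omega> n) (\<omega> (Suc n))"
    and "case_prod h \<in> borel_measurable (borel \<Otimes>\<^sub>M borel)"
  shows "adapted s"
  unfolding adapted_def
proof
  fix n
  show "depends_on {1..n} borel (\<lambda>\<omega>. s \<omega> n)"
  proof (induction n)
    case 0
    show ?case
      by (simp add: assms depends_on_const)
  next
    case (Suc n)
    have "depends_on {1..Suc n} borel (\<lambda>\<omega>. s \<omega> n)"
      using Suc by (rule depends_on_mono) auto
    then show ?case
      unfolding assms(2)
      by (rule depends_on_compose2[OF _ _ assms(3)]) (simp add: depends_on_component)
  qed
qed

lemma depends_on_less:
  assumes "depends_on J borel (\<lambda>\<omega>. U \<omega> :: real)"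
  shows "depends_on J (count_space UNIV) (\<lambda>\<omega>. U \<omega> < b)"
  by (rule depends_on_compose[OF assms]) measurable

lemma depends_on_passage:
  assumes "adapted s"
  shows "depends_on {1..n} (count_space UNIV) (\<lambda>\<omega>. enat n < first_passage (s \<omega>) b)"
  unfolding enat_less_first_passage_iff
proof (intro depends_on_Ball depends_on_less)
  fix i assume "i \<in> {1..n}"
  then show "depends_on {1..n} borel (\<lambda>\<omega>. s \<omega> i)"
    using assms by (auto simp: adapted_def intro: depends_on_mono)
qed simp

lemma depends_on_of_bool:
  "depends_on J (count_space UNIV) P \<Longrightarrow> depends_on J borel (\<lambda>\<omega>. of_bool (P \<omega>) :: real)"
proof -
  assume "depends_on J (count_space UNIV) P"
  moreover have "(of_bool :: bool \<Rightarrow> real) \<in> borel_measurable (count_space UNIV)"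
    by (rule borel_measurable_count_space)
  ultimately show ?thesis
    by (rule depends_on_compose)
qed

text \<open>The marginals may differ from index to index, so a single development covers the law
  without a change and the laws with a change at any time.\<close>

locale real_sequence =
  fixes M :: "nat \<Rightarrow> real measure"
  assumes prob_space_M: "prob_space (M i)" and sets_M [measurable_cong]: "sets (M i) = sets borel"
begin

sublocale product_prob_space M "{1..}"
  using prob_space_M
  by (auto simp: product_prob_space_def product_sigma_finite_def product_prob_space_axioms_def
      intro: prob_space_imp_sigma_finite)

abbreviation "\<P> \<equiv> \<Pi>\<^sub>M i\<in>{1..}. M i"

lemma sets_PiM_M: "sets (PiM J M) = sets (\<Pi>\<^sub>M i\<in>J. borel)"
  by (rule sets_PiM_cong) (auto simp: sets_M)

lemma depends_on_measurable:
  assumes "depends_on J N U" "J \<subseteq> {1..}"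
  shows "U \<in> measurable \<P> N"
  using depends_on_mono[OF assms] measurable_cong_sets[OF sets_PiM_M refl]
  by (auto simp: depends_on_def)

lemma indep_vars_coordinates: "indep_vars (\<lambda>_. borel) (\<lambda>i \<omega>. \<omega> i) {1..}"
proof -
  have "indep_vars M (\<lambda>i \<omega>. \<omega> i) {1..}"
  proof (subst indep_vars_iff_distr_eq_PiM')
    have "distr \<P> \<P> (\<lambda>x. \<lambda>i\<in>{1..}. x i) = distr \<P> \<P> (\<lambda>x. x)"
      by (rule distr_cong) (auto simp: space_PiM PiE_def extensional_def fun_eq_iff)
    moreover have "(\<Pi>\<^sub>M i\<in>{1..}. distr \<P> (M i) (\<lambda>\<omega>. \<omega> i)) = \<P>"
      by (rule PiM_cong) (simp_all add: PiM_component)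
    ultimately show "distr \<P> \<P> (\<lambda>x. \<lambda>i\<in>{1..}. x i) = (\<Pi>\<^sub>M i\<in>{1..}. distr \<P> (M i) (\<lambda>\<omega>. \<omega> i))"
      by (simp add: distr_id2)
  qed auto
  then show ?thesis
    by (rule indep_vars_compose2) (simp_all add: measurable_ident_sets sets_M)
qed

text \<open>Restrictions to disjoint blocks of coordinates are independent, and \<open>U\<close> and
  \<open>V\<close> factor through them; the uniform bounds supply integrability.\<close>

lemma expectation_mult_depends_on:
  fixes U V :: "(nat \<Rightarrow> real) \<Rightarrow> real"
  assumes U: "depends_on A borel U" "A \<subseteq> {1..}" "\<And>\<omega>. \<bar>U \<omega>\<bar> \<le> c"
    and V: "depends_on B borel V" "B \<subseteq> {1..}" "\<And>\<omega>. \<bar>V \<omega>\<bar> \<le> d"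
    and disj: "A \<inter> B = {}"
  shows "(\<integral>\<omega>. U \<omega> * V \<omega> \<partial>\<P>) = (\<integral>\<omega>. U \<omega> \<partial>\<P>) * (\<integral>\<omega>. V \<omega> \<partial>\<P>)"
proof (rule indep_var_lebesgue_integral)
  have "indep_var (\<Pi>\<^sub>M i\<in>A. borel) (\<lambda>\<omega>. restrict (\<lambda>i. \<omega> i) A) (\<Pi>\<^sub>M i\<in>B. borel) (\<lambda>\<omega>. restrict (\<lambda>i. \<omega> i) B)"
    by (rule indep_var_restrict[OF indep_vars_coordinates disj U(2) V(2)])
  then have "indep_var borel (U \<circ> (\<lambda>\<omega>. restrict \<omega> A)) borel (V \<circ> (\<lambda>\<omega>. restrict \<omega> B))"
    by (rule indep_var_compose) (use U V in \<open>auto simp: depends_on_def\<close>)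
  then show "indep_var borel U borel V"
    using U V by (simp add: o_def depends_on_def)
  show "integrable \<P> U"
    using U by (intro integrable_const_bound[of _ c] depends_on_measurable) auto
  show "integrable \<P> V"
    using V by (intro integrable_const_bound[of _ d] depends_on_measurable) auto
qed

lemma integral_component:
  assumes "i \<ge> 1" and [measurable]: "g \<in> borel_measurable borel"
  shows "(\<integral>\<omega>. g (\<omega> i) \<partial>\<P>) = (\<integral>x. (g x :: real) \<partial>M i)"
  using assms by (subst PiM_component[of i, symmetric]) (auto simp: integral_distr)

lemma expectation_mult_component:
  fixes U :: "(nat \<Rightarrow> real) \<Rightarrow> real"
  assumes U: "depends_on A borel U" "A \<subseteq> {1..}" "\<And>\<omega>. \<bar>U \<omega>\<bar> \<le> c"
    and g: "g \<in> borel_measurable borel" "\<And>x. \<bar>g x\<bar> \<le> d"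
    and i: "1 \<le> i" "i \<notin> A"
  shows "(\<integral>\<omega>. U \<omega> * g (\<omega> i) \<partial>\<P>) = (\<integral>\<omega>. U \<omega> \<partial>\<P>) * (\<integral>x. g x \<partial>M i)"
proof -
  have "depends_on {i} borel (\<lambda>\<omega>. g (\<omega> i))"
    by (rule depends_on_compose[OF depends_on_component g(1)]) simp
  then have "(\<integral>\<omega>. U \<omega> * g (\<omega> i) \<partial>\<P>) = (\<integral>\<omega>. U \<omega> \<partial>\<P>) * (\<integral>\<omega>. g (\<omega> i) \<partial>\<P>)"
    using i by (intro expectation_mult_depends_on[OF U _ _ g(2)]) auto
  then show ?thesis
    using i g by (simp add: integral_component)
qed

lemma nn_integral_of_bool_eq_expectation:
  assumes "depends_on J (count_space UNIV) P" "J \<subseteq> {1..}"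
  shows "(\<integral>\<^sup>+\<omega>. of_bool (P \<omega>) \<partial>\<P>) = ennreal (\<integral>\<omega>. of_bool (P \<omega>) \<partial>\<P>)"
proof -
  have [measurable]: "Measurable.pred \<P> P"
    using depends_on_measurable[OF assms] .
  have "integrable \<P> (\<lambda>\<omega>. of_bool (P \<omega>) :: real)"
    by (rule integrable_const_bound[of _ 1]) auto
  then have "(\<integral>\<^sup>+\<omega>. ennreal (of_bool (P \<omega>)) \<partial>\<P>) = ennreal (\<integral>\<omega>. of_bool (P \<omega>) \<partial>\<P>)"
    by (rule nn_integral_eq_integral) simp
  also have "(\<integral>\<^sup>+\<omega>. ennreal (of_bool (P \<omega>)) \<partial>\<P>) = (\<integral>\<^sup>+\<omega>. of_bool (P \<omega>) \<partial>\<P>)"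
    by (rule nn_integral_cong) (simp add: of_bool_def)
  finally show ?thesis .
qed

end

section \<open>Stopped sums and stopped martingales\<close>

lemma stopped_sum_le:
  fixes a :: "nat \<Rightarrow> real"
  assumes a: "\<And>i. a i \<le> amax" and "0 \<le> amax" "0 \<le> \<beta>"
  shows "(\<Sum>k<n. of_bool (\<forall>j\<in>{1..k}. sum a {..<j} < \<beta>) * a k) \<le> \<beta> + amax"
proof -
  let ?alive = "\<lambda>k. \<forall>j\<in>{1..k}. sum a {..<j} < \<beta>"
  have "(\<Sum>k<n. of_bool (?alive k) * a k) \<le> \<beta> + amax \<and>
      (?alive n \<longrightarrow> (\<Sum>k<n. of_bool (?alive k) * a k) = sum a {..<n})"
  proof (induction n)
    case 0
    then show ?case
      using assms by simp
  next
    case (Suc n)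
    have alive: "?alive (Suc n) \<Longrightarrow> ?alive n"
      by auto
    show ?case
    proof (cases "?alive n")
      case True
      \<comment> \<open>The empty prefix is not tested by \<open>?alive\<close>; for it the bound is
        just that \<beta> is nonnegative.\<close>
      have "sum a {..<n} \<le> \<beta>"
      proof (cases "n = 0")
        case False
        then have "n \<in> {1..n}"
          by auto
        with True have "sum a {..<n} < \<beta>"
          by blast
        then show ?thesis
          by simp
      qed (use assms in simp)
      moreover have "(\<Sum>k<Suc n. of_bool (?alive k) * a k) = sum a {..<n} + a n"
        using Suc.IH True by simp
      ultimately show ?thesis
        using a[of n] by simp
    next
      case False
      then have "(\<Sum>k<Suc n. of_bool (?alive k) * a k) = (\<Sum>k<n. of_bool (?alive k) * a k)"
        by simp
      then show ?thesis
        using Suc.IH alive False by auto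
    qed
  qed
  then show ?thesis
    by simp
qed

context real_sequence
begin

lemma integrable_depends_on:
  fixes U :: "(nat \<Rightarrow> real) \<Rightarrow> real"
  assumes "depends_on J borel U" "J \<subseteq> {1..}" "\<And>\<omega>. \<bar>U \<omega>\<bar> \<le> c"
  shows "integrable \<P> U"
  using assms by (intro integrable_const_bound[of _ c] depends_on_measurable) auto

lemma expectation_of_bool_nonneg: "(0 :: real) \<le> (\<integral>\<omega>. of_bool (P \<omega>) \<partial>\<P>)"
  by (simp add: integral_nonneg_AE)

lemma expectation_of_bool_le_1: "(\<integral>\<omega>. of_bool (P \<omega>) \<partial>\<P>) \<le> (1 :: real)"
proof (cases "integrable \<P> (\<lambda>\<omega>. of_bool (P \<omega>) :: real)")
  case True
  then show ?thesis
    by (rule P.integral_le_const) simp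
qed (simp add: not_integrable_integral_eq)

text \<open>Wald's identity for the truncated passage time, combined with the bound
  \<open>\<beta> + gmax\<close> for the stopped sum.\<close>

lemma wald_bound:
  assumes g: "g \<in> borel_measurable borel" "\<And>x. \<bar>g x\<bar> \<le> d" "\<And>x. g x \<le> gmax"
    and "1 \<le> \<tau>" and \<mu>: "\<And>i. \<tau> \<le> i \<Longrightarrow> (\<integral>x. g x \<partial>M i) = \<mu>" "0 < \<mu>"
    and "0 \<le> gmax" "0 \<le> \<beta>"
  shows "(\<Sum>k. ennreal (\<integral>\<omega>. of_bool (\<forall>j\<in>{1..k}. (\<Sum>i<j. g (\<omega> (\<tau> + i))) < \<beta>) \<partial>\<P>))
    \<le> ennreal ((\<beta> + gmax) / \<mu>)"
proof -
  define alive where "alive k \<omega> \<longleftrightarrow> (\<forall>j\<in>{1..k}. (\<Sum>i<j. g (\<omega> (\<tau> + i))) < \<beta>)" for k \<omega>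
  have dep: "depends_on {\<tau>..<\<tau> + k} borel (\<lambda>\<omega>. of_bool (alive k \<omega>) :: real)" for k
    unfolding alive_def
    by (intro depends_on_of_bool depends_on_Ball depends_on_less depends_on_sum
        depends_on_compose[OF depends_on_component g(1)]) auto
  have dep_g: "depends_on {\<tau> + k} borel (\<lambda>\<omega>. g (\<omega> (\<tau> + k)))" for k
    by (rule depends_on_compose[OF depends_on_component g(1)]) simp
  have "0 \<le> d"
    using g(2)[of 0] by linarith
  have int: "integrable \<P> (\<lambda>\<omega>. of_bool (alive k \<omega>) * g (\<omega> (\<tau> + k)))" for k
  proof (rule integrable_depends_on[of "{\<tau>..\<tau> + k}" _ d])
    show "depends_on {\<tau>..\<tau> + k} borel (\<lambda>\<omega>. of_bool (alive k \<omega>) * g (\<omega> (\<tau> + k)))"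
      by (rule depends_on_compose2[OF depends_on_mono[OF dep] depends_on_mono[OF dep_g]]) auto
    show "\<bar>of_bool (alive k \<omega>) * g (\<omega> (\<tau> + k))\<bar> \<le> d" for \<omega>
      using g(2) \<open>0 \<le> d\<close> by (simp add: abs_mult)
  qed (use \<open>1 \<le> \<tau>\<close> in auto)
  \<comment> \<open>Truncation at n avoids presupposing that the passage time is finite; the bound
    does not depend on n and so passes to the supremum.\<close>
  have "(\<Sum>k<n. \<integral>\<omega>. of_bool (alive k \<omega>) \<partial>\<P>) \<le> (\<beta> + gmax) / \<mu>" for n
  proof -
    \<comment> \<open>\<open>alive k\<close> looks at the coordinates from \<tau> to \<tau> + k - 1
      only, so it is independent of the increment at \<tau> + k, whose mean is \<mu>.\<close>
    have "\<mu> * (\<integral>\<omega>. of_bool (alive k \<omega>) \<partial>\<P>) = (\<integral>\<omega>. of_bool (alive k \<omega>) * g (\<omega> (\<tau> + k)) \<partial>\<P>)" for k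
      using \<open>1 \<le> \<tau>\<close> \<mu>(1)[of "\<tau> + k"]
      by (subst expectation_mult_component[OF dep _ _ g(1,2), where c = 1]) auto
    then have "\<mu> * (\<Sum>k<n. \<integral>\<omega>. of_bool (alive k \<omega>) \<partial>\<P>) =
        (\<Sum>k<n. \<integral>\<omega>. of_bool (alive k \<omega>) * g (\<omega> (\<tau> + k)) \<partial>\<P>)"
      by (simp add: sum_distrib_left)
    also have "\<dots> = (\<integral>\<omega>. (\<Sum>k<n. of_bool (alive k \<omega>) * g (\<omega> (\<tau> + k))) \<partial>\<P>)"
      using int by (subst Bochner_Integration.integral_sum) auto
    also have "\<dots> \<le> (\<integral>\<omega>. \<beta> + gmax \<partial>\<P>)"
    proof (rule integral_mono)
      show "integrable \<P> (\<lambda>\<omega>. \<Sum>k<n. of_bool (alive k \<omega>) * g (\<omega> (\<tau> + k)))"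
        using int by (rule Bochner_Integration.integrable_sum)
      show "(\<Sum>k<n. of_bool (alive k \<omega>) * g (\<omega> (\<tau> + k))) \<le> \<beta> + gmax" for \<omega>
        unfolding alive_def using assms by (intro stopped_sum_le) auto
    qed simp
    also have "\<dots> = \<beta> + gmax"
      by (simp add: P.prob_space)
    finally show ?thesis
      using \<open>0 < \<mu>\<close> by (simp add: field_simps)
  qed
  then have "(\<Sum>k<n. ennreal (\<integral>\<omega>. of_bool (alive k \<omega>) \<partial>\<P>)) \<le> ennreal ((\<beta> + gmax) / \<mu>)" for n
    by (subst sum_ennreal) (auto simp: expectation_of_bool_nonneg intro: ennreal_leI)
  then show ?thesis
    unfolding alive_def suminf_eq_SUP by (intro SUP_least) auto
qed

text \<open>The survival indicator and the statistic at n are independent of the next factor exp Z,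
  which has mean 1. Splitting the statistic at n + 1 into survivors and fresh alarms, where it is at
  least b, gives the inequality. With c = a = 1 this is the Shiryaev-Roberts recursion, with c =
  1/(1-p) and a = p the Shiryaev one.\<close>

lemma passage_step:
  assumes s: "\<And>\<omega>. s \<omega> 0 = 0" "\<And>\<omega> n. s \<omega> (Suc n) = c * (a + s \<omega> n) * exp (z (\<omega> (Suc n)))"
    and "0 \<le> a" "0 \<le> c" "0 \<le> b"
    and z: "z \<in> borel_measurable borel" "\<And>x. \<bar>z x\<bar> \<le> d"
    and tilt: "(\<integral>x. exp (z x) \<partial>M (Suc n)) = 1"
  defines "alive \<equiv> \<lambda>n \<omega>. of_bool (enat n < first_passage (s \<omega>) b) :: real"
  shows "(\<integral>\<omega>. alive (Suc n) \<omega> * s \<omega> (Suc n) \<partial>\<P>) + b * ((\<integral>\<omega>. alive n \<omega> \<partial>\<P>) - (\<integral>\<omega>. alive (Suc n) \<omega> \<partial>\<P>))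
    \<le> c * (a * (\<integral>\<omega>. alive n \<omega> \<partial>\<P>) + (\<integral>\<omega>. alive n \<omega> * s \<omega> n \<partial>\<P>))"
proof -
  note z(1) [measurable]
  have adapted: "adapted s"
    by (rule adapted_recursion[where c = 0 and h = "\<lambda>s x. c * (a + s) * exp (z x)"]) (auto simp: s)
  have s_dep: "depends_on {1..n} borel (\<lambda>\<omega>. s \<omega> n)" for n
    using adapted by (simp add: adapted_def)
  have alive_dep: "depends_on {1..n} borel (alive n)" for n
    unfolding alive_def by (intro depends_on_of_bool depends_on_passage adapted)
  have s_nonneg: "0 \<le> s \<omega> n" for \<omega> n
    by (induction n) (use assms in \<open>auto simp: s\<close>)
  have alive_01: "0 \<le> alive n \<omega>" "alive n \<omega> \<le> 1" for n \<omega>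
    by (auto simp: alive_def)
  \<comment> \<open>On survival the statistic has not reached b, and at n = 0 it is 0. This bound
    makes every integrand below bounded.\<close>
  have alive_s_le: "alive n \<omega> * s \<omega> n \<le> b" for n \<omega>
  proof (cases "alive n \<omega> = 0")
    case False
    then have "\<forall>i\<in>{1..n}. s \<omega> i < b" "alive n \<omega> = 1"
      by (auto simp: alive_def enat_less_first_passage_iff split: if_splits)
    then show ?thesis
      using \<open>0 \<le> b\<close> s(1) by (cases "n = 0") (auto intro: less_imp_le)
  qed (use \<open>0 \<le> b\<close> in simp)
  have alive_s_dep: "depends_on {1..n} borel (\<lambda>\<omega>. alive n \<omega> * s \<omega> n)" for n
    by (rule depends_on_compose2[OF alive_dep s_dep]) simp
  define U where "U \<omega> = c * (a * alive n \<omega> + alive n \<omega> * s \<omega> n)" for \<omega>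
  have U_dep: "depends_on {1..n} borel U"
    unfolding U_def by (rule depends_on_compose2[OF alive_dep alive_s_dep]) simp
  have U_nonneg: "0 \<le> U \<omega>" and U_le: "U \<omega> \<le> c * (a + b)" for \<omega>
    using \<open>0 \<le> a\<close> \<open>0 \<le> c\<close> alive_01 s_nonneg alive_s_le
    by (auto simp: U_def intro!: mult_left_mono add_mono mult_left_le)
  have U: "\<bar>U \<omega>\<bar> \<le> c * (a + b)" for \<omega>
    using U_nonneg U_le by simp
  have exp_le: "\<bar>exp (z x)\<bar> \<le> exp d" for x
    using z(2)[of x] by simp
  have [simp]: "integrable \<P> (alive n)" "integrable \<P> (\<lambda>\<omega>. alive n \<omega> * s \<omega> n)" for n
    using alive_01 s_nonneg alive_s_le \<open>0 \<le> b\<close>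
    by (auto intro!: integrable_depends_on[OF alive_dep, where c = 1] integrable_depends_on[OF alive_s_dep, where c = b])
  have "integrable \<P> (\<lambda>\<omega>. U \<omega> * exp (z (\<omega> (Suc n))))"
  proof (rule integrable_depends_on[of "{1..Suc n}" _ "c * (a + b) * exp d"])
    show "depends_on {1..Suc n} borel (\<lambda>\<omega>. U \<omega> * exp (z (\<omega> (Suc n))))"
      by (rule depends_on_compose2[OF depends_on_mono[OF U_dep] depends_on_component,
            where h = "\<lambda>u x. u * exp (z x)"]) auto
    show "\<bar>U \<omega> * exp (z (\<omega> (Suc n)))\<bar> \<le> c * (a + b) * exp d" for \<omega>
      unfolding abs_mult using U exp_le by (intro mult_mono) (auto intro: order.trans[OF abs_ge_zero])
  qed auto
  \<comment> \<open>A path alive at n either stays below b and keeps its statistic, or alarms now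
    with a statistic of at least b and is credited with b only.\<close>
  moreover have "alive (Suc n) \<omega> * s \<omega> (Suc n) + b * (alive n \<omega> - alive (Suc n) \<omega>)
      \<le> U \<omega> * exp (z (\<omega> (Suc n)))" for \<omega>
  proof -
    have U_eq: "U \<omega> * exp (z (\<omega> (Suc n))) = alive n \<omega> * s \<omega> (Suc n)"
      by (simp add: U_def s(2) algebra_simps)
    have alive_Suc: "alive (Suc n) \<omega> = alive n \<omega> * of_bool (s \<omega> (Suc n) < b)"
      by (auto simp: alive_def enat_less_first_passage_iff le_Suc_eq)
    show ?thesis
      unfolding U_eq alive_Suc using alive_01[of n \<omega>]
      by (cases "s \<omega> (Suc n) < b") (auto simp: not_less mult.commute[of b] intro: mult_left_mono)
  qed
  ultimately have "(\<integral>\<omega>. alive (Suc n) \<omega> * s \<omega> (Suc n) + b * (alive n \<omega> - alive (Suc n) \<omega>) \<partial>\<P>)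
      \<le> (\<integral>\<omega>. U \<omega> * exp (z (\<omega> (Suc n))) \<partial>\<P>)"
    by (intro integral_mono) auto
  also have "\<dots> = (\<integral>\<omega>. U \<omega> \<partial>\<P>)"
    by (subst expectation_mult_component[OF U_dep _ U _ exp_le]) (auto simp: tilt)
  also have "\<dots> = c * (a * (\<integral>\<omega>. alive n \<omega> \<partial>\<P>) + (\<integral>\<omega>. alive n \<omega> * s \<omega> n \<partial>\<P>))"
    by (simp add: U_def[abs_def])
  finally show ?thesis
    by simp
qed

lemma expected_passage_eq_suminf:
  assumes "adapted s"
  shows "(\<integral>\<^sup>+\<omega>. ennreal_of_enat (first_passage (s \<omega>) b) \<partial>\<P>) =
    (\<Sum>n. ennreal (\<integral>\<omega>. of_bool (enat n < first_passage (s \<omega>) b) \<partial>\<P>))"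
proof -
  have [measurable]: "Measurable.pred \<P> (\<lambda>\<omega>. enat n < first_passage (s \<omega>) b)" for n
    by (rule depends_on_measurable[OF depends_on_passage[OF assms]]) auto
  have [measurable]: "(\<lambda>\<omega>. of_bool (enat n < first_passage (s \<omega>) b) :: ennreal) \<in> borel_measurable \<P>" for n
    by (simp add: of_bool_def)
  show ?thesis
    unfolding ennreal_of_enat_eq_suminf
    by (subst nn_integral_suminf)
      (auto intro!: suminf_cong nn_integral_of_bool_eq_expectation depends_on_passage assms)
qed

text \<open>Adding up the one-step inequalities and dropping the survivors' statistic gives b P(T
  \<le> n) \<le> E min(T, n), the stopped form of R_n - n being a martingale. It remains to let n
  grow.\<close>

lemma sr_mean_passage:
  assumes z: "z \<in> borel_measurable borel" "\<And>x. \<bar>z x\<bar> \<le> d"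
    and tilt: "\<And>i. 1 \<le> i \<Longrightarrow> (\<integral>x. exp (z x) \<partial>M i) = 1" and "0 < b"
  shows "ennreal b \<le> (\<integral>\<^sup>+\<omega>. ennreal_of_enat (first_passage (sr_stat z \<omega>) b) \<partial>\<P>)"
proof -
  note z(1) [measurable]
  define y :: "nat \<Rightarrow> real" where "y n = (\<integral>\<omega>. of_bool (enat n < first_passage (sr_stat z \<omega>) b) \<partial>\<P>)" for n
  define x where "x n = (\<integral>\<omega>. of_bool (enat n < first_passage (sr_stat z \<omega>) b) * sr_stat z \<omega> n \<partial>\<P>)" for n
  have sr_nonneg: "0 \<le> sr_stat z \<omega> n" for \<omega> n
    by (induction n) auto
  then have x_nonneg: "0 \<le> x n" for n
    unfolding x_def by (intro Bochner_Integration.integral_nonneg) auto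
  have y_nonneg: "0 \<le> y n" for n
    unfolding y_def by (rule expectation_of_bool_nonneg)
  have step: "x (Suc n) + b * (y n - y (Suc n)) \<le> y n + x n" for n
    using passage_step[of "sr_stat z" 1 1 z b d n] z tilt[of "Suc n"] \<open>0 < b\<close> by (simp add: x_def y_def)
  have y0: "y 0 = 1"
    by (simp add: y_def enat_less_first_passage_iff P.prob_space)
  have "x n + b * (1 - y n) \<le> (\<Sum>k<n. y k)" for n
  proof (induction n)
    case 0
    then show ?case
      by (simp add: x_def y0)
  next
    case (Suc n)
    then show ?case
      using step[of n] by (simp add: algebra_simps)
  qed
  then have *: "b * (1 - y n) \<le> (\<Sum>k<n. y k)" for n
    by (rule order.trans[rotated]) (simp add: x_nonneg)
  have "adapted (sr_stat z)"
    by (rule adapted_recursion[where c = 0 and h = "\<lambda>s x. (1 + s) * exp (z x)"]) auto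
  then have eq: "(\<integral>\<^sup>+\<omega>. ennreal_of_enat (first_passage (sr_stat z \<omega>) b) \<partial>\<P>) = (\<Sum>n. ennreal (y n))"
    unfolding y_def by (rule expected_passage_eq_suminf)
  show ?thesis
  \<comment> \<open>If the mean alarm time is finite, the survival probabilities tend to 0 and the
    left side tends to b; otherwise the mean is infinite and nothing is to be shown.\<close>
  proof (cases "summable y")
    case True
    then have "(\<lambda>n. b * (1 - y n)) \<longlonglongrightarrow> b * (1 - 0)"
      by (intro tendsto_intros summable_LIMSEQ_zero)
    moreover have "b * (1 - y n) \<le> suminf y" for n
      using *[of n] sum_le_suminf[OF True, of "{..<n}"] y_nonneg by fastforce
    ultimately have "b \<le> suminf y"
      by (auto dest: LIMSEQ_le_const2)
    then show ?thesis
      unfolding eq using suminf_ennreal2[OF y_nonneg True] by (simp add: ennreal_leI)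
  next
    case False
    then have "(\<Sum>n. ennreal (y n)) = \<top>"
      using summable_suminf_not_top[of y, OF y_nonneg] by blast
    then show ?thesis
      by (simp add: eq)
  qed
qed

text \<open>The series is the probability of T < \<tau>: the prior gives weight p(1-p)^n to \<tau> =
  n + 1, and then T < \<tau> means an alarm by n. Discounting the one-step inequality by powers of
  1-p makes it telescope to b PFA \<le> 1 - PFA. This reflects that S_n is the posterior odds of a
  change in the tilted model, so that an alarm is raised at odds of at least b.\<close>

lemma shiryaev_alarm_bound:
  assumes z: "z \<in> borel_measurable borel" "\<And>x. \<bar>z x\<bar> \<le> d"
    and tilt: "\<And>i. 1 \<le> i \<Longrightarrow> (\<integral>x. exp (z x) \<partial>M i) = 1" and "0 < b" and p: "0 < p" "p < 1"
  defines "y \<equiv> \<lambda>n :: nat. \<integral>\<omega>. (of_bool (enat n < first_passage (shiryaev_stat p z \<omega>) b) :: real) \<partial>\<P>"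
  shows "(\<Sum>n. p * (1 - p) ^ n * (1 - y n)) \<le> 1 / (1 + b)"
proof -
  let ?q = "1 - p"
  define x where "x n = (\<integral>\<omega>. of_bool (enat n < first_passage (shiryaev_stat p z \<omega>) b) * shiryaev_stat p z \<omega> n \<partial>\<P>)" for n
  have "0 \<le> shiryaev_stat p z \<omega> n" for \<omega> n
    by (induction n) (use p in auto)
  then have x_nonneg: "0 \<le> x n" for n
    unfolding x_def by (intro Bochner_Integration.integral_nonneg) auto
  have y_nonneg: "0 \<le> y n" for n
    unfolding y_def by (rule expectation_of_bool_nonneg)
  have y_le: "y n \<le> 1" for n
    unfolding y_def by (rule expectation_of_bool_le_1)
  have y0: "y 0 = 1"
    by (simp add: y_def enat_less_first_passage_iff P.prob_space)
  have step: "?q ^ Suc n * x (Suc n) + b * ?q ^ Suc n * (y n - y (Suc n)) \<le> ?q ^ n * (p * y n + x n)" for n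
  proof -
    have "x (Suc n) + b * (y n - y (Suc n)) \<le> 1 / ?q * (p * y n + x n)"
      using passage_step[of "shiryaev_stat p z" "1 / ?q" p z b d n] z tilt[of "Suc n"] \<open>0 < b\<close> p
      by (simp add: x_def y_def)
    then have "?q ^ Suc n * (x (Suc n) + b * (y n - y (Suc n))) \<le> ?q ^ Suc n * (1 / ?q * (p * y n + x n))"
      using p by (intro mult_left_mono) auto
    also have "\<dots> = ?q ^ n * (p * y n + x n)"
      using p by simp
    finally show ?thesis
      by (simp only: distrib_left mult.assoc mult.left_commute[of b])
  qed
  \<comment> \<open>By summation by parts with \<open>p = 1 - ?q\<close>, the bracket multiplied by
    b is the sum over k < n of \<open>?q ^ Suc k * (y k - y (Suc k))\<close>, the discounted alarm
    mass.\<close>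
  have *: "?q ^ n * x n + b * ((\<Sum>k<n. p * ?q ^ k * (1 - y k)) + ?q ^ n * (1 - y n)) \<le> (\<Sum>k<n. p * ?q ^ k * y k)" for n
  proof (induction n)
    case 0
    then show ?case
      by (simp add: x_def y0)
  next
    case (Suc n)
    then show ?case
      using step[of n] by (simp add: algebra_simps)
  qed
  have bound: "b * (\<Sum>k<n. p * ?q ^ k * (1 - y k)) \<le> (\<Sum>k<n. p * ?q ^ k * y k)" for n
  proof -
    have "0 \<le> ?q ^ n * x n" "0 \<le> b * (?q ^ n * (1 - y n))"
      using p x_nonneg y_le \<open>0 < b\<close> by auto
    then show ?thesis
      using *[of n] by (simp add: distrib_left)
  qed
  have "(\<lambda>k. p * ?q ^ k) sums (p * (1 / (1 - ?q)))"
    using p by (intro sums_mult geometric_sums) auto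
  then have geo: "(\<lambda>k. p * ?q ^ k) sums 1"
    using p by simp
  have sm: "summable (\<lambda>k. p * ?q ^ k * (1 - y k))" "summable (\<lambda>k. p * ?q ^ k * y k)"
    using p y_nonneg y_le
    by (auto intro!: summable_comparison_test'[OF sums_summable[OF geo]] simp: mult_left_le)
  have "b * (\<Sum>k. p * ?q ^ k * (1 - y k)) \<le> (\<Sum>k. p * ?q ^ k * y k)"
    using bound sm by (intro LIMSEQ_le[OF tendsto_mult[OF tendsto_const summable_LIMSEQ] summable_LIMSEQ]) auto
  also have "(\<Sum>k. p * ?q ^ k * y k) = (\<Sum>k. p * ?q ^ k - p * ?q ^ k * (1 - y k))"
    by (simp add: algebra_simps)
  also have "\<dots> = 1 - (\<Sum>k. p * ?q ^ k * (1 - y k))"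
    using suminf_diff[OF sums_summable[OF geo] sm(1)] sums_unique[OF geo] by simp
  finally show ?thesis
    using \<open>0 < b\<close> by (simp add: field_simps)
qed

end

section \<open>False alarms and delays\<close>

lemma sets_law [simp, measurable_cong]: "sets (law f) = sets borel"
  by (simp add: law_def)

lemma space_law [simp]: "space (law f) = UNIV"
  by (simp add: law_def)

lemma first_passage_mono:
  assumes "\<And>n. 1 \<le> n \<Longrightarrow> b \<le> s n \<Longrightarrow> b' \<le> s' n"
  shows "first_passage s' b' \<le> first_passage s b"
  unfolding first_passage_def using assms by (intro Inf_superset_mono) auto

text \<open>The bound by 1 + R carries the induction, since both sides then pick up the same factor.
  The sharper bound by R alone fails after a reset, where exp W = 1 while R may be close to 0; but a
  positive threshold is only reached where W > 0.\<close>

lemma exp_cusum_le_sr: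
  assumes "0 < cusum_stat z \<omega> n"
  shows "exp (cusum_stat z \<omega> n) \<le> sr_stat z \<omega> n"
proof -
  have nonneg: "0 \<le> sr_stat z \<omega> n" for n
    by (induction n) auto
  have "exp (cusum_stat z \<omega> n) \<le> 1 + sr_stat z \<omega> n \<and>
      (0 < cusum_stat z \<omega> n \<longrightarrow> exp (cusum_stat z \<omega> n) \<le> sr_stat z \<omega> n)"
  proof (induction n)
    case (Suc n)
    show ?case
    proof (cases "0 < cusum_stat z \<omega> n + z (\<omega> (Suc n))")
      case True
      then have "exp (cusum_stat z \<omega> (Suc n)) = exp (cusum_stat z \<omega> n) * exp (z (\<omega> (Suc n)))"
        by (simp add: exp_add)
      also have "\<dots> \<le> (1 + sr_stat z \<omega> n) * exp (z (\<omega> (Suc n)))"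
        using Suc.IH by (intro mult_right_mono) auto
      finally show ?thesis
        using True by (simp add: max_def)
    next
      case False
      then show ?thesis
        using nonneg[of "Suc n"] by (simp add: max_def)
    qed
  qed simp
  with assms show ?thesis
    by blast
qed

lemma T_sr_le_T_cusum: "0 < h \<Longrightarrow> T_sr z (exp h) \<omega> \<le> T_cusum z h \<omega>"
  unfolding T_sr_def T_cusum_def
proof (rule first_passage_mono)
  fix n assume "0 < h" "h \<le> cusum_stat z \<omega> n"
  then show "exp h \<le> sr_stat z \<omega> n"
    using exp_cusum_le_sr[of z \<omega> n] order.trans[of "exp h" "exp (cusum_stat z \<omega> n)"] by simp
qed

lemma adapted_cusum_stat: "z \<in> borel_measurable borel \<Longrightarrow> adapted (cusum_stat z)"
  by (rule adapted_recursion[where c = 0 and h = "\<lambda>s x. max 0 (s + z x)"]) auto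

lemma adapted_sr_stat: "z \<in> borel_measurable borel \<Longrightarrow> adapted (sr_stat z)"
  by (rule adapted_recursion[where c = 0 and h = "\<lambda>s x. (1 + s) * exp (z x)"]) auto

lemma adapted_shiryaev_stat: "z \<in> borel_measurable borel \<Longrightarrow> adapted (shiryaev_stat p z)"
  by (rule adapted_recursion[where c = 0 and h = "\<lambda>s x. (p + s) * exp (z x) / (1 - p)"]) auto

text \<open>Comparing the statistics with a random walk restarted after time \<open>k\<close> is what makes the delay
  bounds uniform over the past.\<close>

lemma cusum_stat_ge: "(\<Sum>i<m. z (\<omega> (Suc k + i))) \<le> cusum_stat z \<omega> (k + m)"
proof (induction m)
  case 0
  show ?case
    by (cases k) auto
qed simp

text \<open>Since 1 + R \<ge> 1 at every time, the recursion dominates a product of likelihood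
  ratios started afresh after k. At m = 0 that product is 1, which R need not reach; hence the
  companion bound with 1 + R in the induction.\<close>

lemma sr_stat_ge:
  assumes "1 \<le> m"
  shows "exp (\<Sum>i<m. z (\<omega> (Suc k + i))) \<le> sr_stat z \<omega> (k + m)"
proof -
  have "0 \<le> sr_stat z \<omega> n" for n
    by (induction n) auto
  then have "exp (\<Sum>i<m. z (\<omega> (Suc k + i))) \<le> 1 + sr_stat z \<omega> (k + m) \<and>
      (1 \<le> m \<longrightarrow> exp (\<Sum>i<m. z (\<omega> (Suc k + i))) \<le> sr_stat z \<omega> (k + m))"
  proof (induction m)
    case (Suc m)
    then have "exp (\<Sum>i<m. z (\<omega> (Suc k + i))) * exp (z (\<omega> (Suc k + m))) \<le>
        (1 + sr_stat z \<omega> (k + m)) * exp (z (\<omega> (Suc k + m)))"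
      by (intro mult_right_mono) auto
    then show ?case
      by (simp add: exp_add add_increasing)
  qed simp
  with assms show ?thesis
    by blast
qed

text \<open>Each step divides by 1 - p, which adds \<open>lambda_p p\<close> to every increment of
  the walk, and p + S \<ge> p supplies the starting value p. This is the origin of the threshold
  log(B/p) and of the term c in the Shiryaev delay bound.\<close>

lemma shiryaev_stat_ge:
  assumes "1 \<le> m" and p: "0 < p" "p < 1"
  shows "p * exp (\<Sum>i<m. z (\<omega> (Suc k + i)) + lambda_p p) \<le> shiryaev_stat p z \<omega> (k + m)"
proof -
  have nonneg: "0 \<le> shiryaev_stat p z \<omega> n" for n
    by (induction n) (use p in auto)
  have exp_lambda: "exp (lambda_p p) = 1 / (1 - p)"
    using p by (simp add: lambda_p_def)
  have "p * exp (\<Sum>i<m. z (\<omega> (Suc k + i)) + lambda_p p) \<le> p + shiryaev_stat p z \<omega> (k + m) \<and>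
      (1 \<le> m \<longrightarrow> p * exp (\<Sum>i<m. z (\<omega> (Suc k + i)) + lambda_p p) \<le> shiryaev_stat p z \<omega> (k + m))"
  proof (induction m)
    case 0
    then show ?case
      using nonneg by simp
  next
    case (Suc m)
    then have "p * exp (\<Sum>i<m. z (\<omega> (Suc k + i)) + lambda_p p) * (exp (z (\<omega> (Suc k + m))) / (1 - p)) \<le>
        (p + shiryaev_stat p z \<omega> (k + m)) * (exp (z (\<omega> (Suc k + m))) / (1 - p))"
      using p by (intro mult_right_mono) auto
    then show ?case
      using p by (simp add: exp_add exp_lambda mult.assoc add_increasing)
  qed
  with assms(1) show ?thesis
    by blast
qed

section \<open>Observation laws with a change point\<close>

lemma real_sequence_obs:
  assumes "prob_density f0" "prob_density f1"
  shows "real_sequence (\<lambda>t. law (if enat t < \<tau> then f0 else f1))"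
proof (rule real_sequence.intro)
  show "prob_space (law (if enat t < \<tau> then f0 else f1))" for t
    using assms by (cases "enat t < \<tau>") (simp_all add: prob_density_def)
qed simp

lemma prob_space_obs_law:
  assumes "prob_density f0" "prob_density f1"
  shows "prob_space (obs_law f0 f1 \<tau>)"
proof -
  interpret real_sequence "\<lambda>t. law (if enat t < \<tau> then f0 else f1)"
    by (rule real_sequence_obs[OF assms])
  show ?thesis
    unfolding obs_law_def by (rule P.prob_space_axioms)
qed

lemma sets_obs_law [simp, measurable_cong]: "sets (obs_law f0 f1 \<tau>) = sets obs_space"
  unfolding obs_law_def obs_space_def by (rule sets_PiM_cong) simp_all

lemma space_obs_law [simp]: "space (obs_law f0 f1 \<tau>) = space obs_space"
  by (rule sets_eq_imp_space_eq) simp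

lemma depends_on_measurable_obs:
  assumes "depends_on J N U" "J \<subseteq> {1..}"
  shows "U \<in> measurable obs_space N"
  using depends_on_mono[OF assms] by (simp add: depends_on_def obs_space_def)

text \<open>The law of the observations preceding the change is a product of copies of f_0, whatever
  the change time. False alarm probabilities are therefore free of the post-change density.\<close>

lemma expectation_before_change:
  fixes U :: "(nat \<Rightarrow> real) \<Rightarrow> real"
  assumes f: "prob_density f0" "prob_density f1"
    and U: "depends_on {1..n} borel U" and "enat n < \<tau>"
  shows "(\<integral>\<omega>. U \<omega> \<partial>obs_law f0 f1 \<tau>) = (\<integral>\<omega>. U \<omega> \<partial>(\<Pi>\<^sub>M i\<in>{1..n}. law f0))"
proof -
  let ?M = "\<lambda>t. law (if enat t < \<tau> then f0 else f1)"
  interpret real_sequence ?M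
    by (rule real_sequence_obs[OF f])
  have [measurable]: "U \<in> borel_measurable (PiM {1..n} ?M)"
    using U measurable_cong_sets[OF sets_PiM_M refl] by (auto simp: depends_on_def)
  have "(\<Pi>\<^sub>M i\<in>{1..n}. law f0) = PiM {1..n} ?M"
  proof (rule PiM_cong)
    fix i assume "i \<in> {1..n}"
    then have "enat i < \<tau>"
      using \<open>enat n < \<tau>\<close> by (cases \<tau>) auto
    then show "law f0 = ?M i"
      by simp
  qed simp
  also have "\<dots> = distr (obs_law f0 f1 \<tau>) (PiM {1..n} ?M) (\<lambda>\<omega>. restrict \<omega> {1..n})"
    unfolding obs_law_def by (rule distr_PiM_restrict_finite[symmetric]) auto
  finally show ?thesis
    using U unfolding obs_law_def
    by (simp add: integral_distr measurable_restrict_subset depends_on_def del: atLeastatMost_subset_iff)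
qed

context
  fixes f0 f1 z :: "real \<Rightarrow> real" and d :: real
  assumes f: "prob_density f0" "prob_density f1"
    and z: "z \<in> borel_measurable borel" "\<And>x. \<bar>z x\<bar> \<le> d"
    and tilt: "(\<integral>x. exp (z x) \<partial>law f0) = 1"
begin

lemma mean_time_T_sr: "0 < A \<Longrightarrow> ennreal A \<le> mean_time_no_change f0 f1 (T_sr z A)"
proof -
  assume "0 < A"
  interpret real_sequence "\<lambda>t. law (if enat t < \<infinity> then f0 else f1)"
    by (rule real_sequence_obs[OF f])
  show ?thesis
    unfolding mean_time_no_change_def obs_law_def T_sr_def
    by (rule sr_mean_passage[OF z]) (use tilt \<open>0 < A\<close> in auto)
qed

lemma mean_time_T_cusum: "0 < h \<Longrightarrow> ennreal (exp h) \<le> mean_time_no_change f0 f1 (T_cusum z h)"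
proof -
  assume "0 < h"
  have "ennreal (exp h) \<le> mean_time_no_change f0 f1 (T_sr z (exp h))"
    by (rule mean_time_T_sr) simp
  also have "\<dots> \<le> mean_time_no_change f0 f1 (T_cusum z h)"
    unfolding mean_time_no_change_def
    by (intro nn_integral_mono) (simp add: T_sr_le_T_cusum \<open>0 < h\<close>)
  finally show ?thesis .
qed

end

section \<open>Joint law of change time and observations\<close>

lemma sets_joint_law [simp, measurable_cong]:
  "sets (joint_law f0 f1 p) = sets (count_space UNIV \<Otimes>\<^sub>M obs_space)"
  unfolding joint_law_def by (rule sets_bind) simp_all

lemma nn_integral_joint_law:
  assumes f: "prob_density f0" "prob_density f1" and p: "0 < p" "p < 1"
    and h: "h \<in> borel_measurable (count_space UNIV \<Otimes>\<^sub>M obs_space)"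
  shows "(\<integral>\<^sup>+y. h y \<partial>joint_law f0 f1 p) =
    (\<Sum>k. ennreal (p * (1 - p) ^ k) * (\<integral>\<^sup>+\<omega>. h (Suc k, \<omega>) \<partial>obs_law f0 f1 (enat (Suc k))))"
proof -
  let ?N = "count_space (UNIV :: nat set) \<Otimes>\<^sub>M obs_space"
  let ?kern = "\<lambda>k. distr (obs_law f0 f1 (enat k)) ?N (Pair k)"
  have pair [measurable]: "Pair k \<in> measurable (obs_law f0 f1 \<tau>) ?N" for k \<tau>
    by (simp add: measurable_cong_sets[OF sets_obs_law refl])
  have "?kern k \<in> space (subprob_algebra ?N)" for k
  proof -
    interpret prob_space "obs_law f0 f1 (enat k)"
      by (rule prob_space_obs_law[OF f])
    have "prob_space (?kern k)"
      by (rule prob_space_distr[OF pair])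
    then show ?thesis
      by (simp add: space_subprob_algebra prob_space_imp_subprob_space)
  qed
  \<comment> \<open>The prior lives on a discrete space, where every map is measurable; only that
    each conditional law is a probability has to be checked.\<close>
  then have "?kern \<in> measurable (measure_pmf (change_prior p)) (subprob_algebra ?N)"
    by (simp add: measurable_def)
  then have "(\<integral>\<^sup>+y. h y \<partial>joint_law f0 f1 p) = (\<integral>\<^sup>+k. \<integral>\<^sup>+y. h y \<partial>?kern k \<partial>measure_pmf (change_prior p))"
    unfolding joint_law_def by (rule nn_integral_bind[OF h])
  also have "\<dots> = (\<integral>\<^sup>+k. \<integral>\<^sup>+\<omega>. h (k, \<omega>) \<partial>obs_law f0 f1 (enat k) \<partial>measure_pmf (change_prior p))"
    using h by (simp add: nn_integral_distr[OF pair])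
  also have "\<dots> = (\<Sum>k. ennreal (p * (1 - p) ^ k) * (\<integral>\<^sup>+\<omega>. h (Suc k, \<omega>) \<partial>obs_law f0 f1 (enat (Suc k))))"
    unfolding change_prior_def nn_integral_map_pmf
    using p by (simp add: nn_integral_measure_pmf nn_integral_count_space_nat mult.commute)
  finally show ?thesis .
qed

lemma measurable_count_space_times:
  assumes "\<And>k. (\<lambda>\<omega>. h (k, \<omega>)) \<in> measurable N L"
  shows "h \<in> measurable (count_space (UNIV :: nat set) \<Otimes>\<^sub>M N) L"
  by (rule measurable_pair_measure_countable1) (use assms in auto)

text \<open>For \<tau> = k + 1 a false alarm is an alarm by time k, which is decided by observations
  that precede the change. Each term can thus be computed under the law without a change.\<close>

lemma PFA_eq_suminf:
  assumes f: "prob_density f0" "prob_density f1" and p: "0 < p" "p < 1" and s: "adapted s"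
  shows "PFA f0 f1 p (\<lambda>\<omega>. first_passage (s \<omega>) b) =
    (\<Sum>k. p * (1 - p) ^ k *
      (1 - (\<integral>\<omega>. of_bool (enat k < first_passage (s \<omega>) b) \<partial>obs_law f0 f1 \<infinity>)))"
proof -
  let ?T = "\<lambda>\<omega>. first_passage (s \<omega>) b"
  define y :: "nat \<Rightarrow> real" where
    "y k = (\<integral>\<omega>. of_bool (enat k < ?T \<omega>) \<partial>obs_law f0 f1 \<infinity>)" for k
  let ?E = "{(k, \<omega>) \<in> space (joint_law f0 f1 p). ?T \<omega> < enat k}"
  have pred [measurable]: "Measurable.pred obs_space (\<lambda>\<omega>. enat k < ?T \<omega>)" for k
    by (rule depends_on_measurable_obs[OF depends_on_passage[OF s]]) auto
  have iff: "?T \<omega> < enat k \<longleftrightarrow> 1 \<le> k \<and> \<not> enat (k - 1) < ?T \<omega>" for k \<omega>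
    by (cases k; cases "?T \<omega>") auto
  have "(\<lambda>(k, \<omega>). ?T \<omega> < enat k) \<in> measurable (count_space UNIV \<Otimes>\<^sub>M obs_space) (count_space UNIV)"
    by (rule measurable_count_space_times) (simp add: iff)
  then have "{x \<in> space (count_space UNIV \<Otimes>\<^sub>M obs_space). (\<lambda>(k, \<omega>). ?T \<omega> < enat k) x}
      \<in> sets (count_space UNIV \<Otimes>\<^sub>M obs_space)"
    by (simp add: pred_def)
  moreover have "?E = {x \<in> space (count_space UNIV \<Otimes>\<^sub>M obs_space). (\<lambda>(k, \<omega>). ?T \<omega> < enat k) x}"
    using sets_eq_imp_space_eq[OF sets_joint_law] by auto
  ultimately have E: "?E \<in> sets (count_space UNIV \<Otimes>\<^sub>M obs_space)"
    by simp
  have y_le: "y k \<le> 1" and y_nonneg: "0 \<le> y k" for k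
  proof -
    interpret real_sequence "\<lambda>t. law (if enat t < \<infinity> then f0 else f1)"
      by (rule real_sequence_obs[OF f])
    show "y k \<le> 1" "0 \<le> y k"
      unfolding y_def obs_law_def by (rule expectation_of_bool_le_1 expectation_of_bool_nonneg)+
  qed
  have term_eq: "(\<integral>\<^sup>+\<omega>. indicator ?E (Suc k, \<omega>) \<partial>obs_law f0 f1 (enat (Suc k))) = ennreal (1 - y k)" for k
  proof -
    interpret real_sequence "\<lambda>t. law (if enat t < enat (Suc k) then f0 else f1)"
      by (rule real_sequence_obs[OF f])
    have dep: "depends_on {1..k} (count_space UNIV) (\<lambda>\<omega>. \<not> enat k < ?T \<omega>)"
      by (rule depends_on_compose[OF depends_on_passage[OF s]]) simp
    have "(\<integral>\<^sup>+\<omega>. indicator ?E (Suc k, \<omega>) \<partial>obs_law f0 f1 (enat (Suc k))) =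
        (\<integral>\<^sup>+\<omega>. of_bool (\<not> enat k < ?T \<omega>) \<partial>obs_law f0 f1 (enat (Suc k)))"
      using sets_eq_imp_space_eq[OF sets_joint_law[of f0 f1 p]]
      by (intro nn_integral_cong) (auto simp: space_pair_measure less_enat_iff_not_enat_less)
    also have "\<dots> = ennreal (\<integral>\<omega>. of_bool (\<not> enat k < ?T \<omega>) \<partial>obs_law f0 f1 (enat (Suc k)))"
      unfolding obs_law_def by (rule nn_integral_of_bool_eq_expectation[OF dep]) auto
    also have "(\<integral>\<omega>. of_bool (\<not> enat k < ?T \<omega>) \<partial>obs_law f0 f1 (enat (Suc k))) =
        (\<integral>\<omega>. 1 - of_bool (enat k < ?T \<omega>) \<partial>obs_law f0 f1 (enat (Suc k)) :: real)"
      by (simp add: of_bool_not_iff)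
    also have "\<dots> = 1 - (\<integral>\<omega>. of_bool (enat k < ?T \<omega>) \<partial>obs_law f0 f1 (enat (Suc k)))"
    proof -
      interpret Q: prob_space "obs_law f0 f1 (enat (Suc k))"
        by (rule prob_space_obs_law[OF f])
      have "integrable (obs_law f0 f1 (enat (Suc k))) (\<lambda>\<omega>. of_bool (enat k < ?T \<omega>) :: real)"
        unfolding obs_law_def
        by (rule integrable_depends_on[OF depends_on_of_bool[OF depends_on_passage[OF s]], where c = 1]) auto
      then show ?thesis
        by (simp add: Q.prob_space del: space_obs_law)
    qed
    also have "(\<integral>\<omega>. of_bool (enat k < ?T \<omega>) \<partial>obs_law f0 f1 (enat (Suc k))) = y k"
      unfolding y_def
      by (simp add: expectation_before_change[OF f depends_on_of_bool[OF depends_on_passage[OF s]]])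
    finally show ?thesis .
  qed
  have "(\<lambda>k. p * (1 - p) ^ k) sums (p * (1 / (1 - (1 - p))))"
    using p by (intro sums_mult geometric_sums) auto
  then have sm: "summable (\<lambda>k. p * (1 - p) ^ k * (1 - y k))"
    using p y_le y_nonneg
    by (intro summable_comparison_test'[OF sums_summable]) (auto simp: mult_left_le)
  have nonneg: "0 \<le> p * (1 - p) ^ k * (1 - y k)" for k
    using p y_le by simp
  have "emeasure (joint_law f0 f1 p) ?E = (\<integral>\<^sup>+y. indicator ?E y \<partial>joint_law f0 f1 p)"
    using E by (simp add: nn_integral_indicator)
  also have "\<dots> = (\<Sum>k. ennreal (p * (1 - p) ^ k) * ennreal (1 - y k))"
    using E by (subst nn_integral_joint_law[OF f p]) (auto simp: term_eq)
  also have "\<dots> = (\<Sum>k. ennreal (p * (1 - p) ^ k * (1 - y k)))"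
    using p y_le by (simp add: ennreal_mult)
  also have "\<dots> = ennreal (\<Sum>k. p * (1 - p) ^ k * (1 - y k))"
    by (rule suminf_ennreal2[OF nonneg sm])
  finally show ?thesis
    unfolding PFA_def measure_def y_def[symmetric] using suminf_nonneg[OF sm nonneg] by simp
qed

lemma PFA_T_shiryaev_le:
  assumes f: "prob_density f0" "prob_density f1"
    and z: "z \<in> borel_measurable borel" "\<And>x. \<bar>z x\<bar> \<le> d"
    and tilt: "(\<integral>x. exp (z x) \<partial>law f0) = 1"
    and p: "0 < p" "p < 1" and "0 < B"
  shows "PFA f0 f1 p (T_shiryaev p z B) \<le> 1 / (1 + B)"
proof -
  interpret real_sequence "\<lambda>t. law (if enat t < \<infinity> then f0 else f1)"
    by (rule real_sequence_obs[OF f])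
  show ?thesis
    unfolding T_shiryaev_def[abs_def] PFA_eq_suminf[OF f p adapted_shiryaev_stat[OF z(1)]] obs_law_def
    by (rule shiryaev_alarm_bound[OF z]) (use tilt \<open>0 < B\<close> p in auto)
qed

lemma obs_law_infinity: "obs_law f0 f1 \<infinity> = obs_law f0 f1' \<infinity>"
  by (simp add: obs_law_def)

lemma PFA_T_shiryaev_cong:
  assumes "prob_density f0" "prob_density f1" "prob_density f1'"
    and "z \<in> borel_measurable borel" "0 < p" "p < 1"
  shows "PFA f0 f1' p (T_shiryaev p z B) = PFA f0 f1 p (T_shiryaev p z B)"
  unfolding T_shiryaev_def[abs_def] using assms
  by (simp add: PFA_eq_suminf adapted_shiryaev_stat obs_law_infinity[of f0 f1' f1])

lemma nn_integral_cmult_of_bool_suminf: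
  fixes P :: "nat \<Rightarrow> 'a \<Rightarrow> bool"
  assumes [measurable]: "\<And>k. Measurable.pred M (P k)" "Measurable.pred M Q"
  shows "(\<integral>\<^sup>+x. of_bool (Q x) * (\<Sum>k. of_bool (P k x)) \<partial>M) = (\<Sum>k. \<integral>\<^sup>+x. of_bool (P k x \<and> Q x) \<partial>M)"
proof -
  have [measurable]: "(\<lambda>x. of_bool (P k x \<and> Q x) :: ennreal) \<in> borel_measurable M" for k
    by (simp add: of_bool_def)
  have "of_bool (Q x) * (\<Sum>k. of_bool (P k x)) = (\<Sum>k. of_bool (P k x \<and> Q x) :: ennreal)" for x
    by (cases "Q x") auto
  then show ?thesis
    by (simp add: nn_integral_suminf)
qed

section \<open>Delay bound for any statistic dominating restarted walks\<close>

context
  fixes f0 f1 g :: "real \<Rightarrow> real" and d gmax \<beta> b :: real and s :: "(nat \<Rightarrow> real) \<Rightarrow> nat \<Rightarrow> real"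
  assumes f: "prob_density f0" "prob_density f1"
    and g: "g \<in> borel_measurable borel" "\<And>x. \<bar>g x\<bar> \<le> d" "\<And>x. g x \<le> gmax"
    and drift: "0 < (\<integral>x. g x \<partial>law f1)" and nonneg: "0 \<le> gmax" "0 < \<beta>"
    and s: "adapted s"
    and cross: "\<And>\<omega> k m. 1 \<le> m \<Longrightarrow> s \<omega> (k + m) < b \<Longrightarrow> (\<Sum>i<m. g (\<omega> (Suc k + i))) < \<beta>"
begin

private abbreviation (input) "bound \<equiv> ennreal ((\<beta> + gmax) / (\<integral>x. g x \<partial>law f1))"

text \<open>The surrogate for survival after the change: unlike the alarm time, it does not involve
  the observations before \<tau>.\<close>

private definition walking :: "nat \<Rightarrow> nat \<Rightarrow> (nat \<Rightarrow> real) \<Rightarrow> bool" where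
  "walking \<tau> m \<omega> \<longleftrightarrow> (\<forall>j\<in>{1..m}. (\<Sum>i<j. g (\<omega> (\<tau> + i))) < \<beta>)"

lemma depends_on_walking: "depends_on {\<tau>..} (count_space UNIV) (walking \<tau> m)"
  unfolding walking_def[abs_def]
  by (intro depends_on_Ball depends_on_less depends_on_sum
      depends_on_compose[OF depends_on_component g(1)]) auto

text \<open>With no alarm by \<tau> + m - 1 the statistic is below b at each time \<tau> - 1 + j
  with 1 \<le> j \<le> m, and \<open>cross\<close> keeps the walk restarted after \<tau> - 1 below
  \<beta> at each of these j.\<close>

lemma delay_le_walking:
  assumes "1 \<le> \<tau>"
  shows "delay (first_passage (s \<omega>) b) \<tau> \<le> (\<Sum>m. of_bool (walking \<tau> m \<omega>))"
  unfolding delay_eq_suminf[OF assms]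
proof (intro suminf_le)
  fix m
  have "walking \<tau> m \<omega>" if *: "enat (\<tau> + m - 1) < first_passage (s \<omega>) b"
    unfolding walking_def
  proof
    fix j assume j: "j \<in> {1..m}"
    have "\<tau> - 1 + j \<in> {1..\<tau> + m - 1}"
      using j assms by auto
    then have "s \<omega> (\<tau> - 1 + j) < b"
      using * unfolding enat_less_first_passage_iff by blast
    then show "(\<Sum>i<j. g (\<omega> (\<tau> + i))) < \<beta>"
      using cross[of j \<omega> "\<tau> - 1"] j assms by simp
  qed
  then show "of_bool (enat (\<tau> + m - 1) < first_passage (s \<omega>) b) \<le> (of_bool (walking \<tau> m \<omega>) :: ennreal)"
    by (auto simp: of_bool_def)
qed auto

text \<open>The event \<open>Q\<close> lies in the past of \<tau> and the walk in its future, so the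
  factorisation holds for each m and sums up by monotone convergence. The mean of the count is then
  bounded by Wald's identity.\<close>

lemma nn_integral_past_mult_walking:
  assumes "1 \<le> \<tau>" and Q: "depends_on {1..<\<tau>} (count_space UNIV) Q"
  shows "(\<integral>\<^sup>+\<omega>. of_bool (Q \<omega>) * (\<Sum>m. of_bool (walking \<tau> m \<omega>)) \<partial>obs_law f0 f1 (enat \<tau>)) =
      (\<integral>\<^sup>+\<omega>. of_bool (Q \<omega>) \<partial>obs_law f0 f1 (enat \<tau>)) *
      (\<integral>\<^sup>+\<omega>. (\<Sum>m. of_bool (walking \<tau> m \<omega>)) \<partial>obs_law f0 f1 (enat \<tau>))"
    and "(\<integral>\<^sup>+\<omega>. (\<Sum>m. of_bool (walking \<tau> m \<omega>)) \<partial>obs_law f0 f1 (enat \<tau>)) \<le> bound"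
proof -
  interpret real_sequence "\<lambda>t. law (if enat t < enat \<tau> then f0 else f1)"
    by (rule real_sequence_obs[OF f])
  let ?P = "obs_law f0 f1 (enat \<tau>)"
  have W: "depends_on {\<tau>..} (count_space UNIV) (walking \<tau> m)" for m
    by (rule depends_on_walking)
  have pred [measurable]: "Measurable.pred obs_space Q" "Measurable.pred obs_space (walking \<tau> m)" for m
    using assms by (auto intro!: depends_on_measurable_obs[OF Q] depends_on_measurable_obs[OF W])
  have QW: "depends_on {1..} (count_space UNIV) (\<lambda>\<omega>. walking \<tau> m \<omega> \<and> Q \<omega>)" for m
    using assms by (intro depends_on_compose2[OF depends_on_mono[OF W] depends_on_mono[OF Q]]) auto
  define w where "w m = (\<integral>\<omega>. of_bool (walking \<tau> m \<omega>) \<partial>?P :: real)" for m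
  define q where "q = (\<integral>\<omega>. of_bool (Q \<omega>) \<partial>?P :: real)"
  have [simp]: "0 \<le> w m" "0 \<le> q" for m
    unfolding w_def q_def obs_law_def by (rule expectation_of_bool_nonneg)+
  have eq_w: "(\<integral>\<^sup>+\<omega>. of_bool (walking \<tau> m \<omega>) \<partial>?P) = ennreal (w m)" for m
    unfolding w_def obs_law_def using assms by (intro nn_integral_of_bool_eq_expectation[OF W]) auto
  have eq_q: "(\<integral>\<^sup>+\<omega>. of_bool (Q \<omega>) \<partial>?P) = ennreal q"
    unfolding q_def obs_law_def using assms by (intro nn_integral_of_bool_eq_expectation[OF Q]) auto
  have eq_qw: "(\<integral>\<^sup>+\<omega>. of_bool (walking \<tau> m \<omega> \<and> Q \<omega>) \<partial>?P) = ennreal q * ennreal (w m)" for m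
  proof -
    have "(\<integral>\<^sup>+\<omega>. of_bool (walking \<tau> m \<omega> \<and> Q \<omega>) \<partial>?P) =
        ennreal (\<integral>\<omega>. of_bool (walking \<tau> m \<omega> \<and> Q \<omega>) \<partial>?P)"
      unfolding obs_law_def by (intro nn_integral_of_bool_eq_expectation[OF QW]) auto
    also have "(\<integral>\<omega>. of_bool (walking \<tau> m \<omega> \<and> Q \<omega>) \<partial>?P) =
        (\<integral>\<omega>. of_bool (Q \<omega>) * of_bool (walking \<tau> m \<omega>) \<partial>?P :: real)"
      by (simp add: of_bool_conj mult.commute)
    also have "\<dots> = q * w m"
      unfolding q_def w_def obs_law_def using assms
      by (intro expectation_mult_depends_on[OF depends_on_of_bool[OF Q] _ _ depends_on_of_bool[OF W], where c = 1 and d = 1]) auto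
    finally show ?thesis
      by (simp add: ennreal_mult)
  qed
  have eq_sum: "(\<integral>\<^sup>+\<omega>. (\<Sum>m. of_bool (walking \<tau> m \<omega>)) \<partial>?P) = (\<Sum>m. ennreal (w m))"
  proof -
    have "(\<lambda>\<omega>. of_bool (walking \<tau> m \<omega>) :: ennreal) \<in> borel_measurable ?P" for m
      unfolding of_bool_def by measurable
    then show ?thesis
      by (simp only: nn_integral_suminf eq_w)
  qed
  show "(\<integral>\<^sup>+\<omega>. of_bool (Q \<omega>) * (\<Sum>m. of_bool (walking \<tau> m \<omega>)) \<partial>?P) =
      (\<integral>\<^sup>+\<omega>. of_bool (Q \<omega>) \<partial>?P) * (\<integral>\<^sup>+\<omega>. (\<Sum>m. of_bool (walking \<tau> m \<omega>)) \<partial>?P)"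
    unfolding eq_sum eq_q by (subst nn_integral_cmult_of_bool_suminf) (simp_all add: eq_qw)
  show "(\<integral>\<^sup>+\<omega>. (\<Sum>m. of_bool (walking \<tau> m \<omega>)) \<partial>?P) \<le> bound"
    unfolding eq_sum unfolding w_def walking_def obs_law_def
    by (rule wald_bound[OF g assms(1) _ drift]) (use nonneg in auto)
qed

lemma measurable_delay: "(\<lambda>\<omega>. delay (first_passage (s \<omega>) b) \<tau>) \<in> borel_measurable obs_space"
proof -
  have [measurable]: "Measurable.pred obs_space (\<lambda>\<omega>. enat n < first_passage (s \<omega>) b)" for n
    by (rule depends_on_measurable_obs[OF depends_on_passage[OF s]]) auto
  \<comment> \<open>Measurability on the product with the change time is checked slice by slice,
    including \<tau> = 0. For \<tau> = m = 0 the truncated index \<tau> + m - 1 would give the wrong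
    condition, hence the extra disjunct.\<close>
  have iff: "enat m < T + 1 - enat \<tau> \<longleftrightarrow> \<tau> + m = 0 \<or> enat (\<tau> + m - 1) < T" for m T
    by (cases T) (auto simp: one_enat_def)
  have [measurable]: "(\<lambda>\<omega>. of_bool (\<tau> + m = 0 \<or> enat (\<tau> + m - 1) < first_passage (s \<omega>) b) :: ennreal)
      \<in> borel_measurable obs_space" for m
    unfolding of_bool_def by measurable
  show ?thesis
    unfolding delay_def ennreal_of_enat_eq_suminf iff by measurable
qed

text \<open>The conditional mean of the delay is not computed. The dominating count is independent
  of the history, so its conditional expectation is almost surely its plain mean, and monotonicity
  of conditional expectation carries the bound over to the delay.\<close>

lemma ADD_le: "ADD f0 f1 (\<lambda>\<omega>. first_passage (s \<omega>) b) \<le> bound"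
  unfolding ADD_def
proof (rule SUP_least)
  fix \<tau> :: nat assume "\<tau> \<in> {1..}"
  then have \<tau>: "1 \<le> \<tau>"
    by simp
  let ?P = "obs_law f0 f1 (enat \<tau>)" and ?H = "history \<tau>"
  let ?N = "\<lambda>\<omega>. (\<Sum>m. of_bool (walking \<tau> m \<omega>)) :: ennreal"
  interpret prob_space ?P
    by (rule prob_space_obs_law[OF f])
  have restr: "(\<lambda>\<omega>. restrict \<omega> {1..<\<tau>}) \<in> measurable obs_space (\<Pi>\<^sub>M t\<in>{1..<\<tau>}. borel)"
    unfolding obs_space_def by (rule measurable_restrict_subset) auto
  have restr_space: "(\<lambda>\<omega>. restrict \<omega> {1..<\<tau>}) \<in> space obs_space \<rightarrow> space (\<Pi>\<^sub>M t\<in>{1..<\<tau>}. borel)"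
    using measurable_space[OF restr] by auto
  have sub: "subalgebra ?P ?H"
    unfolding subalgebra_def history_def
    using measurable_sets[OF restr] by (auto simp: sets_vimage_algebra2[OF restr_space])
  interpret finite_measure_subalgebra ?P ?H
    by unfold_locales (rule sub)
  have walk [measurable]: "Measurable.pred obs_space (walking \<tau> m)" for m
    using \<tau> by (intro depends_on_measurable_obs[OF depends_on_walking]) auto
  have [measurable]: "(\<lambda>\<omega>. of_bool (walking \<tau> m \<omega>) :: ennreal) \<in> borel_measurable obs_space" for m
    by (simp add: of_bool_def)
  have N [measurable]: "?N \<in> borel_measurable obs_space"
    by measurable
  note measurable_delay [measurable]
  \<comment> \<open>Tested against sets of the history: each is the preimage of a set of initial
    segments, so its indicator is an event on the coordinates before \<tau>.\<close>
  have "AE \<omega> in ?P. (\<integral>\<^sup>+\<omega>. ?N \<omega> \<partial>?P) = nn_cond_exp ?P ?H ?N \<omega>"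
  proof (rule nn_cond_exp_charact)
    fix A assume "A \<in> sets ?H"
    then obtain B where A: "A = (\<lambda>\<omega>. restrict \<omega> {1..<\<tau>}) -` B \<inter> space obs_space"
      and B: "B \<in> sets (\<Pi>\<^sub>M t\<in>{1..<\<tau>}. borel)"
      by (auto simp: history_def sets_vimage_algebra2[OF restr_space])
    have "(\<lambda>\<omega>. restrict \<omega> {1..<\<tau>}) \<in> measurable (\<Pi>\<^sub>M t\<in>{1..<\<tau>}. borel :: real measure) (\<Pi>\<^sub>M t\<in>{1..<\<tau>}. borel)"
      by (rule measurable_restrict_subset) auto
    then have Q: "depends_on {1..<\<tau>} (count_space UNIV) (\<lambda>\<omega>. restrict \<omega> {1..<\<tau>} \<in> B)"
      using B by (simp add: depends_on_def)
    have ind: "indicator A \<omega> = (of_bool (restrict \<omega> {1..<\<tau>} \<in> B) :: ennreal)" if "\<omega> \<in> space ?P" for \<omega>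
      using that by (auto simp: A indicator_def)
    have "(\<integral>\<^sup>+\<omega>\<in>A. ?N \<omega> \<partial>?P) = (\<integral>\<^sup>+\<omega>. of_bool (restrict \<omega> {1..<\<tau>} \<in> B) * ?N \<omega> \<partial>?P)"
      by (rule nn_integral_cong) (simp add: ind mult.commute)
    also have "\<dots> = (\<integral>\<^sup>+\<omega>. of_bool (restrict \<omega> {1..<\<tau>} \<in> B) \<partial>?P) * (\<integral>\<^sup>+\<omega>. ?N \<omega> \<partial>?P)"
      by (rule nn_integral_past_mult_walking(1)[OF \<tau> Q])
    also have "(\<integral>\<^sup>+\<omega>. of_bool (restrict \<omega> {1..<\<tau>} \<in> B) \<partial>?P) = (\<integral>\<^sup>+\<omega>. indicator A \<omega> \<partial>?P)"
      by (rule nn_integral_cong) (simp add: ind)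
    also have "\<dots> * (\<integral>\<^sup>+\<omega>. ?N \<omega> \<partial>?P) = (\<integral>\<^sup>+\<omega>\<in>A. (\<integral>\<^sup>+\<omega>. ?N \<omega> \<partial>?P) \<partial>?P)"
      using \<open>A \<in> sets ?H\<close> sub
      by (subst nn_integral_cmult) (auto simp: mult.commute subalgebra_def)
    finally show "(\<integral>\<^sup>+\<omega>\<in>A. ?N \<omega> \<partial>?P) = (\<integral>\<^sup>+\<omega>\<in>A. (\<integral>\<^sup>+\<omega>. ?N \<omega> \<partial>?P) \<partial>?P)" .
  qed auto
  moreover have "AE \<omega> in ?P. nn_cond_exp ?P ?H (\<lambda>\<omega>. delay (first_passage (s \<omega>) b) \<tau>) \<omega> \<le> nn_cond_exp ?P ?H ?N \<omega>"
    by (rule nn_cond_exp_mono) (auto simp: delay_le_walking[OF \<tau>])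
  ultimately have "AE \<omega> in ?P. nn_cond_exp ?P ?H (\<lambda>\<omega>. delay (first_passage (s \<omega>) b) \<tau>) \<omega> \<le> bound"
  proof eventually_elim
    case (elim \<omega>)
    have "(\<integral>\<^sup>+\<omega>. ?N \<omega> \<partial>?P) \<le> bound"
      by (rule nn_integral_past_mult_walking(2)[OF \<tau> depends_on_const[of True]]) simp
    then show ?case
      by (rule order.trans[OF order.trans[OF elim(2) eq_refl[OF elim(1)[symmetric]]]])
  qed
  then show "esssup ?P (nn_cond_exp ?P ?H (\<lambda>\<omega>. delay (first_passage (s \<omega>) b) \<tau>)) \<le> bound"
    by (intro esssup_I) auto
qed

text \<open>For \<tau> = k + 1 the conditioning event, survival past k, belongs to the past and is
  independent of the restarted walk. Hence each term of the numerator is at most the bound times the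
  corresponding term of the denominator, whatever the weights.\<close>

lemma bayes_delay_le:
  assumes p: "0 < p" "p < 1"
  shows "bayes_delay f0 f1 p (\<lambda>\<omega>. first_passage (s \<omega>) b) \<le> bound"
proof -
  let ?T = "\<lambda>\<omega>. first_passage (s \<omega>) b" and ?J = "joint_law f0 f1 p"
  let ?E = "{(k, \<omega>) \<in> space ?J. enat k \<le> ?T \<omega>}"
  define h where "h y = delay (?T (snd y)) (fst y) * indicator {(k, \<omega>). enat k \<le> ?T \<omega>} y"
    for y :: "nat \<times> (nat \<Rightarrow> real)"
  have iff: "enat k \<le> ?T \<omega> \<longleftrightarrow> k = 0 \<or> enat (k - 1) < ?T \<omega>" for k \<omega>
    by (cases k; cases "?T \<omega>") (auto simp: zero_enat_def[symmetric])
  have pred [measurable]: "Measurable.pred obs_space (\<lambda>\<omega>. enat k < ?T \<omega>)" for k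
    by (rule depends_on_measurable_obs[OF depends_on_passage[OF s]]) auto
  have [measurable]: "Measurable.pred obs_space (\<lambda>\<omega>. enat k \<le> ?T \<omega>)" for k
    unfolding iff by measurable
  have space_J: "space ?J = UNIV \<times> space obs_space"
    using sets_eq_imp_space_eq[OF sets_joint_law] by (simp add: space_pair_measure)
  have "(\<lambda>(k, \<omega>). enat k \<le> ?T \<omega>) \<in> measurable (count_space UNIV \<Otimes>\<^sub>M obs_space) (count_space UNIV)"
    by (rule measurable_count_space_times) simp
  then have "{x \<in> space (count_space UNIV \<Otimes>\<^sub>M obs_space). (\<lambda>(k, \<omega>). enat k \<le> ?T \<omega>) x}
      \<in> sets (count_space UNIV \<Otimes>\<^sub>M obs_space)"
    by (simp add: pred_def)
  moreover have "?E = {x \<in> space (count_space UNIV \<Otimes>\<^sub>M obs_space). (\<lambda>(k, \<omega>). enat k \<le> ?T \<omega>) x}"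
    by (auto simp: space_J space_pair_measure)
  ultimately have E: "?E \<in> sets (count_space UNIV \<Otimes>\<^sub>M obs_space)"
    by simp
  have h: "h \<in> borel_measurable (count_space UNIV \<Otimes>\<^sub>M obs_space)"
  proof (rule measurable_count_space_times)
    fix k
    have "(\<lambda>\<omega>. delay (?T \<omega>) k * (if enat k \<le> ?T \<omega> then 1 else 0)) \<in> borel_measurable obs_space"
      using measurable_delay[of k] by measurable
    then show "(\<lambda>\<omega>. h (k, \<omega>)) \<in> borel_measurable obs_space"
      by (simp add: h_def indicator_def of_bool_def)
  qed
  let ?O = "\<lambda>k. obs_law f0 f1 (enat (Suc k))"
  have "emeasure ?J ?E = (\<integral>\<^sup>+y. indicator ?E y \<partial>?J)"
    using E by (simp add: nn_integral_indicator)
  also have "\<dots> = (\<Sum>k. ennreal (p * (1 - p) ^ k) * (\<integral>\<^sup>+\<omega>. indicator ?E (Suc k, \<omega>) \<partial>?O k))"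
    using E by (intro nn_integral_joint_law[OF f p]) simp
  also have "\<dots> = (\<Sum>k. ennreal (p * (1 - p) ^ k) * (\<integral>\<^sup>+\<omega>. of_bool (enat k < ?T \<omega>) \<partial>?O k))"
  proof -
    have "(\<integral>\<^sup>+\<omega>. indicator ?E (Suc k, \<omega>) \<partial>?O k) = (\<integral>\<^sup>+\<omega>. of_bool (enat k < ?T \<omega>) \<partial>?O k)" for k
      by (intro nn_integral_cong) (simp add: space_J indicator_def iff)
    then show ?thesis
      by simp
  qed
  finally have den: "emeasure ?J ?E = (\<Sum>k. ennreal (p * (1 - p) ^ k) * (\<integral>\<^sup>+\<omega>. of_bool (enat k < ?T \<omega>) \<partial>?O k))" .
  have "(\<integral>\<^sup>+y. h y \<partial>?J) = (\<Sum>k. ennreal (p * (1 - p) ^ k) * (\<integral>\<^sup>+\<omega>. h (Suc k, \<omega>) \<partial>?O k))"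
    by (rule nn_integral_joint_law[OF f p h])
  also have "\<dots> \<le> (\<Sum>k. ennreal (p * (1 - p) ^ k) * (\<integral>\<^sup>+\<omega>. of_bool (enat k < ?T \<omega>) \<partial>?O k) * bound)"
  proof (rule suminf_le)
    fix k
    let ?N = "\<lambda>\<omega>. (\<Sum>m. of_bool (walking (Suc k) m \<omega>)) :: ennreal"
    have Q: "depends_on {1..<Suc k} (count_space UNIV) (\<lambda>\<omega>. enat k < ?T \<omega>)"
      using depends_on_passage[OF s, of k b] by (simp add: atLeastLessThanSuc_atLeastAtMost)
    have "(\<integral>\<^sup>+\<omega>. h (Suc k, \<omega>) \<partial>?O k) \<le> (\<integral>\<^sup>+\<omega>. of_bool (enat k < ?T \<omega>) * ?N \<omega> \<partial>?O k)"
      using delay_le_walking[of "Suc k"]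
      by (intro nn_integral_mono) (simp add: h_def indicator_def iff)
    also have "\<dots> = (\<integral>\<^sup>+\<omega>. of_bool (enat k < ?T \<omega>) \<partial>?O k) * (\<integral>\<^sup>+\<omega>. ?N \<omega> \<partial>?O k)"
      by (rule nn_integral_past_mult_walking(1)[OF _ Q]) simp
    also have "\<dots> \<le> (\<integral>\<^sup>+\<omega>. of_bool (enat k < ?T \<omega>) \<partial>?O k) * bound"
      by (intro mult_left_mono nn_integral_past_mult_walking(2)[OF _ Q]) simp_all
    finally show "ennreal (p * (1 - p) ^ k) * (\<integral>\<^sup>+\<omega>. h (Suc k, \<omega>) \<partial>?O k) \<le>
        ennreal (p * (1 - p) ^ k) * (\<integral>\<^sup>+\<omega>. of_bool (enat k < ?T \<omega>) \<partial>?O k) * bound"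
      by (simp add: mult.assoc mult_left_mono)
  qed auto
  also have "\<dots> = emeasure ?J ?E * bound"
    unfolding den by simp
  finally have le: "(\<integral>\<^sup>+y. h y \<partial>?J) \<le> bound * emeasure ?J ?E"
    by (simp add: mult.commute)
  have "(\<integral>\<^sup>+y. h y \<partial>?J) / emeasure ?J ?E \<le> bound"
  \<comment> \<open>If the conditioning event is null, \<open>le\<close> makes the numerator 0 as
    well, and 0 / 0 = 0 in \<open>ennreal\<close>.\<close>
  proof (cases "emeasure ?J ?E = 0")
    case True
    then show ?thesis
      using le by simp
  next
    case False
    then show ?thesis
      using le by (intro divide_le_posI_ennreal) (auto simp: zero_less_iff_neq_zero mult.commute)
  qed
  then show ?thesis
    by (simp add: bayes_delay_def h_def)
qed

end

section \<open>Delay bounds for the three rules\<close>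

context
  fixes f0 f1 z :: "real \<Rightarrow> real" and d zmax :: real
  assumes f: "prob_density f0" "prob_density f1"
    and z: "z \<in> borel_measurable borel" "\<And>x. \<bar>z x\<bar> \<le> d" "\<And>x. z x \<le> zmax"
    and drift: "0 < (\<integral>x. z x \<partial>law f1)" and zmax: "0 \<le> zmax"
begin

lemma ADD_T_cusum_le:
  assumes "0 < h"
  shows "ADD f0 f1 (T_cusum z h) \<le> ennreal ((h + zmax) / (\<integral>x. z x \<partial>law f1))"
  unfolding T_cusum_def[abs_def]
proof (rule ADD_le[OF f z drift zmax assms adapted_cusum_stat[OF z(1)]])
  fix \<omega> k m assume "cusum_stat z \<omega> (k + m) < h"
  with cusum_stat_ge show "(\<Sum>i<m. z (\<omega> (Suc k + i))) < h"
    by (rule le_less_trans)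
qed

lemma ADD_T_sr_le:
  assumes "1 < A"
  shows "ADD f0 f1 (T_sr z A) \<le> ennreal ((ln A + zmax) / (\<integral>x. z x \<partial>law f1))"
  unfolding T_sr_def[abs_def]
proof (rule ADD_le[OF f z drift zmax _ adapted_sr_stat[OF z(1)]])
  show "0 < ln A"
    using assms by simp
next
  fix \<omega> and k m :: nat assume "1 \<le> m" "sr_stat z \<omega> (k + m) < A"
  then have "exp (\<Sum>i<m. z (\<omega> (Suc k + i))) < A"
    using sr_stat_ge by (blast intro: le_less_trans)
  then have "ln (exp (\<Sum>i<m. z (\<omega> (Suc k + i)))) < ln A"
    using assms by (subst ln_less_cancel_iff) auto
  then show "(\<Sum>i<m. z (\<omega> (Suc k + i))) < ln A"
    by simp
qed

text \<open>The comparison walk has increments z + \<open>lambda_p p\<close>. Its drift gains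
  \<open>lambda_p p\<close>, and so does its largest possible increment, which is why the term
  occurs in both numerator and denominator.\<close>

lemma T_shiryaev_delay_le:
  assumes p: "0 < p" "p < 1" "p < B"
  defines "C \<equiv> ennreal ((ln (B / p) + zmax + lambda_p p) / ((\<integral>x. z x \<partial>law f1) + lambda_p p))"
  shows "ADD f0 f1 (T_shiryaev p z B) \<le> C" "bayes_delay f0 f1 p (T_shiryaev p z B) \<le> C"
proof -
  interpret prob_space "law f1"
    using f by (simp add: prob_density_def)
  let ?g = "\<lambda>x. z x + lambda_p p"
  have lambda: "0 < lambda_p p"
    using p by (simp add: lambda_p_def)
  have g: "?g \<in> borel_measurable borel" "\<And>x. \<bar>?g x\<bar> \<le> d + lambda_p p" "\<And>x. ?g x \<le> zmax + lambda_p p"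
    using z lambda by (auto intro: order.trans[OF abs_triangle_ineq])
  have "integrable (law f1) z"
    by (rule integrable_const_bound[of _ d]) (use z in auto)
  then have mean: "(\<integral>x. ?g x \<partial>law f1) = (\<integral>x. z x \<partial>law f1) + lambda_p p"
    using prob_space by simp
  then have drift': "0 < (\<integral>x. ?g x \<partial>law f1)" and zmax': "0 \<le> zmax + lambda_p p"
    using drift zmax lambda by auto
  have \<beta>: "0 < ln (B / p)"
    using p by simp
  have cross: "(\<Sum>i<m. ?g (\<omega> (Suc k + i))) < ln (B / p)"
    if "1 \<le> m" "shiryaev_stat p z \<omega> (k + m) < B" for \<omega> and k m :: nat
  proof -
    have "p * exp (\<Sum>i<m. ?g (\<omega> (Suc k + i))) < B"
      using shiryaev_stat_ge[OF that(1) p(1,2)] that(2) by (rule le_less_trans)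
    then have "exp (\<Sum>i<m. ?g (\<omega> (Suc k + i))) < B / p"
      using p by (simp add: field_simps)
    then have "ln (exp (\<Sum>i<m. ?g (\<omega> (Suc k + i)))) < ln (B / p)"
      using p by (subst ln_less_cancel_iff) auto
    then show ?thesis
      by simp
  qed
  note ADD_le[OF f g drift' zmax' \<beta> adapted_shiryaev_stat[OF z(1)] cross]
    bayes_delay_le[OF f g drift' zmax' \<beta> adapted_shiryaev_stat[OF z(1)] cross p(1,2)]
  then show "ADD f0 f1 (T_shiryaev p z B) \<le> C" "bayes_delay f0 f1 p (T_shiryaev p z B) \<le> C"
    unfolding mean C_def T_shiryaev_def[abs_def] by (simp_all add: add.assoc)
qed

end

section \<open>Moment generating functions\<close>

text \<open>The Lagrange remainder is exp t * y^3 / 6 with |t| \<le> 1, and exp 1 \<le> 3 turns 1/6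
  into 1/2.\<close>

lemma abs_exp_minus_taylor2_le:
  fixes y :: real
  assumes "\<bar>y\<bar> \<le> 1"
  shows "\<bar>exp y - (1 + y + y\<^sup>2 / 2)\<bar> \<le> \<bar>y\<bar> ^ 3 / 2"
proof -
  obtain t where t: "\<bar>t\<bar> \<le> \<bar>y\<bar>" "exp y = (\<Sum>m<3. y ^ m / fact m) + exp t / fact 3 * y ^ 3"
    using Maclaurin_exp_le[of y 3] by blast
  have "exp t \<le> exp 1"
    using t assms by simp
  then have "exp t \<le> 3"
    using exp_le by linarith
  then have "\<bar>exp t / 6 * y ^ 3\<bar> \<le> 3 / 6 * \<bar>y\<bar> ^ 3"
    unfolding abs_mult power_abs[symmetric] by (intro mult_right_mono) auto
  moreover have eq: "exp y - (1 + y + y\<^sup>2 / 2) = exp t / 6 * y ^ 3"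
  proof -
    have "{..<3 :: nat} = {0, 1, 2}"
      by auto
    then show ?thesis
      using t(2) by (simp add: fact_numeral)
  qed
  ultimately show ?thesis
    unfolding eq by simp
qed

text \<open>The values at 0 and at y are compared with the tangent at u y; in the weighted mean the
  slopes cancel. Strictness is taken from the endpoint 0.\<close>

lemma exp_strictly_convex:
  fixes y u :: real
  assumes "0 < u" "u < 1" "y \<noteq> 0"
  shows "exp (u * y) < (1 - u) + u * exp y"
proof -
  have "1 - u * y < exp (- (u * y))"
    using assms by (subst exp_minus_greater) auto
  then have "(1 - u * y) * exp (u * y) < exp (- (u * y)) * exp (u * y)"
    by (rule mult_strict_right_mono) simp
  then have 1: "(1 - u) * ((1 - u * y) * exp (u * y)) < (1 - u) * 1"
    using assms by (intro mult_strict_left_mono) (auto simp: exp_minus)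
  have "(1 + (1 - u) * y) * exp (u * y) \<le> exp ((1 - u) * y) * exp (u * y)"
    by (intro mult_right_mono) auto
  also have "\<dots> = exp y"
    by (simp flip: exp_add add: algebra_simps)
  finally have 2: "u * ((1 + (1 - u) * y) * exp (u * y)) \<le> u * exp y"
    using assms by (intro mult_left_mono) auto
  have "exp (u * y) = (1 - u) * ((1 - u * y) * exp (u * y)) + u * ((1 + (1 - u) * y) * exp (u * y))"
    by (simp add: algebra_simps)
  also have "\<dots> < (1 - u) * 1 + u * exp y"
    using 1 2 by (rule add_less_le_mono)
  finally show ?thesis
    by simp
qed

context prob_space
begin

context
  fixes X :: "'a \<Rightarrow> real" and C :: real
  assumes X [measurable]: "X \<in> borel_measurable M" and X_le: "\<And>x. \<bar>X x\<bar> \<le> C"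
begin

lemma integrable_exp_mult: "integrable M (\<lambda>x. exp (t * X x))"
proof (rule integrable_const_bound)
  have "exp (t * X x) \<le> exp (\<bar>t\<bar> * C)" for x
  proof -
    have "t * X x \<le> \<bar>t * X x\<bar>"
      by simp
    also have "\<dots> \<le> \<bar>t\<bar> * C"
      unfolding abs_mult by (intro mult_left_mono X_le) simp
    finally show ?thesis
      by simp
  qed
  then show "AE x in M. norm (exp (t * X x)) \<le> exp (\<bar>t\<bar> * C)"
    by simp
qed simp

lemma integrable_bounded_variable: "integrable M X"
  by (rule integrable_const_bound[of _ C]) (use X_le in auto)

text \<open>Convexity on the interval from 0 to t, made strict: \<open>D\<close> is the pointwise
  convexity gap, and a zero mean would force X = 0 almost surely, against the negative mean. Both
  the uniqueness of the root and the later localisation of \<open>theta0\<close> rest on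
  this.\<close>

lemma mgf_less_one:
  assumes "0 < s" "s < t" "expectation (\<lambda>x. exp (t * X x)) \<le> 1" and neg: "expectation X < 0"
  shows "expectation (\<lambda>x. exp (s * X x)) < 1"
proof (rule ccontr)
  assume ge: "\<not> expectation (\<lambda>x. exp (s * X x)) < 1"
  define D where "D x = (1 - s / t) + s / t * exp (t * X x) - exp (s * X x)" for x
  have D_pos: "0 < D x" if "X x \<noteq> 0" for x
    using exp_strictly_convex[of "s / t" "t * X x"] assms that by (simp add: D_def)
  have D_nonneg: "0 \<le> D x" for x
    using D_pos[of x] by (cases "X x = 0") (auto simp: D_def)
  have int: "integrable M D"
    unfolding D_def[abs_def] by (intro Bochner_Integration.integrable_diff Bochner_Integration.integrable_add
        integrable_mult_right integrable_exp_mult integrable_const)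
  have "expectation D = (1 - s / t) + s / t * expectation (\<lambda>x. exp (t * X x)) - expectation (\<lambda>x. exp (s * X x))"
    unfolding D_def[abs_def] using prob_space
    by (simp add: integrable_exp_mult Bochner_Integration.integral_diff Bochner_Integration.integral_add)
  also have "\<dots> \<le> (1 - s / t) + s / t * 1 - 1"
    using assms ge by (intro diff_mono add_left_mono mult_left_mono) auto
  finally have "expectation D = 0"
    using D_nonneg by (intro antisym Bochner_Integration.integral_nonneg) auto
  then have "AE x in M. D x = 0"
    using int D_nonneg by (subst (asm) integral_nonneg_eq_0_iff_AE) auto
  then have "AE x in M. X x = 0"
    by eventually_elim (use D_pos in force)
  then have "expectation X = 0"
    by (subst integral_cong_AE[where g = "\<lambda>_. 0"]) auto
  with neg show False
    by simp
qed

text \<open>A finite convex function on an open set is continuous, so no dominated convergence is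
  needed.\<close>

lemma continuous_mgf: "continuous_on UNIV (\<lambda>t. expectation (\<lambda>x. exp (t * X x)))"
proof (rule convex_on_continuous)
  show "convex_on UNIV (\<lambda>t. expectation (\<lambda>x. exp (t * X x)))"
  proof (rule convex_onI)
    fix u s t :: real assume u: "0 < u" "u < 1"
    have "exp (((1 - u) *\<^sub>R s + u *\<^sub>R t) * X x) \<le> (1 - u) * exp (s * X x) + u * exp (t * X x)" for x
      using convex_onD[OF exp_convex, of u "s * X x" "t * X x"] u by (simp add: algebra_simps)
    then have "expectation (\<lambda>x. exp (((1 - u) *\<^sub>R s + u *\<^sub>R t) * X x)) \<le>
        expectation (\<lambda>x. (1 - u) * exp (s * X x) + u * exp (t * X x))"
      by (intro integral_mono integrable_exp_mult Bochner_Integration.integrable_add integrable_mult_right)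
    then show "expectation (\<lambda>x. exp (((1 - u) *\<^sub>R s + u *\<^sub>R t) * X x)) \<le>
        (1 - u) * expectation (\<lambda>x. exp (s * X x)) + u * expectation (\<lambda>x. exp (t * X x))"
      by (simp add: integrable_exp_mult)
  qed simp
qed simp

text \<open>The negative mean pushes the generating function below 1 just to the right of 0,
  positive values of X on a set of positive measure bring it back to 1 or above, and the
  intermediate value theorem applies. Strict convexity gives uniqueness.\<close>

lemma tilt_root_ex1:
  assumes neg: "expectation X < 0" and pos: "\<not> (AE x in M. X x \<le> 0)"
  shows "\<exists>!\<theta>. 0 < \<theta> \<and> expectation (\<lambda>x. exp (\<theta> * X x)) = 1"
proof -
  let ?m = "\<lambda>t. expectation (\<lambda>x. exp (t * X x))"
  have "0 < C"
  proof (rule ccontr)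
    assume "\<not> 0 < C"
    have "X x = 0" for x
      using X_le[of x] \<open>\<not> 0 < C\<close> by linarith
    then have "X = (\<lambda>_. 0)"
      by auto
    then show False
      using neg by simp
  qed
  \<comment> \<open>For |y| \<le> 1 one has exp y \<le> 1 + y + y^2, so the generating function at a
    is at most 1 + a(E X + a C^2) once a C \<le> 1. The second entry makes the bracket negative,
    with a factor 2 to spare.\<close>
  define a where "a = min (1 / C) (- expectation X / (2 * C\<^sup>2))"
  have a: "0 < a" "a * C \<le> 1" "a * C\<^sup>2 < - expectation X"
  proof -
    show "0 < a"
      using \<open>0 < C\<close> neg by (simp add: a_def divide_neg_pos)
    have "a \<le> 1 / C"
      by (simp add: a_def)
    then show "a * C \<le> 1"
      using \<open>0 < C\<close> by (simp add: field_simps)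
    have "a \<le> - expectation X / (2 * C\<^sup>2)"
      by (simp add: a_def)
    then have "a * C\<^sup>2 \<le> - expectation X / 2"
      using \<open>0 < C\<close> by (simp add: field_simps)
    then show "a * C\<^sup>2 < - expectation X"
      using neg by simp
  qed
  have "?m a < 1"
  proof -
    have "exp (a * X x) \<le> 1 + a * X x + a\<^sup>2 * C\<^sup>2" for x
    proof -
      let ?y = "a * X x"
      have y_le: "\<bar>?y\<bar> \<le> a * C"
        using a X_le by (simp add: abs_mult)
      then have "\<bar>?y\<bar> \<le> 1"
        using a by linarith
      have "\<bar>?y\<bar> ^ 3 \<le> \<bar>?y\<bar> ^ 2"
        using \<open>\<bar>?y\<bar> \<le> 1\<close> by (intro power_decreasing) auto
      moreover have "exp ?y - (1 + ?y + ?y\<^sup>2 / 2) \<le> \<bar>?y\<bar> ^ 3 / 2"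
        by (rule order.trans[OF abs_ge_self abs_exp_minus_taylor2_le[OF \<open>\<bar>?y\<bar> \<le> 1\<close>]])
      ultimately have "exp ?y \<le> 1 + ?y + ?y\<^sup>2"
        unfolding power2_abs by linarith
      moreover have "?y\<^sup>2 \<le> (a * C)\<^sup>2"
        using y_le by (metis abs_ge_zero power2_abs power_mono)
      ultimately show ?thesis
        by (simp add: power_mult_distrib)
    qed
    then have "?m a \<le> expectation (\<lambda>x. 1 + a * X x + a\<^sup>2 * C\<^sup>2)"
      by (intro integral_mono integrable_exp_mult) (simp add: integrable_bounded_variable)
    also have "\<dots> = 1 + a * expectation X + a\<^sup>2 * C\<^sup>2"
      using prob_space by (simp add: integrable_bounded_variable)
    also have "\<dots> = 1 + a * (expectation X + a * C\<^sup>2)"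
      by (simp add: algebra_simps power2_eq_square)
    also have "\<dots> < 1"
      using a by (simp add: mult_pos_neg)
    finally show ?thesis .
  qed
  \<comment> \<open>The mean of the positive part fixes the upper point 1/c: exp(X/c) dominates max
    0 X / c, whose mean is 1.\<close>
  define c where "c = expectation (\<lambda>x. max 0 (X x))"
  have int_max: "integrable M (\<lambda>x. max 0 (X x))"
    by (rule integrable_const_bound[of _ C]) (use X_le \<open>0 < C\<close> in \<open>auto simp: abs_le_iff\<close>)
  have "0 < c"
  proof (rule ccontr)
    assume "\<not> 0 < c"
    then have "c = 0"
      unfolding c_def by (intro antisym Bochner_Integration.integral_nonneg) auto
    then have "AE x in M. max 0 (X x) = 0"
      using int_max unfolding c_def by (subst (asm) integral_nonneg_eq_0_iff_AE) auto
    then have "AE x in M. X x \<le> 0"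
      by eventually_elim auto
    with pos show False ..
  qed
  have "1 \<le> ?m (1 / c)"
  proof -
    have "1 / c * max 0 (X x) \<le> exp (1 / c * X x)" for x
    proof (cases "0 \<le> X x")
      case True
      then show ?thesis
        using order.trans[OF _ exp_ge_add_one_self[of "X x / c"], of "X x / c"] by simp
    qed simp
    then have "expectation (\<lambda>x. 1 / c * max 0 (X x)) \<le> ?m (1 / c)"
      by (intro integral_mono integrable_exp_mult integrable_mult_right int_max)
    then show ?thesis
      using \<open>0 < c\<close> by (simp add: c_def)
  qed
  have "\<exists>\<theta>. 0 < \<theta> \<and> ?m \<theta> = 1"
  proof (cases "a \<le> 1 / c")
    case True
    then obtain \<theta> where \<theta>: "a \<le> \<theta>" "?m \<theta> = 1"
      using IVT'[of ?m a 1 "1 / c"] \<open>?m a < 1\<close> \<open>1 \<le> ?m (1 / c)\<close> continuous_on_subset[OF continuous_mgf]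
      by auto
    then have "0 < \<theta>"
      using a(1) by linarith
    with \<theta> show ?thesis
      by blast
  next
    \<comment> \<open>This order of the two points is contradictory: 1/c < a would give a value
      below 1 at 1/c by strict convexity.\<close>
    case False
    then show ?thesis
      using mgf_less_one[of "1 / c" a] \<open>?m a < 1\<close> \<open>1 \<le> ?m (1 / c)\<close> \<open>0 < c\<close> neg by force
  qed
  moreover have "\<theta> = \<theta>'" if "0 < \<theta>" "?m \<theta> = 1" "0 < \<theta>'" "?m \<theta>' = 1" for \<theta> \<theta>'
    using mgf_less_one[of \<theta> \<theta>'] mgf_less_one[of \<theta>' \<theta>] that neg by (cases \<theta> \<theta>' rule: linorder_cases) auto
  ultimately show ?thesis
    by blast
qed

end

end

section \<open>Integration against a density\<close>

lemma integral_law: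
  assumes "prob_density f" "h \<in> borel_measurable borel"
  shows "(\<integral>x. h x \<partial>law f) = (\<integral>x. f x * h x \<partial>lborel :: real)"
  using assms by (simp add: law_def prob_density_def integral_density)

lemma integrable_law_iff:
  assumes "prob_density f" "h \<in> borel_measurable borel"
  shows "integrable (law f) h \<longleftrightarrow> integrable lborel (\<lambda>x. f x * h x :: real)"
  using assms by (simp add: law_def prob_density_def integrable_density)

lemma AE_law_iff:
  assumes "prob_density f"
  shows "(AE x in law f. P x) \<longleftrightarrow> (AE x in lborel. f x \<noteq> 0 \<longrightarrow> P x)"
proof -
  have pos: "0 < f x \<longleftrightarrow> f x \<noteq> 0" for x
    using assms by (auto simp: prob_density_def less_le)
  have "(AE x in law f. P x) \<longleftrightarrow> (AE x in lborel. 0 < ennreal (f x) \<longrightarrow> P x)"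
    unfolding law_def using assms by (intro AE_density) (simp add: prob_density_def)
  then show ?thesis
    by (simp add: pos)
qed

lemma AE_law_absolutely_continuous:
  assumes "prob_density f0" "prob_density f1" "\<And>x. f0 x = 0 \<Longrightarrow> f1 x = 0" "AE x in law f0. P x"
  shows "AE x in law f1. P x"
  using assms(4) unfolding AE_law_iff[OF assms(1)] AE_law_iff[OF assms(2)]
  by eventually_elim (use assms(3) in blast)

lemma integrable_law_bounded:
  fixes h :: "real \<Rightarrow> real"
  assumes "prob_density f" "h \<in> borel_measurable borel" "\<And>x. \<bar>h x\<bar> \<le> c"
  shows "integrable (law f) h"
proof -
  interpret prob_space "law f"
    using assms by (simp add: prob_density_def)
  show ?thesis
    by (rule integrable_const_bound[of _ c]) (use assms in auto)
qed

lemma integrable_density_mult: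
  assumes "prob_density f" "h \<in> borel_measurable borel" "\<And>x. \<bar>h x\<bar> \<le> c"
  shows "integrable lborel (\<lambda>x. f x * h x)"
  using integrable_law_bounded[OF assms] assms by (simp add: integrable_law_iff)

lemma prob_density_integral:
  assumes "prob_density f"
  shows "integrable lborel f" "(\<integral>x. f x \<partial>lborel) = 1"
proof -
  interpret prob_space "law f"
    using assms by (simp add: prob_density_def)
  show "integrable lborel f"
    using integrable_density_mult[OF assms, of "\<lambda>_. 1" 1] by simp
  show "(\<integral>x. f x \<partial>lborel) = 1"
    using integral_law[OF assms, of "\<lambda>_. 1"] prob_space by simp
qed

section \<open>Exponential tilting\<close>

context
  fixes f0 :: "real \<Rightarrow> real" and L :: "real \<Rightarrow> real" and c :: real
  assumes f0: "prob_density f0" and L: "L \<in> borel_measurable borel" "\<And>x. \<bar>L x\<bar> \<le> c"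
    and tilt: "(\<integral>x. exp (L x) \<partial>law f0) = 1"
begin

lemma law_tilted: "law (\<lambda>x. exp (L x) * f0 x) = density (law f0) (\<lambda>x. ennreal (exp (L x)))"
  using f0 L unfolding law_def
  by (subst density_density_eq) (auto simp: prob_density_def ennreal_mult mult.commute intro!: density_cong)

lemma prob_density_tilted: "prob_density (\<lambda>x. exp (L x) * f0 x)"
proof -
  note L(1) [measurable]
  have [measurable]: "f0 \<in> borel_measurable borel"
    using f0 by (simp add: prob_density_def)
  have "integrable (law f0) (\<lambda>x. exp (L x))"
    using L by (intro integrable_law_bounded[OF f0, where c = "exp c"]) (auto simp: abs_le_iff)
  then have "(\<integral>\<^sup>+x. ennreal (exp (L x)) \<partial>law f0) = 1"
    by (subst nn_integral_eq_integral) (auto simp: tilt)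
  moreover have "emeasure (density (law f0) (\<lambda>x. ennreal (exp (L x)))) UNIV = (\<integral>\<^sup>+x. ennreal (exp (L x)) \<partial>law f0)"
    by (subst emeasure_density) auto
  ultimately have "prob_space (law (\<lambda>x. exp (L x) * f0 x))"
    unfolding law_tilted by (intro prob_spaceI) simp
  then show ?thesis
    using f0 by (simp add: prob_density_def)
qed

text \<open>The difference of the two sides is the integral of \<open>H\<close>, which pointwise is
  f_1 (r - 1 - ln r), where r is the tilted density divided by f_1. It is nonnegative, and it
  vanishes exactly where f_1 equals the tilted density.\<close>

lemma gibbs:
  assumes f1: "prob_density f1" and ac: "\<And>x. f0 x = 0 \<Longrightarrow> f1 x = 0" and fin: "D_KL_finite f1 f0"
  shows "(\<integral>x. L x \<partial>law f1) \<le> D_KL f1 f0"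
    and "(\<integral>x. L x \<partial>law f1) = D_KL f1 f0 \<longleftrightarrow> (AE x in law f0. ereal (L x) = log_lr f1 f0 x)"
proof -
  note L(1) [measurable]
  \<comment> \<open>The last two terms integrate to -1 and 1 and cancel; they are added to make the
    integrand nonnegative at every point, and not only in the mean.\<close>
  define H where "H x = f1 x * ln (f1 x / f0 x) - f1 x * L x - f1 x + exp (L x) * f0 x" for x
  have nonneg: "0 \<le> f0 x" "0 \<le> f1 x" for x
    using f0 f1 by (auto simp: prob_density_def)
  have H: "0 \<le> H x" "H x = 0 \<longleftrightarrow> f1 x = exp (L x) * f0 x" for x
  proof -
    consider "f1 x = 0" | "0 < f1 x" "0 < f0 x"
      using nonneg[of x] ac[of x] by (auto simp: less_le)
    then have "0 \<le> H x \<and> (H x = 0 \<longleftrightarrow> f1 x = exp (L x) * f0 x)"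
    proof cases
      case 1
      then show ?thesis
        using nonneg[of x] by (simp add: H_def)
    next
      case 2
      define r where "r = exp (L x) * f0 x / f1 x"
      have "0 < r"
        using 2 by (simp add: r_def)
      have L_eq: "L x = ln r + ln (f1 x / f0 x)"
        using 2 by (simp add: r_def ln_div ln_mult)
      have "exp (L x) * f0 x = f1 x * r"
        using 2 by (simp add: r_def)
      then have "H x = f1 x * ln (f1 x / f0 x) - f1 x * L x - f1 x + f1 x * r"
        by (simp only: H_def)
      also have "\<dots> = f1 x * (r - 1 - ln r)"
        unfolding L_eq by (simp only: algebra_simps)
      finally have eq: "H x = f1 x * (r - 1 - ln r)" .
      have "0 \<le> H x"
        using ln_le_minus_one[OF \<open>0 < r\<close>] 2 by (simp add: eq)
      moreover have "H x = 0 \<longleftrightarrow> r = 1"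
        using ln_eq_minus_one[OF \<open>0 < r\<close>] 2 by (auto simp: eq)
      moreover have "r = 1 \<longleftrightarrow> f1 x = exp (L x) * f0 x"
        using 2 by (auto simp: r_def field_simps)
      ultimately show ?thesis
        by simp
    qed
    then show "0 \<le> H x" "H x = 0 \<longleftrightarrow> f1 x = exp (L x) * f0 x"
      by auto
  qed
  have int: "integrable lborel (\<lambda>x. f1 x * ln (f1 x / f0 x))" "integrable lborel (\<lambda>x. f1 x * L x)"
    "integrable lborel f1" "integrable lborel (\<lambda>x. exp (L x) * f0 x)"
    using fin integrable_density_mult[OF f1 L] prob_density_integral[OF f1]
      prob_density_integral[OF prob_density_tilted] by (auto simp: D_KL_finite_def)
  have intH: "integrable lborel H"
    unfolding H_def[abs_def] using int by auto
  have "(\<integral>x. H x \<partial>lborel) = D_KL f1 f0 - (\<integral>x. f1 x * L x \<partial>lborel) - (\<integral>x. f1 x \<partial>lborel) + (\<integral>x. exp (L x) * f0 x \<partial>lborel)"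
    unfolding H_def[abs_def] D_KL_def using int by simp
  also have "\<dots> = D_KL f1 f0 - (\<integral>x. L x \<partial>law f1)"
    using prob_density_integral(2)[OF f1] prob_density_integral(2)[OF prob_density_tilted]
    by (simp add: integral_law[OF f1 L(1)])
  finally have eq: "(\<integral>x. H x \<partial>lborel) = D_KL f1 f0 - (\<integral>x. L x \<partial>law f1)" .
  have "0 \<le> (\<integral>x. H x \<partial>lborel)"
    using H(1) by (intro Bochner_Integration.integral_nonneg) auto
  then show "(\<integral>x. L x \<partial>law f1) \<le> D_KL f1 f0"
    by (simp add: eq)
  have "(\<integral>x. L x \<partial>law f1) = D_KL f1 f0 \<longleftrightarrow> (\<integral>x. H x \<partial>lborel) = 0"
    by (auto simp: eq)
  also have "\<dots> \<longleftrightarrow> (AE x in lborel. H x = 0)"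
    using intH H(1) by (intro integral_nonneg_eq_0_iff_AE) auto
  also have "\<dots> \<longleftrightarrow> (AE x in lborel. f0 x \<noteq> 0 \<longrightarrow> ereal (L x) = log_lr f1 f0 x)"
  proof (rule AE_cong)
    fix x
    show "H x = 0 \<longleftrightarrow> (f0 x \<noteq> 0 \<longrightarrow> ereal (L x) = log_lr f1 f0 x)"
    \<comment> \<open>Where f_1 vanishes but f_0 does not, \<open>H\<close> is positive;
      correspondingly the finite \<open>L x\<close> differs from the value -\<infinity> of
      \<open>log_lr\<close>.\<close>
    proof (cases "f0 x = 0 \<or> f1 x = 0")
      case True
      then show ?thesis
        using ac[of x] by (auto simp: H(2) log_lr_def)
    next
      case False
      then have "0 < f0 x" "0 < f1 x"
        using nonneg[of x] by auto
      then have "f1 x = exp (L x) * f0 x \<longleftrightarrow> exp (ln (f1 x / f0 x)) = exp (L x)"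
        by (auto simp: field_simps)
      then show ?thesis
        using False by (auto simp: H(2) log_lr_def)
    qed
  qed
  also have "\<dots> \<longleftrightarrow> (AE x in law f0. ereal (L x) = log_lr f1 f0 x)"
    by (simp add: AE_law_iff[OF f0])
  finally show "(\<integral>x. L x \<partial>law f1) = D_KL f1 f0 \<longleftrightarrow> (AE x in law f0. ereal (L x) = log_lr f1 f0 x)" .
qed

end

section \<open>Second-order statistics of the dictionary\<close>

lemma positive_definite_imp_invertible:
  fixes A :: "real ^ 's ^ 's"
  assumes "positive_definite A"
  shows "invertible A"
proof -
  have "x = 0" if "A *v x = 0" for x
    using assms that unfolding positive_definite_def by (metis inner_zero_right less_irrefl)
  then show ?thesis
    unfolding invertible_left_inverse matrix_left_invertible_ker by blast
qed

lemma matrix_inv_mult_vector: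
  fixes A :: "real ^ 's ^ 's"
  assumes "invertible A"
  shows "A *v (matrix_inv A *v v) = v" "matrix_inv A *v (A *v v) = v"
proof -
  have "A ** matrix_inv A = mat 1 \<and> matrix_inv A ** A = mat 1"
    using assms unfolding invertible_def matrix_inv_def by (rule someI_ex)
  then show "A *v (matrix_inv A *v v) = v" "matrix_inv A *v (A *v v) = v"
    by (simp_all add: matrix_vector_mul_assoc)
qed

lemma measurable_vec_nth:
  fixes \<phi> :: "real \<Rightarrow> real ^ 's"
  assumes "\<phi> \<in> borel_measurable M"
  shows "(\<lambda>x. \<phi> x $ i) \<in> borel_measurable M"
proof -
  have "(\<lambda>v. v $ i) \<in> borel_measurable (borel :: (real ^ 's) measure)"
    by (intro borel_measurable_continuous_onI continuous_intros)
  then show ?thesis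
    by (rule measurable_compose[OF assms])
qed

lemma norm_le_card_mult:
  fixes v :: "real ^ 's"
  assumes "\<And>i. \<bar>v $ i\<bar> \<le> b"
  shows "norm v \<le> real CARD('s) * b"
  using norm_le_l1_cart[of v] sum_mono[of UNIV "\<lambda>i. \<bar>v $ i\<bar>" "\<lambda>_. b"] assms by simp

context
  fixes \<phi> :: "real \<Rightarrow> real ^ 's" and b :: real
  assumes \<phi>: "\<phi> \<in> borel_measurable borel" and bound: "\<And>i x. \<bar>\<phi> x $ i\<bar> \<le> b"
begin

lemma abs_mean_le:
  assumes "prob_density f"
  shows "\<bar>mean \<phi> f $ i\<bar> \<le> b"
proof -
  interpret prob_space "law f"
    using assms by (simp add: prob_density_def)
  have int: "integrable (law f) (\<lambda>x. \<phi> x $ i)"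
    by (rule integrable_law_bounded[OF assms measurable_vec_nth[OF \<phi>] bound])
  have "expectation (\<lambda>x. \<phi> x $ i) \<le> b" "- b \<le> expectation (\<lambda>x. \<phi> x $ i)"
    using int bound by (auto intro!: integral_le_const integral_ge_const simp: abs_le_iff minus_le_iff)
  then show ?thesis
    by (simp add: mean_def abs_le_iff)
qed

lemma expectation_inner:
  assumes "prob_density f"
  shows "(\<integral>x. v \<bullet> \<phi> x \<partial>law f) = v \<bullet> mean \<phi> f"
  using integrable_law_bounded[OF assms measurable_vec_nth[OF \<phi>] bound]
  by (simp add: inner_vec_def mean_def)

lemma inner_Cov:
  assumes "prob_density f"
  shows "v \<bullet> (Cov \<phi> f *v w) = (\<integral>x. (v \<bullet> (\<phi> x - mean \<phi> f)) * (w \<bullet> (\<phi> x - mean \<phi> f)) \<partial>law f)"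
proof -
  let ?\<psi> = "\<lambda>x i. \<phi> x $ i - mean \<phi> f $ i"
  have \<psi>_le: "\<bar>?\<psi> x i\<bar> \<le> 2 * b" for x i
    using bound[of x i] abs_mean_le[OF assms, of i] by linarith
  have "\<bar>?\<psi> x i * ?\<psi> x j\<bar> \<le> 2 * b * (2 * b)" for x i j
    unfolding abs_mult using \<psi>_le[of x i] \<psi>_le[of x j] by (intro mult_mono) auto
  then have int: "integrable (law f) (\<lambda>x. ?\<psi> x i * ?\<psi> x j)" for i j
    by (rule integrable_law_bounded[OF assms, rotated])
      (intro borel_measurable_times borel_measurable_diff measurable_vec_nth[OF \<phi>] borel_measurable_const)
  have "v \<bullet> (Cov \<phi> f *v w) = (\<Sum>i\<in>UNIV. \<Sum>j\<in>UNIV. v $ i * w $ j * (\<integral>x. ?\<psi> x i * ?\<psi> x j \<partial>law f))"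
    by (simp add: inner_vec_def matrix_vector_mult_def Cov_def sum_distrib_left ac_simps)
  also have "\<dots> = (\<integral>x. (\<Sum>i\<in>UNIV. \<Sum>j\<in>UNIV. v $ i * w $ j * (?\<psi> x i * ?\<psi> x j)) \<partial>law f)"
    using int by simp
  also have "\<dots> = (\<integral>x. (v \<bullet> (\<phi> x - mean \<phi> f)) * (w \<bullet> (\<phi> x - mean \<phi> f)) \<partial>law f)"
    by (simp add: inner_vec_def sum_product ac_simps)
  finally show ?thesis .
qed

lemma Cov_nonneg:
  assumes "prob_density f"
  shows "0 \<le> v \<bullet> (Cov \<phi> f *v v)"
  unfolding inner_Cov[OF assms] by (intro Bochner_Integration.integral_nonneg) simp

lemma measurable_Lam: "Lam \<phi> f0 f1 \<in> borel_measurable borel"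
  unfolding Lam_def[abs_def] using \<phi> by measurable

lemma measurable_Lam_law: "Lam \<phi> f0 f1 \<in> borel_measurable (law f)"
  using measurable_Lam measurable_cong_sets[OF sets_law refl] by blast

text \<open>Crude in the dimension, but proportional to the norm of K: in the local limit K tends to
  0, and \<Lambda> then tends to 0 uniformly in x.\<close>

lemma abs_Lam_le:
  assumes "prob_density f0" "prob_density f1"
  shows "\<bar>Lam \<phi> f0 f1 x\<bar> \<le> norm (K_vec \<phi> f0 f1) * (real CARD('s) * (2 * b))"
proof -
  have "\<bar>(\<phi> x - (1/2) *\<^sub>R (mean \<phi> f0 + mean \<phi> f1)) $ i\<bar> \<le> 2 * b" for i
  proof -
    have "\<bar>mean \<phi> f0 $ i + mean \<phi> f1 $ i\<bar> \<le> 2 * b"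
      using abs_mean_le[OF assms(1), of i] abs_mean_le[OF assms(2), of i] by linarith
    then have "\<bar>1/2 * (mean \<phi> f0 $ i + mean \<phi> f1 $ i)\<bar> \<le> b"
      unfolding abs_mult by simp
    then show ?thesis
      unfolding vector_minus_component vector_scaleR_component vector_add_component real_scaleR_def
      using bound[of x i] abs_triangle_ineq4[of "\<phi> x $ i" "1/2 * (mean \<phi> f0 $ i + mean \<phi> f1 $ i)"] by linarith
  qed
  then have "norm (\<phi> x - (1/2) *\<^sub>R (mean \<phi> f0 + mean \<phi> f1)) \<le> real CARD('s) * (2 * b)"
    by (rule norm_le_card_mult)
  then show ?thesis
    unfolding Lam_def by (intro order.trans[OF Cauchy_Schwarz_ineq2] mult_left_mono) auto
qed

context
  fixes f0 f1 :: "real \<Rightarrow> real"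
  assumes f0: "prob_density f0" and f1: "prob_density f1" and moment: "moment_assumption \<phi> f0 f1"
begin

lemma positive_definite_F: "positive_definite (F_mat \<phi> f0 f1)"
proof -
  have "0 < v \<bullet> (Cov \<phi> f0 *v v) + v \<bullet> (Cov \<phi> f1 *v v)" if "v \<noteq> 0" for v
    using moment that Cov_nonneg[OF f1, of v]
    by (auto simp: moment_assumption_def positive_definite_def intro: add_pos_nonneg)
  then show ?thesis
    by (simp add: positive_definite_def F_mat_def matrix_vector_mult_add_rdistrib inner_add_right)
qed

lemma F_mult_K: "F_mat \<phi> f0 f1 *v K_vec \<phi> f0 f1 = Y_vec \<phi> f0 f1"
  unfolding K_vec_def
  by (rule matrix_inv_mult_vector(1)[OF positive_definite_imp_invertible[OF positive_definite_F]])

lemma J_eq_K_inner_Y: "J_val \<phi> f0 f1 = K_vec \<phi> f0 f1 \<bullet> Y_vec \<phi> f0 f1"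
  by (simp add: J_val_def K_vec_def inner_commute)

text \<open>Because Y = F K, the value J is the sum of the variances of \<Lambda> under f_0 and f_1.
  For close densities this makes it about twice the variance under f_0.\<close>

lemma J_eq_quadratic:
  "J_val \<phi> f0 f1 = K_vec \<phi> f0 f1 \<bullet> (Cov \<phi> f0 *v K_vec \<phi> f0 f1) + K_vec \<phi> f0 f1 \<bullet> (Cov \<phi> f1 *v K_vec \<phi> f0 f1)"
  unfolding J_eq_K_inner_Y F_mult_K[symmetric] F_mat_def
  by (simp add: matrix_vector_mult_add_rdistrib inner_add_right)

lemma J_pos:
  assumes "Y_vec \<phi> f0 f1 \<noteq> 0"
  shows "0 < J_val \<phi> f0 f1"
proof -
  have "K_vec \<phi> f0 f1 \<noteq> 0"
    using F_mult_K assms by auto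
  then show ?thesis
    using positive_definite_F unfolding J_eq_K_inner_Y F_mult_K[symmetric] positive_definite_def by blast
qed

text \<open>Centring at the midpoint of the two means pairs K with -Y/2 under f_0 and with Y/2 under
  f_1.\<close>

lemma expectation_Lam:
  "(\<integral>x. Lam \<phi> f0 f1 x \<partial>law f0) = - (1/2 * J_val \<phi> f0 f1)" "(\<integral>x. Lam \<phi> f0 f1 x \<partial>law f1) = 1/2 * J_val \<phi> f0 f1"
proof -
  let ?K = "K_vec \<phi> f0 f1" and ?m = "(1/2) *\<^sub>R (mean \<phi> f0 + mean \<phi> f1)"
  have *: "(\<integral>x. Lam \<phi> f0 f1 x \<partial>law f) = ?K \<bullet> (mean \<phi> f - ?m)" if "prob_density f" for f
  proof -
    interpret prob_space "law f"
      using that by (simp add: prob_density_def)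
    have "integrable (law f) (\<lambda>x. ?K \<bullet> \<phi> x)"
      unfolding inner_vec_def
      using integrable_law_bounded[OF that measurable_vec_nth[OF \<phi>] bound] by simp
    then have "(\<integral>x. ?K \<bullet> \<phi> x - ?K \<bullet> ?m \<partial>law f) = ?K \<bullet> mean \<phi> f - ?K \<bullet> ?m"
      using prob_space by (simp add: expectation_inner[OF that])
    then show ?thesis
      by (simp only: Lam_def inner_diff_right)
  qed
  have "mean \<phi> f0 - ?m = - ((1/2) *\<^sub>R Y_vec \<phi> f0 f1)" "mean \<phi> f1 - ?m = (1/2) *\<^sub>R Y_vec \<phi> f0 f1"
    by (simp_all add: Y_vec_def vec_eq_iff field_simps)
  then show "(\<integral>x. Lam \<phi> f0 f1 x \<partial>law f0) = - (1/2 * J_val \<phi> f0 f1)" "(\<integral>x. Lam \<phi> f0 f1 x \<partial>law f1) = 1/2 * J_val \<phi> f0 f1"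
    unfolding *[OF f0] *[OF f1] J_eq_K_inner_Y by simp_all
qed

context
  assumes Y: "Y_vec \<phi> f0 f1 \<noteq> 0"
begin

text \<open>If \<Lambda> were nonpositive almost surely under f_0, it would be so under f_1 by
  absolute continuity, against its positive mean J/2 there.\<close>

lemma theta0_ex1: "\<exists>!\<theta>. 0 < \<theta> \<and> (\<integral>x. exp (\<theta> * Lam \<phi> f0 f1 x) \<partial>law f0) = 1"
proof -
  interpret prob_space "law f0"
    using f0 by (simp add: prob_density_def)
  show ?thesis
  proof (rule tilt_root_ex1[OF _ abs_Lam_le[OF f0 f1]])
    show "expectation (Lam \<phi> f0 f1) < 0"
      using expectation_Lam J_pos[OF Y] by simp
    show "\<not> (AE x in law f0. Lam \<phi> f0 f1 x \<le> 0)"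
    proof
      assume "AE x in law f0. Lam \<phi> f0 f1 x \<le> 0"
      then have "AE x in law f1. Lam \<phi> f0 f1 x \<le> 0"
        using moment by (intro AE_law_absolutely_continuous[OF f0 f1]) (auto simp: moment_assumption_def)
      then have "0 \<le> (\<integral>x. - Lam \<phi> f0 f1 x \<partial>law f1)"
        by (intro integral_nonneg_AE) simp
      then show False
        using expectation_Lam J_pos[OF Y] by simp
    qed
  qed (rule measurable_Lam_law)
qed

lemma theta0_pos: "0 < theta0 \<phi> f0 f1"
  and theta0_root: "(\<integral>x. exp (theta0 \<phi> f0 f1 * Lam \<phi> f0 f1 x) \<partial>law f0) = 1"
  using theI'[OF theta0_ex1] by (auto simp: theta0_def)

text \<open>A root at or before t would force the value at t to be at least 1. This lemma and its
  converse companion \<open>theta0_less\<close> locate \<open>theta0\<close> by the sign of the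
  generating function minus 1 at a single argument.\<close>

lemma less_theta0:
  assumes "0 < t" "(\<integral>x. exp (t * Lam \<phi> f0 f1 x) \<partial>law f0) < 1"
  shows "t < theta0 \<phi> f0 f1"
proof -
  interpret prob_space "law f0"
    using f0 by (simp add: prob_density_def)
  have "expectation (Lam \<phi> f0 f1) < 0"
    using expectation_Lam J_pos[OF Y] by simp
  then show ?thesis
    using mgf_less_one[OF measurable_Lam_law abs_Lam_le[OF f0 f1], where s = "theta0 \<phi> f0 f1" and t = t] theta0_pos theta0_root assms
    by (cases "theta0 \<phi> f0 f1" t rule: linorder_cases) auto
qed

lemma theta0_less:
  assumes "0 < t" "1 < (\<integral>x. exp (t * Lam \<phi> f0 f1 x) \<partial>law f0)"
  shows "theta0 \<phi> f0 f1 < t"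
proof -
  interpret prob_space "law f0"
    using f0 by (simp add: prob_density_def)
  have "expectation (Lam \<phi> f0 f1) < 0"
    using expectation_Lam J_pos[OF Y] by simp
  then show ?thesis
    using mgf_less_one[OF measurable_Lam_law abs_Lam_le[OF f0 f1], where s = t and t = "theta0 \<phi> f0 f1"] theta0_pos theta0_root assms
    by (cases "theta0 \<phi> f0 f1" t rule: linorder_cases) auto
qed

end

end

end

section \<open>Local families\<close>

text \<open>Boundedness of \<open>x\<close> is enough, with no convergence: it will be applied to
  the unit vector in the direction of K, which may have no limit.\<close>

lemma matrix_mult_vector_small:
  fixes A :: "'b \<Rightarrow> real ^ 's ^ 's" and x :: "'b \<Rightarrow> real ^ 's"
  assumes A: "\<And>i j. ((\<lambda>t. A t $ i $ j) \<longlongrightarrow> 0) F" and x: "\<forall>\<^sub>F t in F. norm (x t) \<le> c"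
  shows "((\<lambda>t. A t *v x t) \<longlongrightarrow> 0) F"
proof (rule Lim_null_comparison)
  have "((\<lambda>t. \<Sum>i\<in>UNIV. \<Sum>j\<in>UNIV. \<bar>A t $ i $ j\<bar>) \<longlongrightarrow> (\<Sum>i\<in>(UNIV :: 's set). \<Sum>j\<in>(UNIV :: 's set). \<bar>0\<bar>)) F"
    by (intro tendsto_sum tendsto_rabs A)
  then show "((\<lambda>t. (\<Sum>i\<in>UNIV. \<Sum>j\<in>UNIV. \<bar>A t $ i $ j\<bar>) * c) \<longlongrightarrow> 0) F"
    by (simp add: tendsto_mult_left_zero)
  show "\<forall>\<^sub>F t in F. norm (A t *v x t) \<le> (\<Sum>i\<in>UNIV. \<Sum>j\<in>UNIV. \<bar>A t $ i $ j\<bar>) * c"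
    using x
  proof eventually_elim
    case (elim t)
    have "norm (A t *v x t) \<le> onorm ((*v) (A t)) * norm (x t)"
      by (intro onorm matrix_vector_mul_bounded_linear)
    also have "\<dots> \<le> (\<Sum>i\<in>UNIV. \<Sum>j\<in>UNIV. \<bar>A t $ i $ j\<bar>) * c"
      using elim by (intro mult_mono onorm_le_matrix_component_sum sum_nonneg) auto
    finally show ?case .
  qed
qed

text \<open>The quadratic form attains its minimum on the compact unit sphere; this positive minimum
  is a, and homogeneity does the rest.\<close>

lemma positive_definite_coercive:
  fixes A :: "real ^ 's ^ 's"
  assumes "positive_definite A"
  obtains a where "0 < a" "\<And>v. a * (norm v)\<^sup>2 \<le> v \<bullet> (A *v v)"
proof -
  obtain u :: "real ^ 's" where "norm u = 1"
    using vector_choose_size[of 1] by auto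
  then have "sphere (0 :: real ^ 's) 1 \<noteq> {}"
    by auto
  moreover have "continuous_on (sphere 0 1) (\<lambda>v. v \<bullet> (A *v v))"
    by (intro continuous_intros linear_continuous_on matrix_vector_mul_bounded_linear)
  ultimately obtain w where w: "norm w = 1" "\<And>v. norm v = 1 \<Longrightarrow> w \<bullet> (A *v w) \<le> v \<bullet> (A *v v)"
    using continuous_attains_inf[OF compact_sphere, of 0 1 "\<lambda>v. v \<bullet> (A *v v)"] by auto
  show ?thesis
  proof (rule that)
    have "w \<noteq> 0"
      using w(1) by auto
    then show "0 < w \<bullet> (A *v w)"
      using assms by (simp add: positive_definite_def)
    show "w \<bullet> (A *v w) * (norm v)\<^sup>2 \<le> v \<bullet> (A *v v)" for v
    proof (cases "v = 0")
      case False
      let ?u = "(1 / norm v) *\<^sub>R v"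
      have "w \<bullet> (A *v w) \<le> ?u \<bullet> (A *v ?u)"
        using False by (intro w(2)) simp
      also have "\<dots> = (v \<bullet> (A *v v)) / (norm v)\<^sup>2"
        by (simp add: matrix_vector_mult_scaleR power2_eq_square)
      finally show ?thesis
        using False by (simp add: field_simps)
    qed simp
  qed
qed

section \<open>Derivatives of expectations in quadratic mean\<close>

lemma integrable_bounded_mult_L2:
  assumes f: "prob_density f" and q: "q \<in> borel_measurable borel" "integrable (law f) (\<lambda>x. (q x)\<^sup>2)"
    and h: "h \<in> borel_measurable borel" "\<And>x. \<bar>h x\<bar> \<le> c"
  shows "integrable (law f) (\<lambda>x. h x * q x :: real)"
proof -
  interpret prob_space "law f"
    using f by (simp add: prob_density_def)
  note q(1) [measurable] h(1) [measurable]
  have "0 \<le> c"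
    using h(2)[of 0] by linarith
  have "integrable (law f) (\<lambda>x. c * (1 + (q x)\<^sup>2))"
    using q by simp
  then show ?thesis
  proof (rule Bochner_Integration.integrable_bound)
    have "\<bar>q x\<bar> \<le> 1 + (q x)\<^sup>2" for x
      using sum_squares_ge_zero[of "\<bar>q x\<bar> - 1" 0] by (simp add: power2_eq_square algebra_simps)
    then have "\<bar>h x\<bar> * \<bar>q x\<bar> \<le> c * (1 + (q x)\<^sup>2)" for x
      using h(2) \<open>0 \<le> c\<close> by (intro mult_mono) auto
    then show "AE x in law f. norm (h x * q x) \<le> norm (c * (1 + (q x)\<^sup>2))"
      using \<open>0 \<le> c\<close> by (simp add: abs_mult)
  qed simp
qed

text \<open>With \<open>s = \<surd>g\<^sub>\<theta>\<close>, \<open>s\<^sub>0 = \<surd>f\<^sub>0\<close> and the remainder \<open>r = s - s\<^sub>0 - \<theta> q s\<^sub>0 / 2\<close>, one has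
  \<open>g\<^sub>\<theta> - f\<^sub>0 - \<theta> q f\<^sub>0 = 2 s\<^sub>0 r + (s - s\<^sub>0)\<^sup>2\<close>. The weight \<open>w\<close> is free; it is chosen below
  slightly larger than the \<open>L\<^sup>2\<close> norm of \<open>r\<close>.\<close>

lemma score_remainder_le:
  fixes s s0 \<theta> q w :: real
  defines "r \<equiv> s - s0 - 1/2 * \<theta> * q * s0"
  assumes "0 < w"
  shows "\<bar>s\<^sup>2 - s0\<^sup>2 - \<theta> * q * s0\<^sup>2\<bar> \<le> w * s0\<^sup>2 + r\<^sup>2 / w + \<theta>\<^sup>2 / 2 * (s0\<^sup>2 * q\<^sup>2) + 2 * r\<^sup>2"
proof -
  have eq: "s\<^sup>2 - s0\<^sup>2 - \<theta> * q * s0\<^sup>2 = 2 * s0 * r + (s - s0)\<^sup>2"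
    by (simp add: r_def power2_eq_square algebra_simps)
  have "0 \<le> (w * s0 - r)\<^sup>2 / w" "0 \<le> (w * s0 + r)\<^sup>2 / w"
    using assms by auto
  then have "\<bar>2 * s0 * r\<bar> \<le> w * s0\<^sup>2 + r\<^sup>2 / w"
    using assms by (intro abs_leI) (simp_all add: power2_eq_square field_simps)
  moreover have "(s - s0)\<^sup>2 \<le> \<theta>\<^sup>2 / 2 * (s0\<^sup>2 * q\<^sup>2) + 2 * r\<^sup>2"
  proof -
    have "s - s0 = 1/2 * \<theta> * q * s0 + r"
      by (simp add: r_def)
    moreover have "(a + r)\<^sup>2 \<le> 2 * a\<^sup>2 + 2 * r\<^sup>2" for a
      using zero_le_power2[of "a - r"] by (simp add: power2_eq_square algebra_simps)
    ultimately have "(s - s0)\<^sup>2 \<le> 2 * (1/2 * \<theta> * q * s0)\<^sup>2 + 2 * r\<^sup>2"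
      by simp
    also have "2 * (1/2 * \<theta> * q * s0)\<^sup>2 = \<theta>\<^sup>2 / 2 * (s0\<^sup>2 * q\<^sup>2)"
      by (simp add: power2_eq_square)
    finally show ?thesis .
  qed
  ultimately have "\<bar>2 * s0 * r\<bar> + \<bar>(s - s0)\<^sup>2\<bar> \<le> w * s0\<^sup>2 + r\<^sup>2 / w + (\<theta>\<^sup>2 / 2 * (s0\<^sup>2 * q\<^sup>2) + 2 * r\<^sup>2)"
    by (intro add_mono) auto
  then show ?thesis
    unfolding eq using abs_triangle_ineq[of "2 * s0 * r" "(s - s0)\<^sup>2"] by linarith
qed

text \<open>A bounded h only multiplies the pointwise remainder estimate by c, and integrating that
  estimate leaves w + N^2/w + \<theta>^2 I/2 + 2 N^2, where N is the norm of the remainder in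
  quadratic mean. All of this is o(\<theta>).\<close>

lemma score_expansion:
  fixes h :: "real \<Rightarrow> real"
  assumes fam: "local_family f0 g q" and f0: "prob_density f0"
    and h: "h \<in> borel_measurable borel" "\<And>x. \<bar>h x\<bar> \<le> c"
  shows "((\<lambda>\<theta>. ((\<integral>x. h x \<partial>law (g \<theta>)) - (\<integral>x. h x \<partial>law f0)) / \<theta>) \<longlongrightarrow> (\<integral>x. h x * q x \<partial>law f0)) (at_right 0)"
proof -
  define r where "r \<theta> x = sqrt (g \<theta> x) - sqrt (f0 x) - 1/2 * \<theta> * q x * sqrt (f0 x)" for \<theta> x
  define N where "N \<theta> = sqrt (\<integral>x. (r \<theta> x)\<^sup>2 \<partial>lborel)" for \<theta>
  \<comment> \<open>The summand \<theta>^2 keeps w positive where N vanishes; w \<ge> N gives N^2/w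
    \<le> w, and w is still o(\<theta>).\<close>
  define w where "w \<theta> = N \<theta> + \<theta>\<^sup>2" for \<theta>
  define I where "I = fisher_info f0 q"
  have g: "prob_density (g \<theta>)" if "0 < \<theta>" for \<theta>
    using fam that by (simp add: local_family_def)
  have q [measurable]: "q \<in> borel_measurable borel" and q2: "integrable (law f0) (\<lambda>x. (q x)\<^sup>2)"
    using fam by (auto simp: local_family_def)
  have [measurable]: "f0 \<in> borel_measurable borel"
    using f0 by (simp add: prob_density_def)
  note h(1) [measurable]
  have c: "0 \<le> c"
    using h(2)[of 0] by linarith
  have f0q2: "integrable lborel (\<lambda>x. f0 x * (q x)\<^sup>2)" "(\<integral>x. f0 x * (q x)\<^sup>2 \<partial>lborel) = I"
    using q2 unfolding I_def fisher_info_def by (simp_all add: integrable_law_iff[OF f0] integral_law[OF f0])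
  have hq: "integrable (law f0) (\<lambda>x. h x * q x)"
    by (rule integrable_bounded_mult_L2[OF f0 q q2 h])
  have "(\<lambda>\<theta>. N \<theta>) \<in> o[at_right 0](\<lambda>\<theta>. \<theta>)"
    using fam unfolding local_family_def N_def r_def by blast
  then have N_lim: "((\<lambda>\<theta>. N \<theta> / \<theta>) \<longlongrightarrow> 0) (at_right 0)"
    by (rule smalloD_tendsto)
  have bound: "\<bar>((\<integral>x. h x \<partial>law (g \<theta>)) - (\<integral>x. h x \<partial>law f0)) / \<theta> - (\<integral>x. h x * q x \<partial>law f0)\<bar> \<le>
      c * (2 * (N \<theta> / \<theta> + \<theta>) + \<theta> / 2 * I + 2 * (N \<theta> / \<theta>)\<^sup>2 * \<theta>)" if "0 < \<theta>" for \<theta>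
  proof -
    note g\<theta> = g[OF that]
    have [measurable]: "g \<theta> \<in> borel_measurable borel"
      using g\<theta> by (simp add: prob_density_def)
    have pos: "0 \<le> g \<theta> x" "0 \<le> f0 x" for x
      using g\<theta> f0 by (auto simp: prob_density_def)
    have N_nonneg: "0 \<le> N \<theta>"
      by (simp add: N_def)
    have w_pos: "0 < w \<theta>"
      using N_nonneg that by (simp add: w_def add_nonneg_pos)
    have int: "integrable lborel f0" "integrable lborel (g \<theta>)"
      using f0 g\<theta> by (auto intro: prob_density_integral)
    \<comment> \<open>Without this the integral inside \<open>N\<close> could be the default value 0
      of a non-integrable function, and \<open>N\<close> would say nothing about the
      remainder.\<close>
    have r2: "integrable lborel (\<lambda>x. (r \<theta> x)\<^sup>2)"
    proof (rule Bochner_Integration.integrable_bound)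
      show "integrable lborel (\<lambda>x. 3 * (g \<theta> x + f0 x + \<theta>\<^sup>2 / 4 * (f0 x * (q x)\<^sup>2)))"
        using int f0q2 by simp
      have "(r \<theta> x)\<^sup>2 \<le> 3 * (g \<theta> x + f0 x + \<theta>\<^sup>2 / 4 * (f0 x * (q x)\<^sup>2))" for x
      proof -
        have "(a - b - d)\<^sup>2 \<le> 3 * (a\<^sup>2 + b\<^sup>2 + d\<^sup>2)" for a b d :: real
          using sum_power2_ge_zero[of "a + b" "a + d"] zero_le_power2[of "b - d"]
          by (simp add: power2_eq_square algebra_simps)
        then have "(r \<theta> x)\<^sup>2 \<le> 3 * ((sqrt (g \<theta> x))\<^sup>2 + (sqrt (f0 x))\<^sup>2 + (1/2 * \<theta> * q x * sqrt (f0 x))\<^sup>2)"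
          unfolding r_def .
        also have "\<dots> = 3 * (g \<theta> x + f0 x + \<theta>\<^sup>2 / 4 * (f0 x * (q x)\<^sup>2))"
          using pos by (simp add: power_mult_distrib power_divide)
        finally show ?thesis .
      qed
      then show "AE x in lborel. norm ((r \<theta> x)\<^sup>2) \<le> norm (3 * (g \<theta> x + f0 x + \<theta>\<^sup>2 / 4 * (f0 x * (q x)\<^sup>2)))"
        using pos by (intro AE_I2) (simp add: abs_of_nonneg)
      show "(\<lambda>x. (r \<theta> x)\<^sup>2) \<in> borel_measurable lborel"
        unfolding r_def by measurable
    qed
    have N2: "(\<integral>x. (r \<theta> x)\<^sup>2 \<partial>lborel) = (N \<theta>)\<^sup>2"
      unfolding N_def by (subst real_sqrt_pow2) (auto intro: Bochner_Integration.integral_nonneg)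
    let ?\<Delta> = "\<lambda>x. g \<theta> x * h x - f0 x * h x - \<theta> * (f0 x * (h x * q x))"
    let ?E = "\<lambda>x. c * (w \<theta> * f0 x + (r \<theta> x)\<^sup>2 / w \<theta> + \<theta>\<^sup>2 / 2 * (f0 x * (q x)\<^sup>2) + 2 * (r \<theta> x)\<^sup>2)"
    have \<Delta>_le: "\<bar>?\<Delta> x\<bar> \<le> ?E x" for x
    proof -
      have "?\<Delta> x = h x * ((sqrt (g \<theta> x))\<^sup>2 - (sqrt (f0 x))\<^sup>2 - \<theta> * q x * (sqrt (f0 x))\<^sup>2)"
        using pos by (simp add: algebra_simps)
      also have "\<bar>\<dots>\<bar> \<le> c * (w \<theta> * (sqrt (f0 x))\<^sup>2 + (r \<theta> x)\<^sup>2 / w \<theta> + \<theta>\<^sup>2 / 2 * ((sqrt (f0 x))\<^sup>2 * (q x)\<^sup>2) + 2 * (r \<theta> x)\<^sup>2)"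
        unfolding abs_mult r_def
        using h(2) c w_pos by (intro mult_mono score_remainder_le) auto
      finally show ?thesis
        using pos by simp
    qed
    have int_gh: "integrable lborel (\<lambda>x. g \<theta> x * h x)" "integrable lborel (\<lambda>x. f0 x * h x)"
      by (rule integrable_density_mult[OF g\<theta> h] integrable_density_mult[OF f0 h])+
    have int_fhq: "integrable lborel (\<lambda>x. f0 x * (h x * q x))"
      using hq by (simp add: integrable_law_iff[OF f0])
    have e1: "(\<integral>x. ?\<Delta> x \<partial>lborel) =
        (\<integral>x. h x \<partial>law (g \<theta>)) - (\<integral>x. h x \<partial>law f0) - \<theta> * (\<integral>x. h x * q x \<partial>law f0)"
      using int_gh int_fhq by (simp add: integral_law[OF f0] integral_law[OF g\<theta>])
    have e2: "\<bar>\<integral>x. ?\<Delta> x \<partial>lborel\<bar> \<le> (\<integral>x. ?E x \<partial>lborel)"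
    proof (rule order.trans[OF integral_abs_bound], rule integral_mono)
      show "integrable lborel (\<lambda>x. \<bar>?\<Delta> x\<bar>)"
        using int_gh int_fhq by simp
      show "integrable lborel ?E"
        using int r2 f0q2 by simp
    qed (rule \<Delta>_le)
    have e3: "(\<integral>x. ?E x \<partial>lborel) = c * (w \<theta> + (N \<theta>)\<^sup>2 / w \<theta> + \<theta>\<^sup>2 / 2 * I + 2 * (N \<theta>)\<^sup>2)"
      using int r2 f0q2 prob_density_integral(2)[OF f0] by (simp add: N2)
    have e4: "(N \<theta>)\<^sup>2 / w \<theta> \<le> w \<theta>"
      using N_nonneg w_pos power_mono[of "N \<theta>" "w \<theta>" 2] by (simp add: w_def divide_le_eq power2_eq_square)
    have "\<bar>(\<integral>x. h x \<partial>law (g \<theta>)) - (\<integral>x. h x \<partial>law f0) - \<theta> * (\<integral>x. h x * q x \<partial>law f0)\<bar> \<le>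
        c * (w \<theta> + (N \<theta>)\<^sup>2 / w \<theta> + \<theta>\<^sup>2 / 2 * I + 2 * (N \<theta>)\<^sup>2)"
      using e2 unfolding e1 e3 .
    also have "\<dots> \<le> c * (w \<theta> + w \<theta> + \<theta>\<^sup>2 / 2 * I + 2 * (N \<theta>)\<^sup>2)"
      using e4 c by (intro mult_left_mono add_mono order_refl)
    finally have "\<bar>(\<integral>x. h x \<partial>law (g \<theta>)) - (\<integral>x. h x \<partial>law f0) - \<theta> * (\<integral>x. h x * q x \<partial>law f0)\<bar> \<le>
        c * (w \<theta> + w \<theta> + \<theta>\<^sup>2 / 2 * I + 2 * (N \<theta>)\<^sup>2)" .
    then have "\<bar>(\<integral>x. h x \<partial>law (g \<theta>)) - (\<integral>x. h x \<partial>law f0) - \<theta> * (\<integral>x. h x * q x \<partial>law f0)\<bar> / \<theta> \<le>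
        c * (w \<theta> + w \<theta> + \<theta>\<^sup>2 / 2 * I + 2 * (N \<theta>)\<^sup>2) / \<theta>"
      using that by (intro divide_right_mono) auto
    also have "\<dots> = c * (2 * (N \<theta> / \<theta> + \<theta>) + \<theta> / 2 * I + 2 * (N \<theta> / \<theta>)\<^sup>2 * \<theta>)"
      using that by (simp add: w_def power2_eq_square field_simps)
    also have "\<bar>(\<integral>x. h x \<partial>law (g \<theta>)) - (\<integral>x. h x \<partial>law f0) - \<theta> * (\<integral>x. h x * q x \<partial>law f0)\<bar> / \<theta> =
        \<bar>((\<integral>x. h x \<partial>law (g \<theta>)) - (\<integral>x. h x \<partial>law f0)) / \<theta> - (\<integral>x. h x * q x \<partial>law f0)\<bar>"
    proof -
      have "((\<integral>x. h x \<partial>law (g \<theta>)) - (\<integral>x. h x \<partial>law f0)) / \<theta> - (\<integral>x. h x * q x \<partial>law f0) =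
          ((\<integral>x. h x \<partial>law (g \<theta>)) - (\<integral>x. h x \<partial>law f0) - \<theta> * (\<integral>x. h x * q x \<partial>law f0)) / \<theta>"
        using that by (simp add: field_simps)
      then show ?thesis
        using that by (simp add: abs_divide)
    qed
    finally show ?thesis .
  qed
  have "((\<lambda>\<theta>. c * (2 * (N \<theta> / \<theta> + \<theta>) + \<theta> / 2 * I + 2 * (N \<theta> / \<theta>)\<^sup>2 * \<theta>)) \<longlongrightarrow>
      c * (2 * (0 + 0) + 0 / 2 * I + 2 * 0\<^sup>2 * 0)) (at_right 0)"
    by (intro tendsto_intros N_lim) auto
  then have lim: "((\<lambda>\<theta>. c * (2 * (N \<theta> / \<theta> + \<theta>) + \<theta> / 2 * I + 2 * (N \<theta> / \<theta>)\<^sup>2 * \<theta>)) \<longlongrightarrow> 0) (at_right 0)"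
    by simp
  have "\<forall>\<^sub>F \<theta> in at_right 0. norm (((\<integral>x. h x \<partial>law (g \<theta>)) - (\<integral>x. h x \<partial>law f0)) / \<theta> - (\<integral>x. h x * q x \<partial>law f0)) \<le>
      c * (2 * (N \<theta> / \<theta> + \<theta>) + \<theta> / 2 * I + 2 * (N \<theta> / \<theta>)\<^sup>2 * \<theta>)"
    using eventually_at_right_less[of 0] by eventually_elim (use bound in simp)
  then show ?thesis
    by (rule LIM_zero_cancel[OF Lim_null_comparison[OF _ lim]])
qed

lemma expectation_continuous_family:
  fixes h :: "real \<Rightarrow> real"
  assumes "local_family f0 g q" "prob_density f0" "h \<in> borel_measurable borel" "\<And>x. \<bar>h x\<bar> \<le> c"
  shows "((\<lambda>\<theta>. \<integral>x. h x \<partial>law (g \<theta>)) \<longlongrightarrow> (\<integral>x. h x \<partial>law f0)) (at_right 0)"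
proof -
  have "((\<lambda>\<theta>. ((\<integral>x. h x \<partial>law (g \<theta>)) - (\<integral>x. h x \<partial>law f0)) / \<theta> * \<theta>) \<longlongrightarrow> (\<integral>x. h x * q x \<partial>law f0) * 0) (at_right 0)"
    by (intro tendsto_intros score_expansion[OF assms])
  then have "((\<lambda>\<theta>. (\<integral>x. h x \<partial>law (g \<theta>)) - (\<integral>x. h x \<partial>law f0)) \<longlongrightarrow> 0) (at_right 0)"
    unfolding mult_zero_right
    by (rule Lim_transform_eventually) (rule eventually_mono[OF eventually_at_right_less[of 0]], simp)
  then show ?thesis
    by (rule LIM_zero_cancel)
qed

section \<open>The dictionary along a local family\<close>

context
  fixes \<phi> :: "real \<Rightarrow> real ^ 's" and b :: real
  assumes \<phi>: "\<phi> \<in> borel_measurable borel" and bound: "\<And>i x. \<bar>\<phi> x $ i\<bar> \<le> b"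
begin

lemma measurable_component_product: "(\<lambda>x. \<phi> x $ i * \<phi> x $ j) \<in> borel_measurable borel"
  by (intro borel_measurable_times measurable_vec_nth[OF \<phi>])

lemma abs_component_product_le: "\<bar>\<phi> x $ i * \<phi> x $ j\<bar> \<le> b * b"
  unfolding abs_mult using bound[of x i] bound[of x j] by (intro mult_mono) auto

lemma Cov_component:
  assumes f: "prob_density f"
  shows "Cov \<phi> f $ i $ j = (\<integral>x. \<phi> x $ i * \<phi> x $ j \<partial>law f) - mean \<phi> f $ i * mean \<phi> f $ j"
proof -
  interpret prob_space "law f"
    using f by (simp add: prob_density_def)
  have [simp]: "integrable (law f) (\<lambda>x. \<phi> x $ i)" for i
    by (rule integrable_law_bounded[OF f measurable_vec_nth[OF \<phi>] bound])
  have [simp]: "integrable (law f) (\<lambda>x. \<phi> x $ i * \<phi> x $ j)"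
    by (rule integrable_law_bounded[OF f measurable_component_product abs_component_product_le])
  have "(\<phi> x $ i - mean \<phi> f $ i) * (\<phi> x $ j - mean \<phi> f $ j) =
      \<phi> x $ i * \<phi> x $ j - mean \<phi> f $ j * \<phi> x $ i - mean \<phi> f $ i * \<phi> x $ j + mean \<phi> f $ i * mean \<phi> f $ j" for x
    by (simp add: algebra_simps)
  then have "Cov \<phi> f $ i $ j = (\<integral>x. \<phi> x $ i * \<phi> x $ j \<partial>law f) - mean \<phi> f $ j * (\<integral>x. \<phi> x $ i \<partial>law f)
      - mean \<phi> f $ i * (\<integral>x. \<phi> x $ j \<partial>law f) + mean \<phi> f $ i * mean \<phi> f $ j"
    using prob_space by (simp add: Cov_def)
  then show ?thesis
    by (simp add: mean_def)
qed

text \<open>Variance plus squared mean: K^T C_0 K is the variance of \<Lambda> under f_0, and its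
  mean is -J/2.\<close>

lemma second_moment_Lam:
  assumes f0: "prob_density f0" and f1: "prob_density f1" and moment: "moment_assumption \<phi> f0 f1"
  shows "(\<integral>x. (Lam \<phi> f0 f1 x)\<^sup>2 \<partial>law f0) =
    K_vec \<phi> f0 f1 \<bullet> (Cov \<phi> f0 *v K_vec \<phi> f0 f1) + (J_val \<phi> f0 f1)\<^sup>2 / 4"
proof -
  interpret prob_space "law f0"
    using f0 by (simp add: prob_density_def)
  let ?K = "K_vec \<phi> f0 f1" and ?J = "J_val \<phi> f0 f1" and ?L = "Lam \<phi> f0 f1"
  have centred: "?K \<bullet> (\<phi> x - mean \<phi> f0) = ?L x + ?J / 2" for x
    unfolding J_eq_K_inner_Y[OF \<phi> bound f0 f1 moment] Lam_def Y_vec_def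
    by (simp add: inner_diff_right inner_add_right field_simps)
  have L_le: "\<bar>?L x\<bar> \<le> norm ?K * (real CARD('s) * (2 * b))" for x
    by (rule abs_Lam_le[OF \<phi> bound f0 f1])
  note measurable_Lam[OF \<phi> bound, measurable]
  have [simp]: "integrable (law f0) ?L"
    by (rule integrable_law_bounded[OF f0 _ L_le]) simp
  have "(?L x)\<^sup>2 \<le> (norm ?K * (real CARD('s) * (2 * b)))\<^sup>2" for x
    by (subst power2_abs[symmetric]) (intro power_mono L_le abs_ge_zero)
  then have [simp]: "integrable (law f0) (\<lambda>x. (?L x)\<^sup>2)"
    by (intro integrable_law_bounded[OF f0, where c = "(norm ?K * (real CARD('s) * (2 * b)))\<^sup>2"]) auto
  have "?K \<bullet> (Cov \<phi> f0 *v ?K) = (\<integral>x. (?L x + ?J / 2) * (?L x + ?J / 2) \<partial>law f0)"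
    unfolding inner_Cov[OF \<phi> bound f0] centred ..
  also have "\<dots> = (\<integral>x. (?L x)\<^sup>2 + ?J * ?L x + ?J\<^sup>2 / 4 \<partial>law f0)"
    by (intro Bochner_Integration.integral_cong) (simp_all add: power2_eq_square field_simps)
  also have "\<dots> = (\<integral>x. (?L x)\<^sup>2 \<partial>law f0) + ?J * (\<integral>x. ?L x \<partial>law f0) + ?J\<^sup>2 / 4"
    using prob_space by simp
  finally show ?thesis
    unfolding expectation_Lam[OF \<phi> bound f0 f1 moment] by (simp add: power2_eq_square)
qed

context
  fixes f0 q :: "real \<Rightarrow> real" and g :: "real \<Rightarrow> real \<Rightarrow> real"
  assumes f0: "prob_density f0" and fam: "local_family f0 g q"
    and moment: "\<And>\<theta>. 0 < \<theta> \<Longrightarrow> moment_assumption \<phi> f0 (g \<theta>)"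
    and Y: "\<And>\<theta>. 0 < \<theta> \<Longrightarrow> Y_vec \<phi> f0 (g \<theta>) \<noteq> 0"
begin

lemma prob_density_family: "0 < \<theta> \<Longrightarrow> prob_density (g \<theta>)"
  using fam by (simp add: local_family_def)

lemma positive_definite_C0: "positive_definite (Cov \<phi> f0)"
  using moment[of 1] by (simp add: moment_assumption_def)

lemma mean_tendsto: "((\<lambda>\<theta>. mean \<phi> (g \<theta>) $ i) \<longlongrightarrow> mean \<phi> f0 $ i) (at_right 0)"
  using expectation_continuous_family[OF fam f0 measurable_vec_nth[OF \<phi>] bound]
  by (simp add: mean_def)

lemma Y_tendsto: "((\<lambda>\<theta>. (1 / \<theta>) *\<^sub>R Y_vec \<phi> f0 (g \<theta>)) \<longlongrightarrow> score_vec \<phi> f0 q) (at_right 0)"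
proof (rule vec_tendstoI)
  fix i
  let ?h = "\<lambda>x. (\<phi> x - mean \<phi> f0) $ i"
  have h: "?h \<in> borel_measurable borel" "\<And>x. \<bar>?h x\<bar> \<le> 2 * b"
  proof -
    show "?h \<in> borel_measurable borel"
      unfolding vector_minus_component by (intro borel_measurable_diff measurable_vec_nth[OF \<phi>] borel_measurable_const)
    show "\<bar>?h x\<bar> \<le> 2 * b" for x
      using bound[of x i] abs_mean_le[OF \<phi> bound f0, of i] unfolding vector_minus_component by linarith
  qed
  have mean: "(\<integral>x. ?h x \<partial>law f) = mean \<phi> f $ i - mean \<phi> f0 $ i" if "prob_density f" for f
  proof -
    interpret prob_space "law f"
      using that by (simp add: prob_density_def)
    have "integrable (law f) (\<lambda>x. \<phi> x $ i)"
      by (rule integrable_law_bounded[OF that measurable_vec_nth[OF \<phi>] bound])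
    then have "(\<integral>x. \<phi> x $ i - mean \<phi> f0 $ i \<partial>law f) = (\<integral>x. \<phi> x $ i \<partial>law f) - mean \<phi> f0 $ i"
      using prob_space by simp
    then show ?thesis
      by (simp add: mean_def)
  qed
  have "((\<lambda>\<theta>. ((\<integral>x. ?h x \<partial>law (g \<theta>)) - (\<integral>x. ?h x \<partial>law f0)) / \<theta>) \<longlongrightarrow> score_vec \<phi> f0 q $ i) (at_right 0)"
    using score_expansion[OF fam f0 h] by (simp add: score_vec_def)
  then show "((\<lambda>\<theta>. ((1 / \<theta>) *\<^sub>R Y_vec \<phi> f0 (g \<theta>)) $ i) \<longlongrightarrow> score_vec \<phi> f0 q $ i) (at_right 0)"
  proof (rule Lim_transform_eventually)
    show "\<forall>\<^sub>F \<theta> in at_right 0. ((\<integral>x. ?h x \<partial>law (g \<theta>)) - (\<integral>x. ?h x \<partial>law f0)) / \<theta> = ((1 / \<theta>) *\<^sub>R Y_vec \<phi> f0 (g \<theta>)) $ i"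
      using eventually_at_right_less[of 0]
    proof eventually_elim
      case (elim \<theta>)
      then show ?case
        unfolding mean[OF f0] mean[OF prob_density_family[OF elim]] by (simp add: Y_vec_def)
    qed
  qed
qed

lemma Cov_diff_tendsto: "((\<lambda>\<theta>. (Cov \<phi> (g \<theta>) - Cov \<phi> f0) $ i $ j) \<longlongrightarrow> 0) (at_right 0)"
proof -
  have "((\<lambda>\<theta>. (\<integral>x. \<phi> x $ i * \<phi> x $ j \<partial>law (g \<theta>)) - mean \<phi> (g \<theta>) $ i * mean \<phi> (g \<theta>) $ j - Cov \<phi> f0 $ i $ j) \<longlongrightarrow>
      (\<integral>x. \<phi> x $ i * \<phi> x $ j \<partial>law f0) - mean \<phi> f0 $ i * mean \<phi> f0 $ j - Cov \<phi> f0 $ i $ j) (at_right 0)"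
    by (intro tendsto_intros mean_tendsto
        expectation_continuous_family[OF fam f0 measurable_component_product abs_component_product_le])
  then have "((\<lambda>\<theta>. (\<integral>x. \<phi> x $ i * \<phi> x $ j \<partial>law (g \<theta>)) - mean \<phi> (g \<theta>) $ i * mean \<phi> (g \<theta>) $ j - Cov \<phi> f0 $ i $ j) \<longlongrightarrow> 0) (at_right 0)"
    by (simp add: Cov_component[OF f0])
  then show ?thesis
    by (rule Lim_transform_eventually)
      (rule eventually_mono[OF eventually_at_right_less[of 0]], simp add: Cov_component prob_density_family)
qed

text \<open>Isolates the part of F that survives in the limit; the remaining matrix tends to 0
  entrywise.\<close>

lemma F_mult_eq:
  "F_mat \<phi> f0 (g \<theta>) *v v = 2 *\<^sub>R (Cov \<phi> f0 *v v) + (Cov \<phi> (g \<theta>) - Cov \<phi> f0) *v v"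
  by (simp add: F_mat_def matrix_vector_mult_add_rdistrib matrix_vector_mult_diff_rdistrib scaleR_2)

text \<open>Continuity of matrix inversion is avoided. The vector k = K/\<theta> solves 2 C_0 k = y
  - A k, where A tends to 0. Since F dominates the coercive C_0, k is bounded in terms of y, hence A
  k tends to 0, and only the fixed inverse of C_0 is applied.\<close>

lemma K_tendsto:
  "((\<lambda>\<theta>. (1 / \<theta>) *\<^sub>R K_vec \<phi> f0 (g \<theta>)) \<longlongrightarrow> (1/2) *\<^sub>R (matrix_inv (Cov \<phi> f0) *v score_vec \<phi> f0 q)) (at_right 0)"
proof -
  let ?C = "Cov \<phi> f0" and ?S = "score_vec \<phi> f0 q"
  define k where "k \<theta> = (1 / \<theta>) *\<^sub>R K_vec \<phi> f0 (g \<theta>)" for \<theta>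
  define y where "y \<theta> = (1 / \<theta>) *\<^sub>R Y_vec \<phi> f0 (g \<theta>)" for \<theta>
  define A where "A \<theta> = Cov \<phi> (g \<theta>) - ?C" for \<theta>
  obtain a where a: "0 < a" "\<And>v. a * (norm v)\<^sup>2 \<le> v \<bullet> (?C *v v)"
    using positive_definite_coercive[OF positive_definite_C0] by blast
  have y_lim: "(y \<longlongrightarrow> ?S) (at_right 0)"
    unfolding y_def by (rule Y_tendsto)
  have Fk: "F_mat \<phi> f0 (g \<theta>) *v k \<theta> = y \<theta>" if "0 < \<theta>" for \<theta>
    unfolding k_def y_def
    by (simp add: matrix_vector_mult_scaleR F_mult_K[OF \<phi> bound f0 prob_density_family[OF that] moment[OF that]])
  have k_le: "norm (k \<theta>) \<le> norm (y \<theta>) / a" if "0 < \<theta>" for \<theta>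
  proof (cases "k \<theta> = 0")
    case False
    have "a * (norm (k \<theta>))\<^sup>2 \<le> k \<theta> \<bullet> (?C *v k \<theta>) + k \<theta> \<bullet> (Cov \<phi> (g \<theta>) *v k \<theta>)"
      using a(2)[of "k \<theta>"] Cov_nonneg[OF \<phi> bound prob_density_family[OF that], of "k \<theta>"] by linarith
    also have "\<dots> = k \<theta> \<bullet> y \<theta>"
      unfolding Fk[OF that, symmetric] F_mat_def by (simp add: matrix_vector_mult_add_rdistrib inner_add_right)
    also have "\<dots> \<le> norm (k \<theta>) * norm (y \<theta>)"
      by (rule norm_cauchy_schwarz)
    finally have "norm (k \<theta>) * (a * norm (k \<theta>)) \<le> norm (k \<theta>) * norm (y \<theta>)"
      by (simp add: power2_eq_square mult.left_commute)
    then have "a * norm (k \<theta>) \<le> norm (y \<theta>)"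
      using False by simp
    then show ?thesis
      using a(1) by (simp add: field_simps)
  qed (use a(1) in simp)
  have "((\<lambda>\<theta>. norm (y \<theta>)) \<longlongrightarrow> norm ?S) (at_right 0)"
    by (intro tendsto_norm y_lim)
  then have "\<forall>\<^sub>F \<theta> in at_right 0. norm (y \<theta>) < norm ?S + 1"
    by (rule order_tendstoD) simp
  then have "\<forall>\<^sub>F \<theta> in at_right 0. norm (k \<theta>) \<le> (norm ?S + 1) / a"
    using eventually_at_right_less[of 0]
  proof eventually_elim
    case (elim \<theta>)
    have "norm (y \<theta>) / a \<le> (norm ?S + 1) / a"
      using elim(1) a(1) by (intro divide_right_mono) auto
    with k_le[OF elim(2)] show ?case
      by (rule order.trans)
  qed
  then have Ak: "((\<lambda>\<theta>. A \<theta> *v k \<theta>) \<longlongrightarrow> 0) (at_right 0)"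
    unfolding A_def by (rule matrix_mult_vector_small[OF Cov_diff_tendsto])
  have "((\<lambda>\<theta>. (1/2) *\<^sub>R (matrix_inv ?C *v (y \<theta> - A \<theta> *v k \<theta>))) \<longlongrightarrow> (1/2) *\<^sub>R (matrix_inv ?C *v (?S - 0))) (at_right 0)"
    by (intro tendsto_intros y_lim Ak bounded_linear.tendsto[OF matrix_vector_mul_bounded_linear])
  then have "((\<lambda>\<theta>. (1/2) *\<^sub>R (matrix_inv ?C *v (y \<theta> - A \<theta> *v k \<theta>))) \<longlongrightarrow> (1/2) *\<^sub>R (matrix_inv ?C *v ?S)) (at_right 0)"
    by simp
  then have "(k \<longlongrightarrow> (1/2) *\<^sub>R (matrix_inv ?C *v ?S)) (at_right 0)"
  proof (rule Lim_transform_eventually)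
    show "\<forall>\<^sub>F \<theta> in at_right 0. (1/2) *\<^sub>R (matrix_inv ?C *v (y \<theta> - A \<theta> *v k \<theta>)) = k \<theta>"
      using eventually_at_right_less[of 0]
    proof eventually_elim
      case (elim \<theta>)
      have "y \<theta> - A \<theta> *v k \<theta> = 2 *\<^sub>R (?C *v k \<theta>)"
        unfolding Fk[OF elim, symmetric] F_mult_eq A_def by simp
      then show ?case
        using matrix_inv_mult_vector(2)[OF positive_definite_imp_invertible[OF positive_definite_C0], of "k \<theta>"]
        by (simp add: matrix_vector_mult_scaleR)
    qed
  qed
  then show ?thesis
    by (simp add: k_def[abs_def])
qed

lemma J_scaled_tendsto:
  "((\<lambda>\<theta>. J_val \<phi> f0 (g \<theta>) / \<theta>\<^sup>2) \<longlongrightarrow>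
    1/2 * (score_vec \<phi> f0 q \<bullet> (matrix_inv (Cov \<phi> f0) *v score_vec \<phi> f0 q))) (at_right 0)"
proof -
  have "((\<lambda>\<theta>. ((1 / \<theta>) *\<^sub>R K_vec \<phi> f0 (g \<theta>)) \<bullet> ((1 / \<theta>) *\<^sub>R Y_vec \<phi> f0 (g \<theta>))) \<longlongrightarrow>
      ((1/2) *\<^sub>R (matrix_inv (Cov \<phi> f0) *v score_vec \<phi> f0 q)) \<bullet> score_vec \<phi> f0 q) (at_right 0)"
    by (intro tendsto_inner K_tendsto Y_tendsto)
  then have "((\<lambda>\<theta>. ((1 / \<theta>) *\<^sub>R K_vec \<phi> f0 (g \<theta>)) \<bullet> ((1 / \<theta>) *\<^sub>R Y_vec \<phi> f0 (g \<theta>))) \<longlongrightarrow>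
      1/2 * (score_vec \<phi> f0 q \<bullet> (matrix_inv (Cov \<phi> f0) *v score_vec \<phi> f0 q))) (at_right 0)"
    by (simp add: inner_commute)
  then show ?thesis
  proof (rule Lim_transform_eventually)
    show "\<forall>\<^sub>F \<theta> in at_right 0. ((1 / \<theta>) *\<^sub>R K_vec \<phi> f0 (g \<theta>)) \<bullet> ((1 / \<theta>) *\<^sub>R Y_vec \<phi> f0 (g \<theta>)) = J_val \<phi> f0 (g \<theta>) / \<theta>\<^sup>2"
      using eventually_at_right_less[of 0]
      by eventually_elim (simp add: J_val_def K_vec_def inner_commute power2_eq_square)
  qed
qed

text \<open>The relevant ratio stays bounded because \<open>K\<close> enters homogeneously: it is evaluated at the
  unit vector \<open>K / norm K\<close>. No lower bound on the size of \<open>K\<close> is needed, so the case of a vanishing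
  limit direction is covered.\<close>

lemma J_over_variance_tendsto:
  "((\<lambda>\<theta>. J_val \<phi> f0 (g \<theta>) / (K_vec \<phi> f0 (g \<theta>) \<bullet> (Cov \<phi> f0 *v K_vec \<phi> f0 (g \<theta>)))) \<longlongrightarrow> 2) (at_right 0)"
proof -
  let ?C = "Cov \<phi> f0" and ?K = "\<lambda>\<theta>. K_vec \<phi> f0 (g \<theta>)"
  define A where "A \<theta> = Cov \<phi> (g \<theta>) - ?C" for \<theta>
  define n where "n \<theta> = (1 / norm (?K \<theta>)) *\<^sub>R ?K \<theta>" for \<theta>
  obtain a where a: "0 < a" "\<And>v. a * (norm v)\<^sup>2 \<le> v \<bullet> (?C *v v)"
    using positive_definite_coercive[OF positive_definite_C0] by blast
  have K_nonzero: "?K \<theta> \<noteq> 0" if "0 < \<theta>" for \<theta>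
    using F_mult_K[OF \<phi> bound f0 prob_density_family[OF that] moment[OF that]] Y[OF that] by auto
  have "((\<lambda>\<theta>. A \<theta> *v n \<theta>) \<longlongrightarrow> 0) (at_right 0)"
    unfolding A_def
  proof (rule matrix_mult_vector_small[OF Cov_diff_tendsto])
    show "\<forall>\<^sub>F \<theta> in at_right 0. norm (n \<theta>) \<le> 1"
      by (rule always_eventually) (simp add: n_def)
  qed
  then have "((\<lambda>\<theta>. norm (A \<theta> *v n \<theta>) / a) \<longlongrightarrow> norm (0 :: real ^ 's) / a) (at_right 0)"
    using a(1) by (intro tendsto_intros) auto
  then have lim: "((\<lambda>\<theta>. norm (A \<theta> *v n \<theta>) / a) \<longlongrightarrow> 0) (at_right 0)"
    by simp
  have "\<forall>\<^sub>F \<theta> in at_right 0. norm (J_val \<phi> f0 (g \<theta>) / (?K \<theta> \<bullet> (?C *v ?K \<theta>)) - 2) \<le> norm (A \<theta> *v n \<theta>) / a"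
    using eventually_at_right_less[of 0]
  proof eventually_elim
    case (elim \<theta>)
    have n1: "norm (n \<theta>) = 1"
      using K_nonzero[OF elim] by (simp add: n_def)
    then have V: "a \<le> n \<theta> \<bullet> (?C *v n \<theta>)"
      using a(2)[of "n \<theta>"] by simp
    have K_eq: "?K \<theta> = norm (?K \<theta>) *\<^sub>R n \<theta>"
      using K_nonzero[OF elim] by (simp add: n_def)
    have J: "J_val \<phi> f0 (g \<theta>) = 2 * (?K \<theta> \<bullet> (?C *v ?K \<theta>)) + ?K \<theta> \<bullet> (A \<theta> *v ?K \<theta>)"
      unfolding J_eq_quadratic[OF \<phi> bound f0 prob_density_family[OF elim] moment[OF elim]] A_def
      by (simp add: matrix_vector_mult_diff_rdistrib inner_diff_right)
    have pos: "0 < ?K \<theta> \<bullet> (?C *v ?K \<theta>)"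
      using positive_definite_C0 K_nonzero[OF elim] by (simp add: positive_definite_def)
    have "J_val \<phi> f0 (g \<theta>) / (?K \<theta> \<bullet> (?C *v ?K \<theta>)) - 2 = (?K \<theta> \<bullet> (A \<theta> *v ?K \<theta>)) / (?K \<theta> \<bullet> (?C *v ?K \<theta>))"
      unfolding J using pos by (simp add: field_simps)
    also have "\<dots> = (n \<theta> \<bullet> (A \<theta> *v n \<theta>)) / (n \<theta> \<bullet> (?C *v n \<theta>))"
      using K_nonzero[OF elim] by (subst (1 2 3 4) K_eq) (simp add: matrix_vector_mult_scaleR)
    finally have eq: "J_val \<phi> f0 (g \<theta>) / (?K \<theta> \<bullet> (?C *v ?K \<theta>)) - 2 = (n \<theta> \<bullet> (A \<theta> *v n \<theta>)) / (n \<theta> \<bullet> (?C *v n \<theta>))" .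
    have "\<bar>n \<theta> \<bullet> (A \<theta> *v n \<theta>)\<bar> \<le> norm (A \<theta> *v n \<theta>)"
      using Cauchy_Schwarz_ineq2[of "n \<theta>" "A \<theta> *v n \<theta>"] n1 by simp
    then have "\<bar>n \<theta> \<bullet> (A \<theta> *v n \<theta>)\<bar> / (n \<theta> \<bullet> (?C *v n \<theta>)) \<le> norm (A \<theta> *v n \<theta>) / a"
      using V a(1) by (intro frac_le) auto
    then show ?case
      unfolding eq using V a(1) by (simp add: abs_divide)
  qed
  then show ?thesis
    by (rule LIM_zero_cancel[OF Lim_null_comparison[OF _ lim]])
qed

text \<open>The first two moments contribute -t J/2 + t^2 (V + J^2/4)/2, where V is the variance.
  Dividing by V, with J/V tending to 2 and J to 0, gives -t + t^2/2. Division by \<theta>^2 would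
  lose the sign when the score is orthogonal to the dictionary, since J/\<theta>^2 then tends to
  0.\<close>

lemma mgf_expansion:
  assumes "0 < t"
  shows "((\<lambda>\<theta>. ((\<integral>x. exp (t * Lam \<phi> f0 (g \<theta>) x) \<partial>law f0) - 1) /
    (K_vec \<phi> f0 (g \<theta>) \<bullet> (Cov \<phi> f0 *v K_vec \<phi> f0 (g \<theta>)))) \<longlongrightarrow> t * (t - 2) / 2) (at_right 0)"
proof -
  interpret prob_space "law f0"
    using f0 by (simp add: prob_density_def)
  let ?K = "\<lambda>\<theta>. K_vec \<phi> f0 (g \<theta>)" and ?J = "\<lambda>\<theta>. J_val \<phi> f0 (g \<theta>)" and ?L = "\<lambda>\<theta>. Lam \<phi> f0 (g \<theta>)"
  define V where "V \<theta> = ?K \<theta> \<bullet> (Cov \<phi> f0 *v ?K \<theta>)" for \<theta>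
  define \<epsilon> where "\<epsilon> \<theta> = norm (?K \<theta>) * (real CARD('s) * (2 * b))" for \<theta>
  \<comment> \<open>The second moment of \<Lambda> divided by its variance; the correction J^2/(4V)
    is grouped so that the known limits of J and J/V apply.\<close>
  define G where "G \<theta> = 1 + ?J \<theta> / 4 * (?J \<theta> / V \<theta>)" for \<theta>
  have ratio: "((\<lambda>\<theta>. ?J \<theta> / V \<theta>) \<longlongrightarrow> 2) (at_right 0)"
    unfolding V_def by (rule J_over_variance_tendsto)
  have J_lim: "(?J \<longlongrightarrow> 0) (at_right 0)"
  proof -
    have "((\<lambda>\<theta>. ?J \<theta> / \<theta>\<^sup>2 * \<theta>\<^sup>2) \<longlongrightarrow>
        1/2 * (score_vec \<phi> f0 q \<bullet> (matrix_inv (Cov \<phi> f0) *v score_vec \<phi> f0 q)) * 0\<^sup>2) (at_right 0)"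
      by (intro tendsto_mult J_scaled_tendsto tendsto_power tendsto_ident_at)
    then have "((\<lambda>\<theta>. ?J \<theta> / \<theta>\<^sup>2 * \<theta>\<^sup>2) \<longlongrightarrow> 0) (at_right 0)"
      by simp
    then show ?thesis
      by (rule Lim_transform_eventually) (rule eventually_mono[OF eventually_at_right_less[of 0]], simp)
  qed
  have \<epsilon>_lim: "(\<epsilon> \<longlongrightarrow> 0) (at_right 0)"
  proof -
    have "((\<lambda>\<theta>. norm (\<theta> *\<^sub>R (1 / \<theta>) *\<^sub>R ?K \<theta>) * (real CARD('s) * (2 * b))) \<longlongrightarrow>
        norm (0 *\<^sub>R (1/2) *\<^sub>R (matrix_inv (Cov \<phi> f0) *v score_vec \<phi> f0 q)) * (real CARD('s) * (2 * b))) (at_right 0)"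
      by (intro tendsto_mult tendsto_norm tendsto_scaleR[OF tendsto_ident_at K_tendsto] tendsto_const)
    then have "((\<lambda>\<theta>. norm (\<theta> *\<^sub>R (1 / \<theta>) *\<^sub>R ?K \<theta>) * (real CARD('s) * (2 * b))) \<longlongrightarrow> 0) (at_right 0)"
      by simp
    then show ?thesis
      by (rule Lim_transform_eventually) (rule eventually_mono[OF eventually_at_right_less[of 0]], simp add: \<epsilon>_def)
  qed
  have G_lim: "(G \<longlongrightarrow> 1) (at_right 0)"
  proof -
    have "(G \<longlongrightarrow> 1 + 0 / 4 * 2) (at_right 0)"
      unfolding G_def by (intro tendsto_intros J_lim ratio) auto
    then show ?thesis
      by simp
  qed
  have err: "\<bar>(expectation (\<lambda>x. exp (t * ?L \<theta> x)) - 1) / V \<theta> - (- (t / 2) * (?J \<theta> / V \<theta>) + t\<^sup>2 / 2 * G \<theta>)\<bar> \<le> t ^ 3 / 2 * \<epsilon> \<theta> * G \<theta>"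
    if "0 < \<theta>" "t * \<epsilon> \<theta> \<le> 1" for \<theta>
  proof -
    note g\<theta> = prob_density_family[OF that(1)] and m\<theta> = moment[OF that(1)]
    have V_pos: "0 < V \<theta>"
    proof -
      have "?K \<theta> \<noteq> 0"
        using F_mult_K[OF \<phi> bound f0 g\<theta> m\<theta>] Y[OF that(1)] by auto
      then show ?thesis
        using positive_definite_C0 by (simp add: V_def positive_definite_def)
    qed
    have L_le: "\<bar>?L \<theta> x\<bar> \<le> \<epsilon> \<theta>" for x
      unfolding \<epsilon>_def by (rule abs_Lam_le[OF \<phi> bound f0 g\<theta>])
    note measurable_Lam[OF \<phi> bound, measurable]
    have int_L: "integrable (law f0) (?L \<theta>)"
      by (rule integrable_law_bounded[OF f0 _ L_le]) simp
    have "(?L \<theta> x)\<^sup>2 \<le> (\<epsilon> \<theta>)\<^sup>2" for x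
      by (subst power2_abs[symmetric]) (intro power_mono L_le abs_ge_zero)
    then have int_L2: "integrable (law f0) (\<lambda>x. (?L \<theta> x)\<^sup>2)"
      by (intro integrable_law_bounded[OF f0, where c = "(\<epsilon> \<theta>)\<^sup>2"]) auto
    have int_exp: "integrable (law f0) (\<lambda>x. exp (t * ?L \<theta> x))"
      by (rule integrable_exp_mult[OF measurable_Lam_law[OF \<phi> bound] L_le])
    have "expectation (\<lambda>x. (?L \<theta> x)\<^sup>2) = V \<theta> + (?J \<theta>)\<^sup>2 / 4"
      unfolding V_def by (rule second_moment_Lam[OF f0 g\<theta> m\<theta>])
    also have "\<dots> = V \<theta> * G \<theta>"
      using V_pos by (simp add: G_def field_simps power2_eq_square)
    finally have L2: "expectation (\<lambda>x. (?L \<theta> x)\<^sup>2) = V \<theta> * G \<theta>" .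
    have L1: "expectation (?L \<theta>) = - (?J \<theta> / 2)"
      by (simp add: expectation_Lam[OF \<phi> bound f0 g\<theta> m\<theta>])
    \<comment> \<open>One factor |\<Lambda>| of the cubic error is bounded by its supremum bound
      \<open>\<epsilon> \<theta>\<close> and the other two are kept as a square, so that after
      integration and division by V a factor tending to 0 remains.\<close>
    have pw: "\<bar>exp (t * ?L \<theta> x) - (1 + t * ?L \<theta> x + t\<^sup>2 / 2 * (?L \<theta> x)\<^sup>2)\<bar> \<le> t ^ 3 / 2 * \<epsilon> \<theta> * (?L \<theta> x)\<^sup>2" for x
    proof -
      have "\<bar>t * ?L \<theta> x\<bar> \<le> t * \<epsilon> \<theta>"
        using assms L_le by (simp add: abs_mult)
      then have "\<bar>t * ?L \<theta> x\<bar> \<le> 1"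
        using that(2) by linarith
      then have "\<bar>exp (t * ?L \<theta> x) - (1 + t * ?L \<theta> x + (t * ?L \<theta> x)\<^sup>2 / 2)\<bar> \<le> \<bar>t * ?L \<theta> x\<bar> ^ 3 / 2"
        by (rule abs_exp_minus_taylor2_le)
      also have "\<bar>t * ?L \<theta> x\<bar> ^ 3 / 2 = t ^ 3 / 2 * \<bar>?L \<theta> x\<bar> * (?L \<theta> x)\<^sup>2"
        using assms by (simp add: abs_mult power_mult_distrib power3_eq_cube power2_eq_square)
      also have "\<dots> \<le> t ^ 3 / 2 * \<epsilon> \<theta> * (?L \<theta> x)\<^sup>2"
        using assms L_le by (intro mult_right_mono mult_left_mono) auto
      finally show ?thesis
        by (simp add: power_mult_distrib)
    qed
    let ?D = "\<lambda>x. exp (t * ?L \<theta> x) - (1 + t * ?L \<theta> x + t\<^sup>2 / 2 * (?L \<theta> x)\<^sup>2)"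
    have "expectation ?D = expectation (\<lambda>x. exp (t * ?L \<theta> x)) - (1 + t * expectation (?L \<theta>) + t\<^sup>2 / 2 * expectation (\<lambda>x. (?L \<theta> x)\<^sup>2))"
      using int_L int_L2 int_exp prob_space by simp
    then have D: "expectation ?D = (expectation (\<lambda>x. exp (t * ?L \<theta> x)) - 1) - (- (t / 2) * ?J \<theta> + t\<^sup>2 / 2 * (V \<theta> * G \<theta>))"
      unfolding L1 L2 by simp
    have "\<bar>expectation ?D\<bar> \<le> expectation (\<lambda>x. t ^ 3 / 2 * \<epsilon> \<theta> * (?L \<theta> x)\<^sup>2)"
    proof (rule order.trans[OF integral_abs_bound], rule integral_mono)
      show "integrable (law f0) (\<lambda>x. \<bar>?D x\<bar>)"
        using int_L int_L2 int_exp by simp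
    qed (use int_L2 pw in auto)
    also have "\<dots> = t ^ 3 / 2 * \<epsilon> \<theta> * (V \<theta> * G \<theta>)"
      by (simp add: L2)
    finally have "\<bar>expectation ?D\<bar> / V \<theta> \<le> t ^ 3 / 2 * \<epsilon> \<theta> * (V \<theta> * G \<theta>) / V \<theta>"
      using V_pos by (intro divide_right_mono) auto
    also have "\<dots> = t ^ 3 / 2 * \<epsilon> \<theta> * G \<theta>"
      using V_pos by simp
    also have "\<bar>expectation ?D\<bar> / V \<theta> = \<bar>expectation ?D / V \<theta>\<bar>"
      using V_pos by (simp add: abs_divide)
    also have "expectation ?D / V \<theta> = (expectation (\<lambda>x. exp (t * ?L \<theta> x)) - 1) / V \<theta> - (- (t / 2) * (?J \<theta> / V \<theta>) + t\<^sup>2 / 2 * G \<theta>)"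
      unfolding D using V_pos by (simp add: field_simps)
    finally show ?thesis .
  qed
  have lim: "((\<lambda>\<theta>. t ^ 3 / 2 * \<epsilon> \<theta> * G \<theta>) \<longlongrightarrow> 0) (at_right 0)"
  proof -
    have "((\<lambda>\<theta>. t ^ 3 / 2 * \<epsilon> \<theta> * G \<theta>) \<longlongrightarrow> t ^ 3 / 2 * 0 * 1) (at_right 0)"
      by (intro tendsto_mult \<epsilon>_lim G_lim tendsto_const)
    then show ?thesis
      by simp
  qed
  have "((\<lambda>\<theta>. t * \<epsilon> \<theta>) \<longlongrightarrow> 0) (at_right 0)"
    using tendsto_mult[OF tendsto_const \<epsilon>_lim, of t] by simp
  then have "\<forall>\<^sub>F \<theta> in at_right 0. t * \<epsilon> \<theta> < 1"
    by (rule order_tendstoD) simp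
  then have "\<forall>\<^sub>F \<theta> in at_right 0. norm ((expectation (\<lambda>x. exp (t * ?L \<theta> x)) - 1) / V \<theta> -
      (- (t / 2) * (?J \<theta> / V \<theta>) + t\<^sup>2 / 2 * G \<theta>)) \<le> t ^ 3 / 2 * \<epsilon> \<theta> * G \<theta>"
    using eventually_at_right_less[of 0] by eventually_elim (use err in simp)
  then have 1: "((\<lambda>\<theta>. (expectation (\<lambda>x. exp (t * ?L \<theta> x)) - 1) / V \<theta> -
      (- (t / 2) * (?J \<theta> / V \<theta>) + t\<^sup>2 / 2 * G \<theta>)) \<longlongrightarrow> 0) (at_right 0)"
    by (rule Lim_null_comparison[OF _ lim])
  have 2: "((\<lambda>\<theta>. - (t / 2) * (?J \<theta> / V \<theta>) + t\<^sup>2 / 2 * G \<theta>) \<longlongrightarrow> - (t / 2) * 2 + t\<^sup>2 / 2 * 1) (at_right 0)"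
    by (intro tendsto_add tendsto_mult tendsto_const ratio G_lim)
  have "((\<lambda>\<theta>. (expectation (\<lambda>x. exp (t * ?L \<theta> x)) - 1) / V \<theta>) \<longlongrightarrow> - (t / 2) * 2 + t\<^sup>2 / 2 * 1) (at_right 0)"
    using tendsto_add[OF 1 2] by simp
  then show ?thesis
    by (simp add: V_def power2_eq_square field_simps)
qed

text \<open>The limit t (t - 2)/2 is negative on (0, 2) and positive beyond 2. For each fixed t its
  sign decides on which side of t the root eventually lies.\<close>

lemma theta0_tendsto: "((\<lambda>\<theta>. theta0 \<phi> f0 (g \<theta>)) \<longlongrightarrow> 2) (at_right 0)"
proof -
  let ?V = "\<lambda>\<theta>. K_vec \<phi> f0 (g \<theta>) \<bullet> (Cov \<phi> f0 *v K_vec \<phi> f0 (g \<theta>))"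
  have V_pos: "0 < ?V \<theta>" if "0 < \<theta>" for \<theta>
  proof -
    have "K_vec \<phi> f0 (g \<theta>) \<noteq> 0"
      using F_mult_K[OF \<phi> bound f0 prob_density_family[OF that] moment[OF that]] Y[OF that] by auto
    then show ?thesis
      using positive_definite_C0 by (simp add: positive_definite_def)
  qed
  show ?thesis
  proof (rule order_tendstoI)
    fix t :: real assume "t < 2"
    \<comment> \<open>The expansion requires a positive argument; any point of (0, 2) not below t
      serves.\<close>
    define t' where "t' = max 1 t"
    have t': "0 < t'" "t \<le> t'" "t' < 2"
      using \<open>t < 2\<close> by (auto simp: t'_def)
    then have "t' * (t' - 2) / 2 < 0"
      by (simp add: mult_pos_neg)
    then have "\<forall>\<^sub>F \<theta> in at_right 0. ((\<integral>x. exp (t' * Lam \<phi> f0 (g \<theta>) x) \<partial>law f0) - 1) / ?V \<theta> < 0"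
      by (rule order_tendstoD(2)[OF mgf_expansion[OF t'(1)]])
    then show "\<forall>\<^sub>F \<theta> in at_right 0. t < theta0 \<phi> f0 (g \<theta>)"
      using eventually_at_right_less[of 0]
    proof eventually_elim
      case (elim \<theta>)
      then have "(\<integral>x. exp (t' * Lam \<phi> f0 (g \<theta>) x) \<partial>law f0) < 1"
        using V_pos[OF elim(2)] by (simp add: divide_less_0_iff)
      then have "t' < theta0 \<phi> f0 (g \<theta>)"
        by (rule less_theta0[OF \<phi> bound f0 prob_density_family[OF elim(2)] moment[OF elim(2)] Y[OF elim(2)] t'(1)])
      then show ?case
        using t' by linarith
    qed
  next
    fix t :: real assume "2 < t"
    then have "0 < t * (t - 2) / 2" "0 < t"
      by auto
    then have "\<forall>\<^sub>F \<theta> in at_right 0. 0 < ((\<integral>x. exp (t * Lam \<phi> f0 (g \<theta>) x) \<partial>law f0) - 1) / ?V \<theta>"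
      by (intro order_tendstoD(1)[OF mgf_expansion])
    then show "\<forall>\<^sub>F \<theta> in at_right 0. theta0 \<phi> f0 (g \<theta>) < t"
      using eventually_at_right_less[of 0]
    proof eventually_elim
      case (elim \<theta>)
      then have "1 < (\<integral>x. exp (t * Lam \<phi> f0 (g \<theta>) x) \<partial>law f0)"
        using V_pos[OF elim(2)] by (simp add: zero_less_divide_iff)
      then show ?case
        by (rule theta0_less[OF \<phi> bound f0 prob_density_family[OF elim(2)] moment[OF elim(2)] Y[OF elim(2)] \<open>0 < t\<close>])
    qed
  qed
qed

text \<open>Numerator and denominator are both of order \<theta>^2: \<theta>_0 J/2 contributes 2 *
  1/2 * 1/2 times the quadratic form of the score vector, the divergence contributes I/2, and the
  halves cancel.\<close>

lemma efficiency_tendsto: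
  assumes KL: "(\<lambda>\<theta>. D_KL (g \<theta>) f0 - \<theta>\<^sup>2 * fisher_info f0 q / 2) \<in> o[at_right 0](\<lambda>\<theta>. \<theta>\<^sup>2)"
  shows "((\<lambda>\<theta>. efficiency \<phi> f0 (g \<theta>)) \<longlongrightarrow> kappa \<phi> f0 q) (at_right 0)"
proof -
  let ?I = "fisher_info f0 q"
  have I: "0 < ?I"
    using fam by (simp add: local_family_def)
  have "((\<lambda>\<theta>. (D_KL (g \<theta>) f0 - \<theta>\<^sup>2 * ?I / 2) / \<theta>\<^sup>2 + ?I / 2) \<longlongrightarrow> 0 + ?I / 2) (at_right 0)"
    by (intro tendsto_add smalloD_tendsto[OF KL] tendsto_const)
  then have "((\<lambda>\<theta>. D_KL (g \<theta>) f0 / \<theta>\<^sup>2) \<longlongrightarrow> 0 + ?I / 2) (at_right 0)"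
    by (rule Lim_transform_eventually)
      (rule eventually_mono[OF eventually_at_right_less[of 0]], simp add: field_simps)
  then have "((\<lambda>\<theta>. theta0 \<phi> f0 (g \<theta>) * (1/2 * (J_val \<phi> f0 (g \<theta>) / \<theta>\<^sup>2)) / (D_KL (g \<theta>) f0 / \<theta>\<^sup>2)) \<longlongrightarrow>
      2 * (1/2 * (1/2 * (score_vec \<phi> f0 q \<bullet> (matrix_inv (Cov \<phi> f0) *v score_vec \<phi> f0 q)))) / (0 + ?I / 2)) (at_right 0)"
    using I by (intro tendsto_divide tendsto_mult theta0_tendsto J_scaled_tendsto tendsto_const) auto
  then have "((\<lambda>\<theta>. theta0 \<phi> f0 (g \<theta>) * (1/2 * (J_val \<phi> f0 (g \<theta>) / \<theta>\<^sup>2)) / (D_KL (g \<theta>) f0 / \<theta>\<^sup>2)) \<longlongrightarrow> kappa \<phi> f0 q) (at_right 0)"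
    by (simp add: kappa_def)
  then show ?thesis
  proof (rule Lim_transform_eventually)
    show "\<forall>\<^sub>F \<theta> in at_right 0. theta0 \<phi> f0 (g \<theta>) * (1/2 * (J_val \<phi> f0 (g \<theta>) / \<theta>\<^sup>2)) / (D_KL (g \<theta>) f0 / \<theta>\<^sup>2) = efficiency \<phi> f0 (g \<theta>)"
      using eventually_at_right_less[of 0]
      by eventually_elim
        (simp add: efficiency_def expectation_Lam[OF \<phi> bound f0 prob_density_family moment])
  qed
qed

text \<open>The residual of the score after projection onto the span of the centred dictionary has
  second moment \<open>(1 - \<kappa>) I\<close>.\<close>

lemma kappa_bounds:
  shows "0 \<le> kappa \<phi> f0 q" "kappa \<phi> f0 q \<le> 1"
    and "kappa \<phi> f0 q = 1 \<longleftrightarrow>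
      (\<exists>a :: 's \<Rightarrow> real. AE x in law f0. q x = (\<Sum>i\<in>UNIV. a i * (\<phi> x - mean \<phi> f0) $ i))"
proof -
  interpret prob_space "law f0"
    using f0 by (simp add: prob_density_def)
  let ?C = "Cov \<phi> f0" and ?S = "score_vec \<phi> f0 q" and ?I = "fisher_info f0 q" and ?\<psi> = "\<lambda>x. \<phi> x - mean \<phi> f0"
  \<comment> \<open>The coefficients of the L^2 projection of q on the centred dictionary:
    \<open>Cw\<close> below is the system of normal equations.\<close>
  define w where "w = matrix_inv ?C *v ?S"
  have q [measurable]: "q \<in> borel_measurable borel" and q2: "integrable (law f0) (\<lambda>x. (q x)\<^sup>2)" and I: "0 < ?I"
    using fam by (auto simp: local_family_def)
  have Cw: "?C *v w = ?S"
    unfolding w_def by (rule matrix_inv_mult_vector(1)[OF positive_definite_imp_invertible[OF positive_definite_C0]])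
  note \<phi> [measurable]
  have \<psi>_le: "\<bar>v \<bullet> ?\<psi> x\<bar> \<le> norm v * (real CARD('s) * (2 * b))" for v x
  proof -
    have "\<bar>?\<psi> x $ i\<bar> \<le> 2 * b" for i
      using bound[of x i] abs_mean_le[OF \<phi> bound f0, of i] unfolding vector_minus_component by linarith
    then have "norm (?\<psi> x) \<le> real CARD('s) * (2 * b)"
      by (rule norm_le_card_mult)
    then show ?thesis
      by (intro order.trans[OF Cauchy_Schwarz_ineq2] mult_left_mono) auto
  qed
  have int_q: "integrable (law f0) (\<lambda>x. (v \<bullet> ?\<psi> x) * q x)" for v
    by (rule integrable_bounded_mult_L2[OF f0 q q2 _ \<psi>_le]) measurable
  have int_2: "integrable (law f0) (\<lambda>x. (v \<bullet> ?\<psi> x)\<^sup>2)" for v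
  proof -
    have "(v \<bullet> ?\<psi> x)\<^sup>2 \<le> (norm v * (real CARD('s) * (2 * b)))\<^sup>2" for x
      by (subst power2_abs[symmetric]) (intro power_mono \<psi>_le abs_ge_zero)
    then show ?thesis
      by (intro integrable_law_bounded[OF f0, where c = "(norm v * (real CARD('s) * (2 * b)))\<^sup>2"]) auto
  qed
  have score: "(\<integral>x. (v \<bullet> ?\<psi> x) * q x \<partial>law f0) = v \<bullet> ?S" for v
  proof -
    have "integrable (law f0) (\<lambda>x. ?\<psi> x $ i * q x)" for i
      using int_q[of "axis i 1"] by (simp add: inner_axis')
    then have "(\<integral>x. (\<Sum>i\<in>UNIV. v $ i * (?\<psi> x $ i * q x)) \<partial>law f0) = (\<Sum>i\<in>UNIV. v $ i * (\<integral>x. ?\<psi> x $ i * q x \<partial>law f0))"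
      by (simp del: vector_minus_component)
    then show ?thesis
      by (simp add: inner_vec_def score_vec_def sum_distrib_right mult.assoc del: vector_minus_component)
  qed
  have kappa_eq: "kappa \<phi> f0 q = (?S \<bullet> w) / ?I"
    by (simp add: kappa_def w_def)
  have resid: "(\<integral>x. (q x - v \<bullet> ?\<psi> x)\<^sup>2 \<partial>law f0) = ?I - 2 * (v \<bullet> ?S) + v \<bullet> (?C *v v)" for v
  proof -
    have "(\<integral>x. (q x - v \<bullet> ?\<psi> x)\<^sup>2 \<partial>law f0) = (\<integral>x. (q x)\<^sup>2 - 2 * ((v \<bullet> ?\<psi> x) * q x) + (v \<bullet> ?\<psi> x)\<^sup>2 \<partial>law f0)"
      by (intro Bochner_Integration.integral_cong) (simp_all add: power2_diff)
    also have "\<dots> = ?I - 2 * (v \<bullet> ?S) + (\<integral>x. (v \<bullet> ?\<psi> x)\<^sup>2 \<partial>law f0)"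
      using q2 int_q[of v] int_2[of v] by (simp add: fisher_info_def score)
    also have "(\<integral>x. (v \<bullet> ?\<psi> x)\<^sup>2 \<partial>law f0) = v \<bullet> (?C *v v)"
      by (simp add: inner_Cov[OF \<phi> bound f0] power2_eq_square)
    finally show ?thesis .
  qed
  have Sw: "?S \<bullet> w = w \<bullet> (?C *v w)"
    by (simp add: Cw inner_commute)
  show "0 \<le> kappa \<phi> f0 q"
    unfolding kappa_eq Sw using I Cov_nonneg[OF \<phi> bound f0, of w] by simp
  have resid_w: "(\<integral>x. (q x - w \<bullet> ?\<psi> x)\<^sup>2 \<partial>law f0) = ?I - ?S \<bullet> w"
    by (simp add: resid Cw inner_commute)
  have "0 \<le> (\<integral>x. (q x - w \<bullet> ?\<psi> x)\<^sup>2 \<partial>law f0)"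
    by (intro Bochner_Integration.integral_nonneg) simp
  then show "kappa \<phi> f0 q \<le> 1"
    unfolding kappa_eq resid_w using I by simp
  have int_resid: "integrable (law f0) (\<lambda>x. (q x - w \<bullet> ?\<psi> x)\<^sup>2)"
  proof -
    have "(q x - w \<bullet> ?\<psi> x)\<^sup>2 = (q x)\<^sup>2 - 2 * ((w \<bullet> ?\<psi> x) * q x) + (w \<bullet> ?\<psi> x)\<^sup>2" for x
      by (simp add: power2_diff)
    then show ?thesis
      using q2 int_q[of w] int_2[of w] by simp
  qed
  have "kappa \<phi> f0 q = 1 \<longleftrightarrow> (\<integral>x. (q x - w \<bullet> ?\<psi> x)\<^sup>2 \<partial>law f0) = 0"
    unfolding kappa_eq resid_w using I by auto
  also have "\<dots> \<longleftrightarrow> (AE x in law f0. (q x - w \<bullet> ?\<psi> x)\<^sup>2 = 0)"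
    using int_resid by (intro integral_nonneg_eq_0_iff_AE) auto
  also have "\<dots> \<longleftrightarrow> (AE x in law f0. q x = w \<bullet> ?\<psi> x)"
    by simp
  also have "\<dots> \<longleftrightarrow> (\<exists>v. AE x in law f0. q x = v \<bullet> ?\<psi> x)"
  proof
    assume "\<exists>v. AE x in law f0. q x = v \<bullet> ?\<psi> x"
    then obtain v where v: "AE x in law f0. q x = v \<bullet> ?\<psi> x" ..
    \<comment> \<open>Any representation of q by the dictionary solves the same normal equations, so
      its coefficient vector is w.\<close>
    have "u \<bullet> ?S = u \<bullet> (?C *v v)" for u
      unfolding score[symmetric] inner_Cov[OF \<phi> bound f0]
      using v by (intro integral_cong_AE) (auto elim: eventually_mono)
    then have "\<forall>u. u \<bullet> ?S = u \<bullet> (?C *v v)"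
      by (rule allI)
    then have "?S = ?C *v v"
      by (rule iffD1[OF vector_eq_ldot])
    then have "w = v"
      unfolding w_def
      by (simp add: matrix_inv_mult_vector(2)[OF positive_definite_imp_invertible[OF positive_definite_C0]])
    with v show "AE x in law f0. q x = w \<bullet> ?\<psi> x"
      by simp
  qed blast
  also have "\<dots> \<longleftrightarrow> (\<exists>a :: 's \<Rightarrow> real. AE x in law f0. q x = (\<Sum>i\<in>UNIV. a i * ?\<psi> x $ i))"
  proof
    assume "\<exists>v. AE x in law f0. q x = v \<bullet> ?\<psi> x"
    then obtain v where v: "AE x in law f0. q x = v \<bullet> ?\<psi> x" ..
    then have "AE x in law f0. q x = (\<Sum>i\<in>UNIV. v $ i * ?\<psi> x $ i)"
      by (simp add: inner_vec_def)
    then show "\<exists>a :: 's \<Rightarrow> real. AE x in law f0. q x = (\<Sum>i\<in>UNIV. a i * ?\<psi> x $ i)"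
      by blast
  next
    assume "\<exists>a :: 's \<Rightarrow> real. AE x in law f0. q x = (\<Sum>i\<in>UNIV. a i * ?\<psi> x $ i)"
    then obtain a :: "'s \<Rightarrow> real" where "AE x in law f0. q x = (\<Sum>i\<in>UNIV. a i * ?\<psi> x $ i)" ..
    then have "AE x in law f0. q x = (\<chi> i. a i) \<bullet> ?\<psi> x"
      by (simp add: inner_vec_def)
    then show "\<exists>v. AE x in law f0. q x = v \<bullet> ?\<psi> x"
      by blast
  qed
  finally show "kappa \<phi> f0 q = 1 \<longleftrightarrow>
      (\<exists>a :: 's \<Rightarrow> real. AE x in law f0. q x = (\<Sum>i\<in>UNIV. a i * (\<phi> x - mean \<phi> f0) $ i))" .
qed

end

end

section \<open>Asymptotics of the delay bounds\<close>

lemma tendsto_const_divide_ln_inverse: "((\<lambda>\<alpha>. c / ln (1 / \<alpha>)) \<longlongrightarrow> (0 :: real)) (at_right 0)"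
proof -
  have "filterlim (\<lambda>\<alpha> :: real. ln (1 / \<alpha>)) at_top (at_right 0)"
    using filterlim_compose[OF ln_at_top filterlim_inverse_at_top_right] by (simp add: inverse_eq_divide)
  then show ?thesis
    by (intro tendsto_divide_0[OF tendsto_const] filterlim_at_top_imp_at_infinity)
qed

lemma tendsto_const_divide_ln: "((\<lambda>\<gamma>. c / ln \<gamma>) \<longlongrightarrow> (0 :: real)) at_top"
  by (intro tendsto_divide_0[OF tendsto_const] filterlim_at_top_imp_at_infinity ln_at_top)

text \<open>With l the log threshold, a the overshoot, m = \<theta>_0 E_1 \<Lambda> and D the
  divergence, m/D is the efficiency and l/D the optimal delay. The two forms put the overshoot into
  a factor 1 + o(1) or into an added term.\<close>

lemma overshoot_ratio:
  fixes a l m D :: real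
  assumes "m \<noteq> 0" "D \<noteq> 0" "l \<noteq> 0"
  shows "(l + a) / m = (1 + a / l) / (m / D) * (l / D)"
    and "(l + a) / m = (1 / (m / D) + a / m / (l / D)) * (l / D)"
  using assms by (simp_all add: field_simps)

text \<open>The optimum has D + k in its denominator and the bound has m + k; since e = m/D \<le> 1,
  m + k is at least e (D + k). In the numerator ln((1/\<alpha> - 1)/p) is at most ln(1/\<alpha>) -
  ln p, and r collects everything except ln(1/\<alpha>).\<close>

lemma bayes_ratio_le:
  fixes a m D k p \<alpha> :: real
  defines "e \<equiv> m / D" and "r \<equiv> (a + k - ln p) / ln (1 / \<alpha>)"
  assumes "0 < m" "m \<le> D" "0 < k" "0 \<le> a" "0 < p" "0 < \<alpha>" "\<alpha> < 1" "p < 1 / \<alpha> - 1"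
  shows "(ln ((1 / \<alpha> - 1) / p) + a + k) / (m + k) \<le> (1 + r) / e * (ln (1 / \<alpha>) / (D + k))"
proof -
  have D: "0 < D" and e: "0 < e"
    using assms(3-) by (auto simp: e_def)
  have l: "0 < ln (1 / \<alpha>)"
    using assms(3-) by simp
  have "0 < ln ((1 / \<alpha> - 1) / p)"
    using assms(3-) by (intro ln_gt_zero) (simp add: less_divide_eq)
  moreover have "ln ((1 / \<alpha> - 1) / p) \<le> ln (1 / \<alpha> / p)"
  proof -
    have "0 < (1 / \<alpha> - 1) / p"
      using assms(3-) by (intro divide_pos_pos) linarith+
    moreover have "(1 / \<alpha> - 1) / p \<le> 1 / \<alpha> / p"
      using assms(3-) by (intro divide_right_mono) auto
    moreover have "0 < 1 / \<alpha> / p"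
      using assms(3-) by simp
    ultimately show ?thesis
      by (simp only: ln_le_cancel_iff)
  qed
  moreover have "ln (1 / \<alpha> / p) = ln (1 / \<alpha>) - ln p"
    using assms(3-) by (subst ln_divide_pos) auto
  ultimately have num: "0 \<le> ln ((1 / \<alpha> - 1) / p) + a + k"
    "ln ((1 / \<alpha> - 1) / p) + a + k \<le> ln (1 / \<alpha>) + (a + k - ln p)"
    using assms(3-) by linarith+
  have den: "0 < e * (D + k)" "e * (D + k) \<le> m + k"
  proof -
    show "0 < e * (D + k)"
      using D e assms(3-) by simp
    have "e \<le> 1"
      using assms(4) D by (simp add: e_def)
    then have "e * k \<le> 1 * k"
      using assms(3-) by (intro mult_right_mono) auto
    moreover have "e * D = m"
      using D by (simp add: e_def)
    ultimately show "e * (D + k) \<le> m + k"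
      by (simp add: distrib_left)
  qed
  have "(ln ((1 / \<alpha> - 1) / p) + a + k) / (m + k) \<le> (ln (1 / \<alpha>) + (a + k - ln p)) / (e * (D + k))"
    using num den by (intro frac_le) auto
  also have "ln (1 / \<alpha>) + (a + k - ln p) = (1 + r) * ln (1 / \<alpha>)"
    using l by (simp add: r_def field_simps)
  also have "(1 + r) * ln (1 / \<alpha>) / (e * (D + k)) = (1 + r) / e * (ln (1 / \<alpha>) / (D + k))"
    by simp
  finally show ?thesis .
qed

text \<open>Each o(1) in (d) is a function r tending to 0; one r serves both CUSUM and
  Shiryaev-Roberts, and for each p one r serves both delays of the Shiryaev rule.\<close>

theorem theorem5p1:
  fixes \<phi> :: "real \<Rightarrow> real ^ 's" and f0 :: "real \<Rightarrow> real"
  assumes "prob_density f0"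
    and "\<phi> \<in> borel_measurable borel"
    and "boundedness_assumption \<phi>"
  shows
   "(\<forall>f1. prob_density f1 \<and> moment_assumption \<phi> f0 f1 \<and> Y_vec \<phi> f0 f1 \<noteq> 0 \<and> D_KL_finite f1 f0 \<longrightarrow>
      (let \<Lambda> = Lam \<phi> f0 f1;
           \<theta>\<^sub>0 = theta0 \<phi> f0 f1;
           z = (\<lambda>x. \<theta>\<^sub>0 * \<Lambda> x);
           \<Lambda>max = (SUP x. \<Lambda> x);
           E1\<Lambda> = (\<integral>x. \<Lambda> x \<partial>law f1);
           D = D_KL f1 f0;
           e = efficiency \<phi> f0 f1;
           tilted = (\<lambda>x. exp (\<theta>\<^sub>0 * \<Lambda> x) * f0 x)
       in
       bdd_above (range \<Lambda>) \<and> 0 < \<Lambda>max \<and>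

       \<comment> \<open>(a)\<close>
       (\<integral>x. exp (0 * \<Lambda> x) \<partial>law f0) = 1 \<and>
       (\<exists>!\<theta>. 0 < \<theta> \<and> (\<integral>x. exp (\<theta> * \<Lambda> x) \<partial>law f0) = 1) \<and>
       0 < \<theta>\<^sub>0 \<and> (\<integral>x. exp (\<theta>\<^sub>0 * \<Lambda> x) \<partial>law f0) = 1 \<and>
       prob_density tilted \<and>
       (\<forall>(\<omega> :: nat \<Rightarrow> real) n. 1 \<le> n \<and> f0 (\<omega> n) \<noteq> 0 \<longrightarrow> tilted (\<omega> n) / f0 (\<omega> n) = exp (z (\<omega> n))) \<and>
       law tilted = density (law f0) (\<lambda>x. ennreal (exp (z x))) \<and>

       \<comment> \<open>(b)\<close>
       (\<forall>h>0. ennreal (exp h) \<le> mean_time_no_change f0 f1 (T_cusum z h)) \<and>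
       (\<forall>A>0. ennreal A \<le> mean_time_no_change f0 f1 (T_sr z A)) \<and>
       (\<forall>p B. 0 < p \<and> p < 1 \<and> 0 < B \<longrightarrow>
          PFA f0 f1 p (T_shiryaev p z B) \<le> 1 / (1 + B) \<and>
          (\<forall>f1'. prob_density f1' \<longrightarrow>
             PFA f0 f1' p (T_shiryaev p z B) = PFA f0 f1 p (T_shiryaev p z B))) \<and>

       \<comment> \<open>(c)\<close>
       E1\<Lambda> = 1/2 * J_val \<phi> f0 f1 \<and> 0 < E1\<Lambda> \<and>
       (\<forall>h>0. ADD f0 f1 (T_cusum z h) \<le> ennreal ((h + \<theta>\<^sub>0 * \<Lambda>max) / (\<theta>\<^sub>0 * E1\<Lambda>))) \<and>
       (\<forall>A>1. ADD f0 f1 (T_sr z A) \<le> ennreal ((ln A + \<theta>\<^sub>0 * \<Lambda>max) / (\<theta>\<^sub>0 * E1\<Lambda>))) \<and>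
       (\<forall>p B. 0 < p \<and> p < 1 \<and> p < B \<longrightarrow>
          ADD f0 f1 (T_shiryaev p z B) \<le>
            ennreal ((ln (B / p) + \<theta>\<^sub>0 * \<Lambda>max + lambda_p p) / (\<theta>\<^sub>0 * E1\<Lambda> + lambda_p p)) \<and>
          bayes_delay f0 f1 p (T_shiryaev p z B) \<le>
            ennreal ((ln (B / p) + \<theta>\<^sub>0 * \<Lambda>max + lambda_p p) / (\<theta>\<^sub>0 * E1\<Lambda> + lambda_p p))) \<and>

       \<comment> \<open>(d)\<close>
       0 < e \<and> e \<le> 1 \<and>
       (e = 1 \<longleftrightarrow> (AE x in law f0. ereal (\<theta>\<^sub>0 * \<Lambda> x) = log_lr f1 f0 x)) \<and>
       (\<forall>\<gamma>>1. ennreal \<gamma> \<le> mean_time_no_change f0 f1 (T_cusum z (ln \<gamma>)) \<and>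
               ennreal \<gamma> \<le> mean_time_no_change f0 f1 (T_sr z \<gamma>)) \<and>
       (\<exists>r :: real \<Rightarrow> real. (r \<longlongrightarrow> 0) at_top \<and>
          (\<forall>\<^sub>F \<gamma> in at_top.
             ADD f0 f1 (T_cusum z (ln \<gamma>)) \<le> ennreal ((1 + r \<gamma>) / e * (ln \<gamma> / D)) \<and>
             ADD f0 f1 (T_sr z \<gamma>) \<le> ennreal ((1 + r \<gamma>) / e * (ln \<gamma> / D)))) \<and>
       (\<forall>\<gamma>>1.
          ADD f0 f1 (T_cusum z (ln \<gamma>)) \<le>
            ennreal ((1 / e + \<theta>\<^sub>0 * \<Lambda>max / (\<theta>\<^sub>0 * E1\<Lambda>) / (ln \<gamma> / D)) * (ln \<gamma> / D)) \<and>
          ADD f0 f1 (T_sr z \<gamma>) \<le>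
            ennreal ((1 / e + \<theta>\<^sub>0 * \<Lambda>max / (\<theta>\<^sub>0 * E1\<Lambda>) / (ln \<gamma> / D)) * (ln \<gamma> / D))) \<and>
       (\<lambda>\<gamma>. \<theta>\<^sub>0 * \<Lambda>max / (\<theta>\<^sub>0 * E1\<Lambda>) / (ln \<gamma> / D)) \<in> O[at_top](\<lambda>\<gamma>. 1 / ln \<gamma>) \<and>
       (\<forall>p. 0 < p \<and> p < 1 \<longrightarrow>
          (\<forall>\<alpha>. 0 < \<alpha> \<and> \<alpha> < 1 \<longrightarrow> PFA f0 f1 p (T_shiryaev p z (1 / \<alpha> - 1)) \<le> \<alpha>) \<and>
          (\<exists>r :: real \<Rightarrow> real. (r \<longlongrightarrow> 0) (at_right 0) \<and>
             (\<forall>\<^sub>F \<alpha> in at_right 0.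
                ADD f0 f1 (T_shiryaev p z (1 / \<alpha> - 1)) \<le>
                  ennreal ((1 + r \<alpha>) / e * (ln (1 / \<alpha>) / (D + lambda_p p))) \<and>
                bayes_delay f0 f1 p (T_shiryaev p z (1 / \<alpha> - 1)) \<le>
                  ennreal ((1 + r \<alpha>) / e * (ln (1 / \<alpha>) / (D + lambda_p p))))))))
    \<and>
    \<comment> \<open>(e)\<close>
    (\<forall>g q. local_family f0 g q \<and>
       (\<forall>\<theta>>0. moment_assumption \<phi> f0 (g \<theta>) \<and> Y_vec \<phi> f0 (g \<theta>) \<noteq> 0) \<and>
       (\<forall>\<^sub>F \<theta> in at_right 0. D_KL_finite (g \<theta>) f0) \<and>
       (\<lambda>\<theta>. D_KL (g \<theta>) f0 - \<theta>\<^sup>2 * fisher_info f0 q / 2) \<in> o[at_right 0](\<lambda>\<theta>. \<theta>\<^sup>2)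
       \<longrightarrow>
       ((\<lambda>\<theta>. theta0 \<phi> f0 (g \<theta>)) \<longlongrightarrow> 2) (at_right 0) \<and>
       ((\<lambda>\<theta>. efficiency \<phi> f0 (g \<theta>)) \<longlongrightarrow> kappa \<phi> f0 q) (at_right 0) \<and>
       0 \<le> kappa \<phi> f0 q \<and> kappa \<phi> f0 q \<le> 1 \<and>
       (kappa \<phi> f0 q = 1 \<longleftrightarrow>
          (\<exists>a :: 's \<Rightarrow> real. AE x in law f0. q x = (\<Sum>i\<in>UNIV. a i * (\<phi> x - mean \<phi> f0) $ i))))"
proof -
  have \<phi>: "\<phi> \<in> borel_measurable borel" and f0: "prob_density f0"
    using assms by auto
  obtain b where bound: "\<And>i x. \<bar>\<phi> x $ i\<bar> \<le> b"
    using assms(3) by (auto simp: boundedness_assumption_def)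
  show ?thesis
  proof ((intro conjI; intro allI impI), goal_cases)
    case (1 f1)
    then have f1: "prob_density f1" and moment: "moment_assumption \<phi> f0 f1"
      and Y: "Y_vec \<phi> f0 f1 \<noteq> 0" and fin: "D_KL_finite f1 f0"
      by auto
    have ac: "\<And>x. f0 x = 0 \<Longrightarrow> f1 x = 0"
      using moment by (simp add: moment_assumption_def)
    let ?\<Lambda> = "Lam \<phi> f0 f1" and ?\<theta>0 = "theta0 \<phi> f0 f1" and ?D = "D_KL f1 f0" and ?e = "efficiency \<phi> f0 f1"
    let ?z = "\<lambda>x. ?\<theta>0 * ?\<Lambda> x" and ?\<Lambda>max = "SUP x. ?\<Lambda> x" and ?E1 = "\<integral>x. ?\<Lambda> x \<partial>law f1"
    let ?t = "\<lambda>x. exp (?\<theta>0 * ?\<Lambda> x) * f0 x"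
    interpret P0: prob_space "law f0"
      using f0 by (simp add: prob_density_def)
    interpret P1: prob_space "law f1"
      using f1 by (simp add: prob_density_def)
    define c where "c = norm (K_vec \<phi> f0 f1) * (real CARD('s) * (2 * b))"
    have \<Lambda>_le: "\<bar>?\<Lambda> x\<bar> \<le> c" for x
      unfolding c_def by (rule abs_Lam_le[OF \<phi> bound f0 f1])
    note measurable_Lam[OF \<phi> bound, measurable]
    have bdd: "bdd_above (range ?\<Lambda>)"
      using \<Lambda>_le by (intro bdd_aboveI[of _ c]) (auto simp: abs_le_iff)
    have \<Lambda>max: "?\<Lambda> x \<le> ?\<Lambda>max" for x
      by (rule cSUP_upper[OF UNIV_I bdd])
    have E1: "?E1 = 1/2 * J_val \<phi> f0 f1"
      by (rule expectation_Lam(2)[OF \<phi> bound f0 f1 moment])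
    have E1_pos: "0 < ?E1"
      using J_pos[OF \<phi> bound f0 f1 moment Y] E1 by simp
    \<comment> \<open>The supremum dominates the mean under f_1, which is positive.\<close>
    have "?E1 \<le> ?\<Lambda>max"
      by (rule P1.integral_le_const) (auto intro: integrable_law_bounded[OF f1 _ \<Lambda>_le] \<Lambda>max)
    then have \<Lambda>max_pos: "0 < ?\<Lambda>max"
      using E1_pos by linarith
    have trivial_root: "(\<integral>x. exp (0 * ?\<Lambda> x) \<partial>law f0) = 1"
      using P0.prob_space by simp
    have ex1: "\<exists>!\<theta>. 0 < \<theta> \<and> (\<integral>x. exp (\<theta> * ?\<Lambda> x) \<partial>law f0) = 1"
      by (rule theta0_ex1[OF \<phi> bound f0 f1 moment Y])
    have \<theta>0: "0 < ?\<theta>0" and root: "(\<integral>x. exp (?\<theta>0 * ?\<Lambda> x) \<partial>law f0) = 1"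
      by (rule theta0_pos[OF \<phi> bound f0 f1 moment Y] theta0_root[OF \<phi> bound f0 f1 moment Y])+
    have z: "?z \<in> borel_measurable borel" "\<And>x. \<bar>?z x\<bar> \<le> ?\<theta>0 * c" "\<And>x. ?z x \<le> ?\<theta>0 * ?\<Lambda>max"
      using \<theta>0 \<Lambda>_le \<Lambda>max by (auto simp: abs_mult)
    have tilted: "prob_density ?t" "law ?t = density (law f0) (\<lambda>x. ennreal (exp (?z x)))"
      by (rule prob_density_tilted[OF f0 z(1,2) root] law_tilted[OF f0 z(1,2) root])+
    have ratio: "\<forall>(\<omega> :: nat \<Rightarrow> real) n. 1 \<le> n \<and> f0 (\<omega> n) \<noteq> 0 \<longrightarrow> ?t (\<omega> n) / f0 (\<omega> n) = exp (?z (\<omega> n))"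
      by simp
    have false_alarm_cusum: "\<forall>h>0. ennreal (exp h) \<le> mean_time_no_change f0 f1 (T_cusum ?z h)"
      using mean_time_T_cusum[OF f0 f1 z(1,2) root] by blast
    have false_alarm_sr: "\<forall>A>0. ennreal A \<le> mean_time_no_change f0 f1 (T_sr ?z A)"
      using mean_time_T_sr[OF f0 f1 z(1,2) root] by blast
    have false_alarm_shiryaev: "\<forall>p B. 0 < p \<and> p < 1 \<and> 0 < B \<longrightarrow>
        PFA f0 f1 p (T_shiryaev p ?z B) \<le> 1 / (1 + B) \<and>
        (\<forall>f1'. prob_density f1' \<longrightarrow> PFA f0 f1' p (T_shiryaev p ?z B) = PFA f0 f1 p (T_shiryaev p ?z B))"
    proof (intro allI impI conjI)
      fix p B :: real assume p: "0 < p \<and> p < 1 \<and> 0 < B"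
      then show "PFA f0 f1 p (T_shiryaev p ?z B) \<le> 1 / (1 + B)"
        by (intro PFA_T_shiryaev_le[OF f0 f1 z(1,2) root]) auto
      fix f1' assume "prob_density f1'"
      with p show "PFA f0 f1' p (T_shiryaev p ?z B) = PFA f0 f1 p (T_shiryaev p ?z B)"
        by (intro PFA_T_shiryaev_cong[OF f0 f1 _ z(1)]) auto
    qed
    have drift_eq: "(\<integral>x. ?z x \<partial>law f1) = ?\<theta>0 * ?E1"
      by simp
    have drift: "0 < (\<integral>x. ?z x \<partial>law f1)" and zmax: "0 \<le> ?\<theta>0 * ?\<Lambda>max"
      using \<theta>0 E1_pos \<Lambda>max_pos by (simp_all add: less_imp_le)
    have delay_cusum: "\<forall>h>0. ADD f0 f1 (T_cusum ?z h) \<le> ennreal ((h + ?\<theta>0 * ?\<Lambda>max) / (?\<theta>0 * ?E1))"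
      using ADD_T_cusum_le[OF f0 f1 z drift zmax] unfolding drift_eq by blast
    have delay_sr: "\<forall>A>1. ADD f0 f1 (T_sr ?z A) \<le> ennreal ((ln A + ?\<theta>0 * ?\<Lambda>max) / (?\<theta>0 * ?E1))"
      using ADD_T_sr_le[OF f0 f1 z drift zmax] unfolding drift_eq by blast
    have delay_shiryaev: "\<forall>p B. 0 < p \<and> p < 1 \<and> p < B \<longrightarrow>
        ADD f0 f1 (T_shiryaev p ?z B) \<le>
          ennreal ((ln (B / p) + ?\<theta>0 * ?\<Lambda>max + lambda_p p) / (?\<theta>0 * ?E1 + lambda_p p)) \<and>
        bayes_delay f0 f1 p (T_shiryaev p ?z B) \<le>
          ennreal ((ln (B / p) + ?\<theta>0 * ?\<Lambda>max + lambda_p p) / (?\<theta>0 * ?E1 + lambda_p p))"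
      using T_shiryaev_delay_le[OF f0 f1 z drift zmax] unfolding drift_eq by blast
    have gibbs_le: "?\<theta>0 * ?E1 \<le> ?D"
      using gibbs(1)[OF f0 z(1,2) root f1 ac fin] unfolding drift_eq .
    have m: "0 < ?\<theta>0 * ?E1"
      using drift unfolding drift_eq .
    \<comment> \<open>Gibbs' inequality places the divergence above the positive drift, so strict
      positivity needs no separate argument.\<close>
    then have D: "0 < ?D"
      using gibbs_le by linarith
    have e_eq: "?e = ?\<theta>0 * ?E1 / ?D"
      by (simp add: efficiency_def)
    have e: "0 < ?e" "?e \<le> 1"
      using m D gibbs_le by (auto simp: e_eq)
    have e_one: "?e = 1 \<longleftrightarrow> (AE x in law f0. ereal (?\<theta>0 * ?\<Lambda> x) = log_lr f1 f0 x)"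
    proof -
      have "?e = 1 \<longleftrightarrow> (\<integral>x. ?z x \<partial>law f1) = ?D"
        unfolding drift_eq e_eq using D by auto
      then show ?thesis
        using gibbs(2)[OF f0 z(1,2) root f1 ac fin] by simp
    qed
    have thresholds: "\<forall>\<gamma>>1. ennreal \<gamma> \<le> mean_time_no_change f0 f1 (T_cusum ?z (ln \<gamma>)) \<and>
        ennreal \<gamma> \<le> mean_time_no_change f0 f1 (T_sr ?z \<gamma>)"
    proof (intro allI impI conjI)
      fix \<gamma> :: real assume "1 < \<gamma>"
      then show "ennreal \<gamma> \<le> mean_time_no_change f0 f1 (T_cusum ?z (ln \<gamma>))"
        using false_alarm_cusum[rule_format, of "ln \<gamma>"] by simp
      show "ennreal \<gamma> \<le> mean_time_no_change f0 f1 (T_sr ?z \<gamma>)"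
        using false_alarm_sr[rule_format, of \<gamma>] \<open>1 < \<gamma>\<close> by simp
    qed
    have ADD_ln: "ADD f0 f1 (T_cusum ?z (ln \<gamma>)) \<le> ennreal ((ln \<gamma> + ?\<theta>0 * ?\<Lambda>max) / (?\<theta>0 * ?E1))"
      "ADD f0 f1 (T_sr ?z \<gamma>) \<le> ennreal ((ln \<gamma> + ?\<theta>0 * ?\<Lambda>max) / (?\<theta>0 * ?E1))" if "1 < \<gamma>" for \<gamma>
      using delay_cusum[rule_format, of "ln \<gamma>"] delay_sr[rule_format, of \<gamma>] that by auto
    have asymptotic: "\<exists>r :: real \<Rightarrow> real. (r \<longlongrightarrow> 0) at_top \<and>
        (\<forall>\<^sub>F \<gamma> in at_top.
           ADD f0 f1 (T_cusum ?z (ln \<gamma>)) \<le> ennreal ((1 + r \<gamma>) / ?e * (ln \<gamma> / ?D)) \<and>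
           ADD f0 f1 (T_sr ?z \<gamma>) \<le> ennreal ((1 + r \<gamma>) / ?e * (ln \<gamma> / ?D)))"
    proof (intro exI conjI)
      \<comment> \<open>The largest overshoot relative to the log threshold.\<close>
      let ?r = "\<lambda>\<gamma>. ?\<theta>0 * ?\<Lambda>max / ln \<gamma>"
      show "(?r \<longlongrightarrow> 0) at_top"
        by (rule tendsto_const_divide_ln)
      show "\<forall>\<^sub>F \<gamma> in at_top.
           ADD f0 f1 (T_cusum ?z (ln \<gamma>)) \<le> ennreal ((1 + ?r \<gamma>) / ?e * (ln \<gamma> / ?D)) \<and>
           ADD f0 f1 (T_sr ?z \<gamma>) \<le> ennreal ((1 + ?r \<gamma>) / ?e * (ln \<gamma> / ?D))"
        using eventually_gt_at_top[of 1]
      proof eventually_elim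
        case (elim \<gamma>)
        have "0 < ln \<gamma>"
          using elim by simp
        then have "(ln \<gamma> + ?\<theta>0 * ?\<Lambda>max) / (?\<theta>0 * ?E1) = (1 + ?r \<gamma>) / ?e * (ln \<gamma> / ?D)"
          using D m unfolding e_eq by (intro overshoot_ratio(1)) auto
        then show ?case
          using ADD_ln[OF elim] by simp
      qed
    qed
    have overshoot: "\<forall>\<gamma>>1.
        ADD f0 f1 (T_cusum ?z (ln \<gamma>)) \<le>
          ennreal ((1 / ?e + ?\<theta>0 * ?\<Lambda>max / (?\<theta>0 * ?E1) / (ln \<gamma> / ?D)) * (ln \<gamma> / ?D)) \<and>
        ADD f0 f1 (T_sr ?z \<gamma>) \<le>
          ennreal ((1 / ?e + ?\<theta>0 * ?\<Lambda>max / (?\<theta>0 * ?E1) / (ln \<gamma> / ?D)) * (ln \<gamma> / ?D))"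
    proof (intro allI impI)
      fix \<gamma> :: real assume "1 < \<gamma>"
      then have "0 < ln \<gamma>"
        by simp
      then have "(ln \<gamma> + ?\<theta>0 * ?\<Lambda>max) / (?\<theta>0 * ?E1) =
          (1 / ?e + ?\<theta>0 * ?\<Lambda>max / (?\<theta>0 * ?E1) / (ln \<gamma> / ?D)) * (ln \<gamma> / ?D)"
        using D m unfolding e_eq by (intro overshoot_ratio(2)) auto
      then show "ADD f0 f1 (T_cusum ?z (ln \<gamma>)) \<le>
          ennreal ((1 / ?e + ?\<theta>0 * ?\<Lambda>max / (?\<theta>0 * ?E1) / (ln \<gamma> / ?D)) * (ln \<gamma> / ?D)) \<and>
        ADD f0 f1 (T_sr ?z \<gamma>) \<le>
          ennreal ((1 / ?e + ?\<theta>0 * ?\<Lambda>max / (?\<theta>0 * ?E1) / (ln \<gamma> / ?D)) * (ln \<gamma> / ?D))"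
        using ADD_ln[OF \<open>1 < \<gamma>\<close>] by simp
    qed
    have overshoot_order: "(\<lambda>\<gamma>. ?\<theta>0 * ?\<Lambda>max / (?\<theta>0 * ?E1) / (ln \<gamma> / ?D)) \<in> O[at_top](\<lambda>\<gamma>. 1 / ln \<gamma>)"
    proof (rule bigoI[where c = "\<bar>?\<theta>0 * ?\<Lambda>max / (?\<theta>0 * ?E1) * ?D\<bar>"])
      have "?\<theta>0 * ?\<Lambda>max / (?\<theta>0 * ?E1) / (ln \<gamma> / ?D) = (?\<theta>0 * ?\<Lambda>max / (?\<theta>0 * ?E1) * ?D) * (1 / ln \<gamma>)" for \<gamma>
        by simp
      then show "\<forall>\<^sub>F \<gamma> in at_top. norm (?\<theta>0 * ?\<Lambda>max / (?\<theta>0 * ?E1) / (ln \<gamma> / ?D)) \<le>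
          \<bar>?\<theta>0 * ?\<Lambda>max / (?\<theta>0 * ?E1) * ?D\<bar> * norm (1 / ln \<gamma>)"
        by (intro always_eventually allI) (simp only: real_norm_def abs_mult order_refl)
    qed
    have bayes: "\<forall>p. 0 < p \<and> p < 1 \<longrightarrow>
        (\<forall>\<alpha>. 0 < \<alpha> \<and> \<alpha> < 1 \<longrightarrow> PFA f0 f1 p (T_shiryaev p ?z (1 / \<alpha> - 1)) \<le> \<alpha>) \<and>
        (\<exists>r :: real \<Rightarrow> real. (r \<longlongrightarrow> 0) (at_right 0) \<and>
           (\<forall>\<^sub>F \<alpha> in at_right 0.
              ADD f0 f1 (T_shiryaev p ?z (1 / \<alpha> - 1)) \<le>
                ennreal ((1 + r \<alpha>) / ?e * (ln (1 / \<alpha>) / (?D + lambda_p p))) \<and>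
              bayes_delay f0 f1 p (T_shiryaev p ?z (1 / \<alpha> - 1)) \<le>
                ennreal ((1 + r \<alpha>) / ?e * (ln (1 / \<alpha>) / (?D + lambda_p p)))))"
    proof (intro allI impI)
      fix p :: real assume p: "0 < p \<and> p < 1"
      have lambda_pos: "0 < lambda_p p"
        using p by (simp add: lambda_p_def)
      have "PFA f0 f1 p (T_shiryaev p ?z (1 / \<alpha> - 1)) \<le> \<alpha>" if "0 < \<alpha>" "\<alpha> < 1" for \<alpha>
        using false_alarm_shiryaev[rule_format, of p "1 / \<alpha> - 1"] p that by simp
      moreover have "\<forall>\<^sub>F \<alpha> in at_right 0.
          ADD f0 f1 (T_shiryaev p ?z (1 / \<alpha> - 1)) \<le>
            ennreal ((1 + (?\<theta>0 * ?\<Lambda>max + lambda_p p - ln p) / ln (1 / \<alpha>)) / ?e * (ln (1 / \<alpha>) / (?D + lambda_p p))) \<and>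
          bayes_delay f0 f1 p (T_shiryaev p ?z (1 / \<alpha> - 1)) \<le>
            ennreal ((1 + (?\<theta>0 * ?\<Lambda>max + lambda_p p - ln p) / ln (1 / \<alpha>)) / ?e * (ln (1 / \<alpha>) / (?D + lambda_p p)))"
      proof -
        \<comment> \<open>The condition \<alpha> < 1/(1 + p) says exactly that the threshold B =
          1/\<alpha> - 1 exceeds p, as the delay bound requires.\<close>
        have "\<forall>\<^sub>F \<alpha> in at_right (0 :: real). \<alpha> \<in> {0<..<1 / (1 + p)}"
          using p by (intro eventually_at_right_real) simp
        then show ?thesis
        proof eventually_elim
          case (elim \<alpha>)
          then have \<alpha>: "0 < \<alpha>" "\<alpha> * (1 + p) < 1"
            using p by (auto simp: field_simps)
          have "0 < \<alpha> * p"
            using \<alpha>(1) p by simp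
          with \<alpha>(2) have "\<alpha> < 1"
            by (simp add: distrib_left)
          have B: "p < 1 / \<alpha> - 1"
            using \<alpha> by (simp add: field_simps)
          have "(ln ((1 / \<alpha> - 1) / p) + ?\<theta>0 * ?\<Lambda>max + lambda_p p) / (?\<theta>0 * ?E1 + lambda_p p) \<le>
              (1 + (?\<theta>0 * ?\<Lambda>max + lambda_p p - ln p) / ln (1 / \<alpha>)) / ?e * (ln (1 / \<alpha>) / (?D + lambda_p p))"
            unfolding e_eq using p by (intro bayes_ratio_le m gibbs_le lambda_pos zmax \<alpha>(1) \<open>\<alpha> < 1\<close> B) auto
          then show ?case
            using delay_shiryaev[rule_format, of p "1 / \<alpha> - 1"] p B
            by (auto intro: order.trans ennreal_leI)
        qed
      qed
      ultimately show "(\<forall>\<alpha>. 0 < \<alpha> \<and> \<alpha> < 1 \<longrightarrow> PFA f0 f1 p (T_shiryaev p ?z (1 / \<alpha> - 1)) \<le> \<alpha>) \<and>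
        (\<exists>r :: real \<Rightarrow> real. (r \<longlongrightarrow> 0) (at_right 0) \<and>
           (\<forall>\<^sub>F \<alpha> in at_right 0.
              ADD f0 f1 (T_shiryaev p ?z (1 / \<alpha> - 1)) \<le>
                ennreal ((1 + r \<alpha>) / ?e * (ln (1 / \<alpha>) / (?D + lambda_p p))) \<and>
              bayes_delay f0 f1 p (T_shiryaev p ?z (1 / \<alpha> - 1)) \<le>
                ennreal ((1 + r \<alpha>) / ?e * (ln (1 / \<alpha>) / (?D + lambda_p p)))))"
        using tendsto_const_divide_ln_inverse[of "?\<theta>0 * ?\<Lambda>max + lambda_p p - ln p"]
        by (intro conjI exI[of _ "\<lambda>\<alpha>. (?\<theta>0 * ?\<Lambda>max + lambda_p p - ln p) / ln (1 / \<alpha>)"]) auto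
    qed
    show ?case
      unfolding Let_def by (intro conjI; fact)
  next
    case (2 g q)
    then have fam: "local_family f0 g q"
      and moment: "\<And>\<theta>. 0 < \<theta> \<Longrightarrow> moment_assumption \<phi> f0 (g \<theta>)"
      and Y: "\<And>\<theta>. 0 < \<theta> \<Longrightarrow> Y_vec \<phi> f0 (g \<theta>) \<noteq> 0"
      and KL: "(\<lambda>\<theta>. D_KL (g \<theta>) f0 - \<theta>\<^sup>2 * fisher_info f0 q / 2) \<in> o[at_right 0](\<lambda>\<theta>. \<theta>\<^sup>2)"
      by blast+
    show ?case
      by (intro conjI theta0_tendsto[OF \<phi> bound f0 fam moment Y] efficiency_tendsto[OF \<phi> bound f0 fam moment Y KL]
          kappa_bounds[OF \<phi> bound f0 fam moment Y])
  qed
qed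

end
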